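(* Let $\Lambda,\lambda,\mu$ be real parameters with $\Lambda\neq 0$ and $\lambda\neq 0$ (in the cosmological model $\mu=m^{2}$), and consider the complexified Hamiltonian system on $\mathbb{C}^{4}$ with canonical coordinates $(q_1,q_2,p_1,p_2)$ and Hamiltonian $$H=\frac12\,(p_1^2+p_2^2)+V(q_1,q_2),\qquad V(q_1,q_2)=\frac12\left[-\frac{\Lambda}{2}q_1^4-\frac{\lambda}{2}q_2^4-\mu\, q_1^2q_2^2\right].$$ Put $\lambda_1=\mu/\Lambda$, $\lambda_2=\mu/\lambda$, assume $\lambda_1\lambda_2\neq 1$, and put $$\lambda_3=\frac{\lambda_1\lambda_2-2(\lambda_1+\lambda_2)+3}{1-\lambda_1\lambda_2}.$$ Define the discrete sets $$I_1=\{p(2p-1)\mid p\in\mathbb{Z}\},\quad I_2=\left\{\tfrac18\left[-1+16\left(\tfrac13+p\right)^2\right]\,\Big|\, p\in\mathbb{Z}\right\},\quad I_3=\left\{\tfrac12\left[\tfrac34+4p(p-1)\right]\,\Big|\, p\in\mathbb{Z}\right\},$$ and $I=I_1\cup I_2\cup I_3$. If $\lambda_1,\lambda_2,\lambda_3\notin I$, then the system is non-integrable in the Liouville sense with meromorphic first integrals, i.e. it has no additional meromorphic first integral that is functionally independent of $H$.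
   Context: The system describes the flat Friedmann–Robertson–Walker universe with a conformally coupled phantom scalar field: $q_1=a$ is the scale factor, $q_2=\phi$ the rescaled field, $\Lambda$ the cosmological constant, $\lambda$ the quartic self-coupling and $m$ the mass of the field. The Hamiltonian system is $\dot q_i=\partial H/\partial p_i$, $\dot p_i=-\partial H/\partial q_i$, $i=1,2$, considered with complex time and complex phase space $\mathbb{C}^4$. A meromorphic first integral is a meromorphic function on $\mathbb{C}^4$ that is constant along solutions (equivalently, whose Poisson bracket with $H$ vanishes). Two functions are functionally independent if their differentials are linearly independent at a generic point. Since the system has two degrees of freedom, Liouville integrability with meromorphic first integrals means the existence of one meromorphic first integral functionally independent of $H$. *)

theory Defs
  imports "HOL-Analysis.Analysis"
begin

text \<open>Holomorphy in several variables: real Frechet differentiability with a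
  \<open>\<complex>\<close>-linear derivative.  It is only used for open sets.\<close>

definition mv_holomorphic_on :: "(complex^'n \<Rightarrow> complex) \<Rightarrow> (complex^'n) set \<Rightarrow> bool" where
  "mv_holomorphic_on f S \<longleftrightarrow>
     (\<forall>z\<in>S. \<exists>D. (f has_derivative D) (at z) \<and> (\<forall>c v. D (c *s v) = c * D v))"

text \<open>A meromorphic function is locally a quotient \<open>g / h\<close> of holomorphic functions with
  \<open>h\<close> not identically zero (on a connected neighbourhood).  It is represented by a total function whose values on the
  (nowhere dense) zero set of \<open>h\<close> are irrelevant.\<close>

definition mv_meromorphic_on :: "(complex^'n \<Rightarrow> complex) \<Rightarrow> (complex^'n) set \<Rightarrow> bool" where
  "mv_meromorphic_on f S \<longleftrightarrow>
     (\<forall>z\<in>S. \<exists>U g h. open U \<and> connected U \<and> z \<in> U \<and>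
        mv_holomorphic_on g U \<and> mv_holomorphic_on h U \<and> (\<exists>w\<in>U. h w \<noteq> 0) \<and>
        (\<forall>w\<in>U. h w \<noteq> 0 \<longrightarrow> f w = g w / h w))"

definition regular_points :: "(complex^'n \<Rightarrow> complex) \<Rightarrow> (complex^'n) set" where
  "regular_points f = \<Union>{U. open U \<and> mv_holomorphic_on f U}"

definition partial_deriv :: "'n \<Rightarrow> (complex^'n \<Rightarrow> complex) \<Rightarrow> complex^'n \<Rightarrow> complex" where
  "partial_deriv i f z = deriv (\<lambda>t. f (z + t *s axis i 1)) 0"

definition gradient :: "(complex^'n \<Rightarrow> complex) \<Rightarrow> complex^'n \<Rightarrow> complex^'n" where
  "gradient f z = (\<chi> i. partial_deriv i f z)"

text \<open>Linear independence (over \<open>\<complex>\<close>) of the two differentials on a dense open set.\<close>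

definition functionally_independent ::
  "(complex^'n \<Rightarrow> complex) \<Rightarrow> (complex^'n \<Rightarrow> complex) \<Rightarrow> bool" where
  "functionally_independent f g \<longleftrightarrow>
     (\<exists>W. open W \<and> closure W = UNIV \<and> W \<subseteq> regular_points f \<inter> regular_points g \<and>
        (\<forall>z\<in>W. \<forall>a b. a *s gradient f z + b *s gradient g z = 0 \<longrightarrow> a = 0 \<and> b = 0))"

text \<open>Phase space \<open>\<complex>\<^sup>4\<close>: the coordinates \<open>1, 2, 3, 4\<close> are \<open>q\<^sub>1, q\<^sub>2, p\<^sub>1, p\<^sub>2\<close>.\<close>

definition poisson_bracket ::
  "(complex^4 \<Rightarrow> complex) \<Rightarrow> (complex^4 \<Rightarrow> complex) \<Rightarrow> complex^4 \<Rightarrow> complex" where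
  "poisson_bracket f g z =
     (partial_deriv 1 f z * partial_deriv 3 g z - partial_deriv 3 f z * partial_deriv 1 g z) +
     (partial_deriv 2 f z * partial_deriv 4 g z - partial_deriv 4 f z * partial_deriv 2 g z)"

definition meromorphic_first_integral ::
  "(complex^4 \<Rightarrow> complex) \<Rightarrow> (complex^4 \<Rightarrow> complex) \<Rightarrow> bool" where
  "meromorphic_first_integral H F \<longleftrightarrow>
     mv_meromorphic_on F UNIV \<and> (\<forall>z\<in>regular_points F. poisson_bracket F H z = 0)"

definition hamiltonian_solution ::
  "(complex^4 \<Rightarrow> complex) \<Rightarrow> complex set \<Rightarrow> (complex \<Rightarrow> complex^4) \<Rightarrow> bool" where
  "hamiltonian_solution H T \<gamma> \<longleftrightarrow>
     (\<forall>t\<in>T. ((\<lambda>s. \<gamma> s $ 1) has_field_derivative partial_deriv 3 H (\<gamma> t)) (at t) \<and>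
            ((\<lambda>s. \<gamma> s $ 2) has_field_derivative partial_deriv 4 H (\<gamma> t)) (at t) \<and>
            ((\<lambda>s. \<gamma> s $ 3) has_field_derivative - partial_deriv 1 H (\<gamma> t)) (at t) \<and>
            ((\<lambda>s. \<gamma> s $ 4) has_field_derivative - partial_deriv 2 H (\<gamma> t)) (at t))"

lemma partial_deriv_eq:
  fixes f :: "complex^'n \<Rightarrow> complex"
  assumes D: "(f has_derivative D) (at z)" and lin: "\<And>c v. D (c *s v) = c * D v"
  shows "partial_deriv i f z = D (axis i 1)"
proof -
  have bl: "bounded_linear (\<lambda>t::complex. t *s (axis i 1 :: complex^'n))"
  proof (rule linear_conv_bounded_linear[THEN iffD1], rule linearI)
    show "(a + b) *s (axis i 1 :: complex^'n) = a *s axis i 1 + b *s axis i 1" for a b :: complex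
      by (simp add: vec_eq_iff algebra_simps)
    show "(r *\<^sub>R b) *s (axis i 1 :: complex^'n) = r *\<^sub>R (b *s axis i 1)" for r and b :: complex
      by (simp add: vec_eq_iff)
  qed
  have 1: "((\<lambda>t. z + t *s axis i 1) has_derivative (\<lambda>t. t *s axis i 1)) (at (0::complex))"
    using has_derivative_add[OF has_derivative_const bounded_linear_imp_has_derivative[OF bl]]
    by simp
  have 2: "(f has_derivative D) (at (z + 0 *s axis i 1))" using D by simp
  have "((\<lambda>t. f (z + t *s axis i 1)) has_derivative (\<lambda>t. D (t *s axis i 1))) (at (0::complex))"
    by (rule has_derivative_compose[OF 1 2])
  then have "((\<lambda>t. f (z + t *s axis i 1)) has_field_derivative D (axis i 1)) (at 0)"
    unfolding has_field_derivative_def by (simp add: lin mult_commute_abs)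
  then show ?thesis unfolding partial_deriv_def by (rule DERIV_imp_deriv)
qed

text \<open>A vanishing Poisson bracket indeed means conservation along complex-time solutions.\<close>

lemma first_integral_constant_along_solutions:
  assumes F: "meromorphic_first_integral H F" and sol: "hamiltonian_solution H T \<gamma>"
    and T: "open T" "connected T" and reg: "\<gamma> ` T \<subseteq> regular_points F"
  shows "(\<lambda>t. F (\<gamma> t)) constant_on T"
proof -
  have "((\<lambda>s. F (\<gamma> s)) has_field_derivative 0) (at t)" if t: "t \<in> T" for t
  proof -
    have r: "\<gamma> t \<in> regular_points F" using t reg by auto
    then obtain D where D: "(F has_derivative D) (at (\<gamma> t))" "\<And>c v. D (c *s v) = c * D v"
      unfolding regular_points_def mv_holomorphic_on_def by blast
    define v :: "complex^4" where "v = (\<chi> i. if i = 1 then partial_deriv 3 H (\<gamma> t)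
       else if i = 2 then partial_deriv 4 H (\<gamma> t)
       else if i = 3 then - partial_deriv 1 H (\<gamma> t) else - partial_deriv 2 H (\<gamma> t))"
    have vs: "v $ 1 = partial_deriv 3 H (\<gamma> t)" "v $ 2 = partial_deriv 4 H (\<gamma> t)"
       "v $ 3 = - partial_deriv 1 H (\<gamma> t)" "v $ 4 = - partial_deriv 2 H (\<gamma> t)"
      by (simp_all add: v_def)
    have comp: "((\<lambda>s. \<gamma> s $ i) has_derivative (\<lambda>s. (s *s v) $ i)) (at t)" for i
    proof -
      have "\<forall>i. ((\<lambda>s. \<gamma> s $ i) has_field_derivative v $ i) (at t)"
        using sol t unfolding forall_4 vs hamiltonian_solution_def by blast
      then show ?thesis
        unfolding has_field_derivative_def by (simp add: mult_commute_abs)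
    qed
    have g: "(\<gamma> has_derivative (\<lambda>s. s *s v)) (at t)"
      by (subst has_derivative_componentwise_within)
        (auto simp: Basis_vec_def inner_axis intro!: has_derivative_inner_left comp
              simp del: vector_smult_component)
    have sv: "v = v$1 *s axis 1 1 + v$2 *s axis 2 1 + v$3 *s axis 3 1 + v$4 *s axis 4 1"
      by (simp add: vec_eq_iff forall_4 axis_def)
    have lin: "D (a + b) = D a + D b" for a b
      using D(1) has_derivative_bounded_linear linear_simps(1) by blast
    have "D v = poisson_bracket F H (\<gamma> t)"
      apply (subst sv) unfolding lin D(2) poisson_bracket_def
      by (simp add: partial_deriv_eq[OF D] vs algebra_simps)
    then have "D v = 0" using F r unfolding meromorphic_first_integral_def by auto
    moreover have "(*) 0 = (\<lambda>x::complex. 0 :: complex)" by (simp add: fun_eq_iff)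
    ultimately show ?thesis
      using has_derivative_compose[OF g D(1)] unfolding has_field_derivative_def
      by (simp add: D(2))
  qed
  moreover from this have "continuous_on T (\<lambda>t. F (\<gamma> t))"
    by (meson DERIV_continuous_on has_field_derivative_at_within)
  ultimately show ?thesis
    by (intro DERIV_zero_connected_constant_on[OF T(2,1) finite.emptyI]) auto
qed

definition phantom_potential ::
  "real \<Rightarrow> real \<Rightarrow> real \<Rightarrow> complex \<Rightarrow> complex \<Rightarrow> complex" where
  "phantom_potential \<Lambda> lam \<mu> q1 q2 =
     1/2 * (- (of_real \<Lambda> / 2) * q1^4 - (of_real lam / 2) * q2^4 - of_real \<mu> * q1^2 * q2^2)"

definition phantom_hamiltonian :: "real \<Rightarrow> real \<Rightarrow> real \<Rightarrow> complex^4 \<Rightarrow> complex" where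
  "phantom_hamiltonian \<Lambda> lam \<mu> z =
     1/2 * ((z$3)^2 + (z$4)^2) + phantom_potential \<Lambda> lam \<mu> (z$1) (z$2)"

definition I1 :: "real set" where
  "I1 = {p * (2 * p - 1) | p. p \<in> \<int>}"

definition I2 :: "real set" where
  "I2 = {1/8 * (-1 + 16 * (1/3 + p)^2) | p. p \<in> \<int>}"

definition I3 :: "real set" where
  "I3 = {1/2 * (3/4 + 4 * p * (p - 1)) | p. p \<in> \<int>}"

end

theory Submission
  imports Defs "HOL-Complex_Analysis.Complex_Analysis"
    "HOL-Computational_Algebra.Fundamental_Theorem_Algebra"
begin

text \<open>Near the origin a meromorphic first integral is a quotient of holomorphic functions. Taking leading
  terms for the weights \<open>(1,2,2,3)\<close> replaces the Hamiltonian system by its linearisation along the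
  invariant plane \<open>q\<^sub>2 = p\<^sub>2 = 0\<close> and the integral by a quotient \<open>P / Q\<close> of quasi-homogeneous entire
  functions that is constant along the solutions of the linearised system; after subtracting polynomials
  in \<open>H\<close> from the integral, functional independence prevents \<open>P\<close> from being \<open>Q\<close> times a constant times
  a power of the planar energy.

  A second passage to leading terms makes \<open>P\<close> and \<open>Q\<close> homogeneous in \<open>(q\<^sub>2, p\<^sub>2)\<close>. Along a planar
  solution, with \<open>y = q\<^sub>1\<close> as independent variable, they become binary forms in the initial data of the
  normal variational equation, which is a pullback of Gauss' equation under \<open>y \<mapsto> y\<^sup>4\<close>. The rotation
  \<open>y \<mapsto> \<i> y\<close> and the connection between \<open>y = 0\<close> and the branch point \<open>y = 1\<close> of \<open>p\<^sub>1\<close> yield two projective maps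
  under which the quotient of the two forms is invariant up to a constant. If this quotient is not constant,
  its zeros and poles form a finite set of lines invariant under both maps. The cross-ratio of the two
  coordinate lines and their images then takes only finitely many values on the group they generate, which
  forces the squared connection coefficient to be \<open>1\<close>, \<open>1/2\<close> or \<open>0\<close>; these are the cases \<open>I1\<close>, \<open>I2\<close>
  and \<open>I3\<close> for \<open>\<mu> / \<Lambda>\<close>.\<close>

text \<open>The weights are those for which \<open>H\<close> is homogeneous, (1,1,2,2), raised by
  one for q2 and p2. Then \<open>X\<close> at \<open>dilate s z\<close> is s times
  \<open>dilate s (XV z)\<close> up to relative order s^2, so a germ of the integral at the
  equilibrium already contains the linearisation along planar orbits of all energies. Non-zero
  energies differ by scaling, leaving one orbit p1 = +-\<omega> sqrt(1 - y^4), with two sheets over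
  |y| < 1 that meet at y = 1.

  The obstacle is that y -> i y exchanges the sheets. If R is the quotient of the forms on one
  sheet, S the rotation and T the involution from passing through y = 1, one only gets R o T o S = k
  R and R o S = k R o T; the invariant lines are therefore the zeros and poles on both sheets
  together.

  Words in S and T change the cross-ratio x by x -> x (1 - 2x)^2 or x -> x (1 + 4 (1 - x)^2). From
  the squared connection coefficient, a real x >= 0, one of them produces a strictly monotone
  sequence, except at 0 and 1, which both fix, and at 1/2, which they send to 0 and 1
  respectively.\<close>

no_notation fps_nth (infixl \<open>$\<close> 75)

section \<open>Taylor estimates in one complex variable\<close>

lemma ball_max_bound:
  assumes "f holomorphic_on ball 0 S" "0 < r" "r < S"
    and "\<And>s. norm s = r \<Longrightarrow> norm (f s) \<le> B" and "norm s \<le> r"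
  shows "norm (f s) \<le> B"
proof (rule maximum_modulus_frontier[where S = "cball 0 r" and f = f and \<xi> = s])
  show "f holomorphic_on interior (cball 0 r)"
    using assms by (auto intro: holomorphic_on_subset)
  show "continuous_on (closure (cball 0 r)) f"
    using assms by (intro holomorphic_on_imp_continuous_on) (auto intro: holomorphic_on_subset)
qed (use assms in auto)

text \<open>The maximum principle is applied twice, to F / s^n and then to its difference quotient
  at 0. The constant depends on \<open>F\<close> only through the bound \<open>B\<close>; this
  uniformity later turns pointwise leading terms into locally uniform limits.\<close>

lemma taylor_leading_bound:
  assumes F: "F holomorphic_on ball 0 S" and r: "0 < r" "r < S"
    and B: "\<And>s. norm s \<le> r \<Longrightarrow> norm (F s) \<le> B"
    and L: "((\<lambda>s. F s / s^n) \<longlongrightarrow> L) (at 0)"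
    and s: "norm s \<le> r"
  shows "norm (F s - L * s^n) \<le> 2 * B / r^Suc n * norm s ^ Suc n"
proof -
  define G where "G s = (if s = 0 then L else F s / s^n)" for s
  have G: "G holomorphic_on ball 0 S"
    unfolding G_def
    by (rule removable_singularity[OF _ _ L])
      (auto intro!: holomorphic_intros holomorphic_on_subset[OF F])
  have Gb: "norm (G s) \<le> B / r^n" if "norm s \<le> r" for s
  proof (rule ball_max_bound[OF G r _ that])
    fix s :: complex assume "norm s = r"
    then show "norm (G s) \<le> B / r^n" using r B[of s]
      by (auto simp: G_def norm_divide norm_power divide_right_mono)
  qed
  define E where "E z = (if z = 0 then deriv G 0 else (G z - G 0) / (z - 0))" for z
  have E: "E holomorphic_on ball 0 S"
    unfolding E_def by (rule pole_lemma_open[OF G]) auto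
  have Eb: "norm (E s) \<le> 2 * B / r^Suc n" if "norm s \<le> r" for s
  proof (rule ball_max_bound[OF E r _ that])
    fix s :: complex assume s: "norm s = r"
    have "norm (G s - G 0) \<le> B / r^n + B / r^n"
      using Gb[of s] Gb[of 0] s r norm_triangle_ineq4[of "G s" "G 0"] by auto
    then show "norm (E s) \<le> 2 * B / r^Suc n" using s r
      by (auto simp: E_def norm_divide divide_right_mono field_simps)
  qed
  have "F s - L * s^n = E s * s^Suc n" if "s \<noteq> 0"
    using that by (simp add: E_def G_def field_simps)
  \<comment> \<open>The quotient \<open>G\<close> carries no information about \<open>F\<close> at
    0, so this point is settled by continuity; for n = 0 the value is \<open>L\<close>, otherwise
    0.\<close>
  moreover have "F 0 = L * 0 ^ n"
  proof -
    have cF: "isCont F 0"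
      using F r holomorphic_on_imp_continuous_on[OF F] continuous_on_eq_continuous_at[of "ball 0 S" F] by auto
    have "((\<lambda>s. F s / s^n * s^n) \<longlongrightarrow> L * 0^n) (at 0)"
      by (intro tendsto_intros L)
    then have "(F \<longlongrightarrow> L * 0^n) (at 0)"
      by (rule Lim_transform_eventually) (auto simp: eventually_at_filter)
    with cF show ?thesis
      unfolding isCont_def by (metis tendsto_unique trivial_limit_at)
  qed
  ultimately have "norm (F s - L * s^n) = norm (E s) * norm s ^ Suc n"
    by (cases "s = 0") (auto simp: norm_mult norm_power)
  then show ?thesis using mult_right_mono[OF Eb[OF s], of "norm s ^ Suc n"] by simp
qed

lemma taylor_next_coeff:
  assumes F: "F holomorphic_on ball 0 S" and S: "0 < S"
    and L: "((\<lambda>s. F s / s^n) \<longlongrightarrow> 0) (at 0)"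
  shows "\<exists>L'. ((\<lambda>s. F s / s^Suc n) \<longlongrightarrow> L') (at 0)"
proof -
  define G where "G s = (if s = 0 then 0 else F s / s^n)" for s
  have G: "G holomorphic_on ball 0 S"
    unfolding G_def
    by (rule removable_singularity[OF _ _ L])
      (auto intro!: holomorphic_intros holomorphic_on_subset[OF F])
  then have "(G has_field_derivative deriv G 0) (at 0)"
    using S holomorphic_derivI[OF G] by auto
  then have "((\<lambda>s. (G s - G 0) / (s - 0)) \<longlongrightarrow> deriv G 0) (at 0)"
    by (simp add: has_field_derivative_iff)
  then have "((\<lambda>s. F s / s^Suc n) \<longlongrightarrow> deriv G 0) (at 0)"
    by (rule Lim_transform_eventually) (auto simp: eventually_at_filter G_def field_simps)
  then show ?thesis by blast
qed

text \<open>The bound of order n decays like (norm s / r)^n, while \<open>B\<close> stays fixed, so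
  n may tend to infinity.\<close>

lemma taylor_all_zero:
  assumes F: "F holomorphic_on ball 0 S" and r: "0 < r" "r < S"
    and L: "\<And>n. ((\<lambda>s. F s / s^n) \<longlongrightarrow> 0) (at 0)"
    and s: "norm s < r"
  shows "F s = 0"
proof -
  have "compact (F ` cball 0 r)"
    using r by (intro compact_continuous_image holomorphic_on_imp_continuous_on)
      (auto intro: holomorphic_on_subset[OF F])
  then obtain B where B: "\<And>s. norm s \<le> r \<Longrightarrow> norm (F s) \<le> B"
    by (meson compact_imp_bounded bounded_iff image_eqI mem_cball_0)
  have "norm (F s) \<le> 2 * B * (norm s / r) ^ Suc n" for n
    using taylor_leading_bound[OF F r B L, of s n] s by (simp add: power_divide)
  moreover have "(\<lambda>n. 2 * B * (norm s / r) ^ Suc n) \<longlonglongrightarrow> 2 * B * 0"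
    using s r by (intro tendsto_intros LIMSEQ_Suc LIMSEQ_power_zero) auto
  ultimately have "norm (F s) \<le> 2 * B * 0"
    by (intro LIMSEQ_le_const) auto
  then show ?thesis by simp
qed

section \<open>Holomorphy along curves\<close>

text \<open>A weak form of holomorphy in several variables: it needs no Hartogs theorem and is stable under
  locally uniform limits, hence under passage to leading terms.\<close>

definition curve_hol :: "(complex^4 \<Rightarrow> complex) \<Rightarrow> (complex^4) set \<Rightarrow> bool" where
  "curve_hol f N \<longleftrightarrow> continuous_on N f \<and>
     (\<forall>\<phi> T. open T \<longrightarrow> (\<forall>i. (\<lambda>t. \<phi> t $ i) holomorphic_on T) \<longrightarrow> \<phi> ` T \<subseteq> N \<longrightarrow>
        (\<lambda>t. f (\<phi> t)) holomorphic_on T)"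

lemma curve_hol_imp_continuous: "curve_hol f N \<Longrightarrow> continuous_on N f"
  unfolding curve_hol_def by blast

lemma curve_hol_compose:
  assumes "curve_hol f N" "open T" "\<And>i. (\<lambda>t. \<phi> t $ i) holomorphic_on T" "\<And>t. t \<in> T \<Longrightarrow> \<phi> t \<in> N"
  shows "(\<lambda>t. f (\<phi> t)) holomorphic_on T"
  using assms unfolding curve_hol_def by blast

lemma has_derivative_curve:
  fixes \<phi> :: "complex \<Rightarrow> complex^'n"
  assumes "\<And>i. ((\<lambda>t. \<phi> t $ i) has_field_derivative v $ i) (at t)"
  shows "(\<phi> has_derivative (\<lambda>s. s *s v)) (at t)"
proof -
  have "((\<lambda>s. \<phi> s $ i) has_derivative (\<lambda>s. (s *s v) $ i)) (at t)" for i
    using assms[of i] unfolding has_field_derivative_def by (simp add: mult_commute_abs)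
  then show ?thesis
    by (subst has_derivative_componentwise_within)
      (auto simp: Basis_vec_def inner_axis intro!: has_derivative_inner_left
        simp del: vector_smult_component)
qed

lemma has_field_derivative_along_curve:
  fixes \<phi> :: "complex \<Rightarrow> complex^'n"
  assumes D: "(f has_derivative D) (at (\<phi> t))" "\<And>c v. D (c *s v) = c * D v"
    and \<phi>: "\<And>i. ((\<lambda>t. \<phi> t $ i) has_field_derivative v $ i) (at t)"
  shows "((\<lambda>t. f (\<phi> t)) has_field_derivative D v) (at t)"
  using has_derivative_compose[OF has_derivative_curve[OF \<phi>] D(1)]
  unfolding has_field_derivative_def by (simp add: D(2) mult_commute_abs)

lemma continuous_curve:
  fixes \<phi> :: "complex \<Rightarrow> complex^'n"
  assumes "\<And>i. (\<lambda>t. \<phi> t $ i) holomorphic_on T"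
  shows "continuous_on T \<phi>"
proof -
  have "continuous_on T (\<lambda>t. \<chi> i. \<phi> t $ i)"
    using assms by (intro continuous_on_vec_lambda holomorphic_on_imp_continuous_on)
  then show ?thesis by simp
qed

lemma mv_holomorphic_imp_curve_hol:
  assumes f: "mv_holomorphic_on f N"
  shows "curve_hol f N"
  unfolding curve_hol_def
proof (intro conjI allI impI)
  show "continuous_on N f"
    using f unfolding mv_holomorphic_on_def
    by (meson continuous_at_imp_continuous_on has_derivative_continuous)
  fix \<phi> T assume T: "open T" and \<phi>: "\<forall>i. (\<lambda>t. \<phi> t $ i) holomorphic_on T" and im: "\<phi> ` T \<subseteq> N"
  show "(\<lambda>t. f (\<phi> t)) holomorphic_on T"
    unfolding holomorphic_on_open[OF T]
  proof
    fix t assume t: "t \<in> T"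
    then obtain D where D: "(f has_derivative D) (at (\<phi> t))" "\<And>c v. D (c *s v) = c * D v"
      using f im unfolding mv_holomorphic_on_def by blast
    have "((\<lambda>t. \<phi> t $ i) has_field_derivative (\<chi> i. deriv (\<lambda>t. \<phi> t $ i) t) $ i) (at t)" for i
      using holomorphic_derivI[OF \<phi>[rule_format] T t] by simp
    from has_field_derivative_along_curve[OF D this]
    show "\<exists>f'. ((\<lambda>t. f (\<phi> t)) has_field_derivative f') (at t)" by blast
  qed
qed

lemma curve_hol_subset: "curve_hol f N \<Longrightarrow> M \<subseteq> N \<Longrightarrow> curve_hol f M"
  unfolding curve_hol_def by (meson continuous_on_subset subset_trans)

lemma curve_hol_const [simp, intro]: "curve_hol (\<lambda>z. c) N"
  and curve_hol_nth [simp, intro]: "curve_hol (\<lambda>z. z $ i) N"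
  unfolding curve_hol_def by (auto intro!: continuous_intros)

lemma curve_hol_add: "curve_hol f N \<Longrightarrow> curve_hol g N \<Longrightarrow> curve_hol (\<lambda>z. f z + g z) N"
  and curve_hol_diff: "curve_hol f N \<Longrightarrow> curve_hol g N \<Longrightarrow> curve_hol (\<lambda>z. f z - g z) N"
  and curve_hol_mult: "curve_hol f N \<Longrightarrow> curve_hol g N \<Longrightarrow> curve_hol (\<lambda>z. f z * g z) N"
  and curve_hol_power: "curve_hol f N \<Longrightarrow> curve_hol (\<lambda>z. f z ^ n) N"
  unfolding curve_hol_def by (auto intro!: continuous_intros holomorphic_intros)

section \<open>Weighted leading terms\<close>

definition scal :: "(4 \<Rightarrow> nat) \<Rightarrow> complex \<Rightarrow> complex^4 \<Rightarrow> complex^4" where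
  "scal w s z = (\<chi> i. s ^ w i * z $ i)"

lemma scal_nth [simp]: "scal w s z $ i = s ^ w i * z $ i"
  by (simp add: scal_def)

lemma scal_1 [simp]: "scal w 1 z = z"
  by (simp add: vec_eq_iff)

lemma scal_scal: "scal w s (scal w t z) = scal w (s * t) z"
  by (simp add: vec_eq_iff power_mult_distrib)

lemma scal_commute: "scal w s (scal w' t z) = scal w' t (scal w s z)"
  by (simp add: vec_eq_iff)

lemma continuous_on_scal [continuous_intros]:
  "continuous_on X f \<Longrightarrow> continuous_on X g \<Longrightarrow> continuous_on X (\<lambda>x. scal w (f x) (g x))"
  unfolding scal_def by (intro continuous_intros)

text \<open>Uniform over bounded sets of \<open>z\<close>. Balls around 0 qualify when all weights
  are positive; the weights with zero entries used later are applied to entire functions, with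
  \<open>N = UNIV\<close>.\<close>

definition dilatable :: "(4 \<Rightarrow> nat) \<Rightarrow> (complex^4) set \<Rightarrow> bool" where
  "dilatable w N \<longleftrightarrow> (\<forall>R. \<exists>S>0. \<forall>z s. norm z \<le> R \<longrightarrow> norm s \<le> S \<longrightarrow> scal w s z \<in> N)"

lemma dilatable_point:
  assumes "dilatable w N" shows "\<exists>S>0. \<forall>s. norm s \<le> S \<longrightarrow> scal w s z \<in> N"
  using assms order_refl[of "norm z"] unfolding dilatable_def by blast

lemma dilatable_UNIV [simp]: "dilatable w UNIV"
  unfolding dilatable_def by (meson UNIV_I zero_less_one)

lemma norm_vec_le_norm: 
  fixes x y :: "complex^'n"
  assumes "\<And>i. norm (x $ i) \<le> norm (y $ i)" shows "norm x \<le> norm y"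
  unfolding norm_vec_def by (intro L2_set_mono assms) auto

lemma norm_scal_le:
  assumes w: "\<And>i. w i \<noteq> 0" and s: "norm s \<le> 1"
  shows "norm (scal w s z) \<le> norm s * norm z"
proof -
  have "norm (scal w s z) \<le> norm (s *s z)"
  proof (rule norm_vec_le_norm)
    fix i
    have "norm s ^ w i \<le> norm s ^ 1"
      using w[of i] s by (intro power_decreasing) auto
    then show "norm (scal w s z $ i) \<le> norm ((s *s z) $ i)"
      by (auto simp: norm_mult norm_power intro: mult_right_mono)
  qed
  also have "norm (s *s z) = norm s * norm z"
    unfolding norm_vec_def by (simp add: norm_mult L2_set_right_distrib)
  finally show ?thesis .
qed

lemma dilatable_ball:
  assumes "\<And>i. w i \<noteq> 0" "0 < e"
  shows "dilatable w (ball 0 e)"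
  unfolding dilatable_def
proof
  fix R :: real
  define S where "S = min 1 (e / (2 * (\<bar>R\<bar> + 1)))"
  have S: "0 < S" using assms by (auto simp: S_def)
  show "\<exists>S>0. \<forall>z s. norm z \<le> R \<longrightarrow> norm s \<le> S \<longrightarrow> scal w s z \<in> ball 0 e"
  proof (intro exI conjI allI impI)
    show "0 < S" by fact
    fix z :: "complex^4" and s :: complex assume z: "norm z \<le> R" and s: "norm s \<le> S"
    have "norm (scal w s z) \<le> norm s * norm z"
      using norm_scal_le[OF assms(1)] s by (auto simp: S_def)
    also have "\<dots> \<le> (e / (2 * (\<bar>R\<bar> + 1))) * (\<bar>R\<bar> + 1)"
      using z s assms(2) by (intro mult_mono) (auto simp: S_def)
    also have "\<dots> < e" using assms by (auto simp: field_simps add_pos_nonneg)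
    finally show "scal w s z \<in> ball 0 e" by simp
  qed
qed

lemma dilation_bounded:
  assumes f: "curve_hol f N" and N: "dilatable w N"
  shows "\<exists>S>0. \<exists>B. \<forall>z s. norm z \<le> R \<longrightarrow> norm s \<le> S \<longrightarrow> scal w s z \<in> N \<and> norm (f (scal w s z)) \<le> B"
proof -
  obtain S where S: "S > 0" "\<And>z s. norm z \<le> R \<Longrightarrow> norm s \<le> S \<Longrightarrow> scal w s z \<in> N"
    using N unfolding dilatable_def by meson
  define K where "K = (\<lambda>(s, z). scal w s z) ` (cball 0 S \<times> cball 0 R)"
  have "compact K"
    unfolding K_def case_prod_beta by (intro compact_continuous_image continuous_intros compact_Times) auto
  moreover have KN: "K \<subseteq> N" using S by (auto simp: K_def)
  ultimately have "compact (f ` K)"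
    using f unfolding curve_hol_def by (meson compact_continuous_image continuous_on_subset)
  then obtain B where B: "\<And>z. z \<in> K \<Longrightarrow> norm (f z) \<le> B"
    by (meson compact_imp_bounded bounded_iff image_eqI)
  have "scal w s z \<in> K" if "norm z \<le> R" "norm s \<le> S" for z s
    using that unfolding K_def by (intro image_eqI[of _ _ "(s, z)"]) auto
  with S B show ?thesis by blast
qed

lemma dilation_holomorphic:
  assumes f: "curve_hol f N" and "open T" "\<And>s. s \<in> T \<Longrightarrow> scal w s z \<in> N"
  shows "(\<lambda>s. f (scal w s z)) holomorphic_on T"
  by (rule curve_hol_compose[OF f]) (use assms in \<open>auto intro!: holomorphic_intros\<close>)

text \<open>The limit \<open>P\<close> may vanish identically, so \<open>n\<close> is not determined by \<open>f\<close>.\<close>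

definition lead :: "(4 \<Rightarrow> nat) \<Rightarrow> (complex^4 \<Rightarrow> complex) \<Rightarrow> nat \<Rightarrow> (complex^4 \<Rightarrow> complex) \<Rightarrow> bool" where
  "lead w f n P \<longleftrightarrow> (\<forall>z. ((\<lambda>s. f (scal w s z) / s^n) \<longlongrightarrow> P z) (at 0))"

lemma lead_diff: "lead w f n P \<Longrightarrow> lead w g n Q \<Longrightarrow> lead w (\<lambda>z. f z - g z) n (\<lambda>z. P z - Q z)"
  unfolding lead_def by (auto simp: diff_divide_distrib intro!: tendsto_intros)

lemma lead_cmult: "lead w f n P \<Longrightarrow> lead w (\<lambda>z. c * f z) n (\<lambda>z. c * P z)"
  unfolding lead_def by (auto simp flip: times_divide_eq_right intro!: tendsto_intros)

lemma lead_mult: "lead w f n P \<Longrightarrow> lead w g m Q \<Longrightarrow> lead w (\<lambda>z. f z * g z) (n + m) (\<lambda>z. P z * Q z)"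
  unfolding lead_def power_add times_divide_times_eq[symmetric] by (intro allI tendsto_mult) auto

lemma lead_one: "lead w (\<lambda>z. 1) 0 (\<lambda>z. 1)"
  unfolding lead_def by simp

lemma lead_power: "lead w f n P \<Longrightarrow> lead w (\<lambda>z. f z ^ j) (n * j) (\<lambda>z. P z ^ j)"
proof (induction j)
  case 0
  then show ?case using lead_one by simp
next
  case (Suc j)
  then show ?case using lead_mult[of w f n P "\<lambda>z. f z ^ j" "n * j" "\<lambda>z. P z ^ j"] by simp
qed

lemma lead_lower:
  assumes "lead w f n P" "m < n" shows "lead w f m (\<lambda>z. 0)"
  unfolding lead_def
proof
  fix z
  have z0: "(0::complex)^(n-m) = 0" using assms(2) by simp
  have "((\<lambda>s. f (scal w s z) / s^n * s^(n - m)) \<longlongrightarrow> P z * 0^(n-m)) (at 0)"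
    using assms by (intro tendsto_intros) (auto simp: lead_def)
  then have "((\<lambda>s. f (scal w s z) / s^n * s^(n - m)) \<longlongrightarrow> 0) (at 0)"
    using z0 by simp
  then show "((\<lambda>s. f (scal w s z) / s^m) \<longlongrightarrow> 0) (at 0)"
  proof (rule Lim_transform_eventually)
    have "f (scal w s z) / s^n * s^(n - m) = f (scal w s z) / s^m" if "s \<noteq> 0" for s
    proof -
      have "s^n = s^m * s^(n-m)" using assms(2) by (simp flip: power_add)
      then show ?thesis using that by simp
    qed
    then show "\<forall>\<^sub>F s in at 0. f (scal w s z) / s^n * s^(n - m) = f (scal w s z) / s^m"
      by (auto simp: eventually_at_filter)
  qed
qed

lemma lead_unique: "lead w f n P \<Longrightarrow> lead w f n Q \<Longrightarrow> P = Q"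
  unfolding lead_def by (rule ext) (blast intro: tendsto_unique[OF trivial_limit_at])

text \<open>\<open>taylor_leading_bound\<close> is applied to each curve s ->
  \<open>scal w s z\<close>. All these curves with norm z <= R share one radius and one bound of
  \<open>f\<close>, hence one constant.\<close>

lemma lead_bound:
  assumes f: "curve_hol f N" and N: "dilatable w N" and L: "lead w f n P"
  shows "\<exists>S>0. \<exists>C\<ge>0. \<forall>z s. norm z \<le> R \<longrightarrow> norm s \<le> S \<longrightarrow> scal w s z \<in> N \<and>
           norm (f (scal w s z) - P z * s^n) \<le> C * norm s ^ Suc n"
proof -
  obtain S B where S: "S > 0" "\<And>z s. norm z \<le> R \<Longrightarrow> norm s \<le> S \<Longrightarrow> scal w s z \<in> N \<and> norm (f (scal w s z)) \<le> B"
    using dilation_bounded[OF f N, of R] by blast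
  show ?thesis
  proof (intro exI conjI allI impI)
    show "0 < S/2" using S by simp
    show "0 \<le> \<bar>2 * B / (S/2)^Suc n\<bar>" by simp
    fix z :: "complex^4" and s :: complex assume z: "norm z \<le> R" and s: "norm s \<le> S/2"
    show "scal w s z \<in> N" using S s z by auto
    have "norm (f (scal w s z) - P z * s^n) \<le> 2 * B / (S/2)^Suc n * norm s ^ Suc n"
    proof (rule taylor_leading_bound[where S = S])
      show "(\<lambda>s. f (scal w s z)) holomorphic_on ball 0 S"
        using S z by (intro dilation_holomorphic[OF f]) auto
    qed (use S z s L in \<open>auto simp: lead_def\<close>)
    also have "\<dots> \<le> \<bar>2 * B / (S/2)^Suc n\<bar> * norm s ^ Suc n"
      by (intro mult_right_mono abs_ge_self) auto
    finally show "norm (f (scal w s z) - P z * s^n) \<le> \<bar>2 * B / (S/2)^Suc n\<bar> * norm s ^ Suc n" .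
  qed
qed

lemma lead_uniform:
  assumes f: "curve_hol f N" and N: "dilatable w N" and L: "lead w f n P"
  shows "\<exists>s. (\<forall>m z. norm z \<le> R \<longrightarrow> scal w (s m) z \<in> N) \<and>
           uniform_limit (cball 0 R) (\<lambda>m z. f (scal w (s m) z) / s m ^ n) P sequentially"
proof -
  obtain S C where S: "S > 0" "C \<ge> 0" "\<And>z s. norm z \<le> R \<Longrightarrow> norm s \<le> S \<Longrightarrow> scal w s z \<in> N \<and>
           norm (f (scal w s z) - P z * s^n) \<le> C * norm s ^ Suc n"
    using lead_bound[OF f N L, of R] by blast
  define s :: "nat \<Rightarrow> complex" where "s m = of_real (S / real (Suc m))" for m
  have s3: "norm (s m) = S / real (Suc m)" for m
    unfolding s_def norm_of_real using S(1) by simp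
  have s: "norm (s m) \<le> S" "s m \<noteq> 0" "norm (s m) = S / real (Suc m)" for m
  proof -
    have "S / real (Suc m) \<le> S / 1" using S(1) by (intro divide_left_mono) auto
    then show "norm (s m) \<le> S" by (simp add: s3)
    have "0 < norm (s m)" unfolding s3 using S(1) by simp
    then show "s m \<noteq> 0" by auto
  qed (fact s3)
  have bd: "norm (f (scal w (s m) z) / s m ^ n - P z) \<le> C * (S / real (Suc m))" if "norm z \<le> R" for m z
  proof -
    have "norm (f (scal w (s m) z) / s m ^ n - P z) = norm (f (scal w (s m) z) - P z * s m ^ n) / norm (s m) ^ n"
      using s(2)[of m] by (simp add: field_simps flip: norm_divide norm_power)
    also have "\<dots> \<le> C * norm (s m) ^ Suc n / norm (s m) ^ n"
      using S(3)[OF that s(1)] by (intro divide_right_mono) auto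
    also have "\<dots> = C * norm (s m)" using s(2)[of m] by simp
    finally show ?thesis using s(3) by simp
  qed
  have "(\<lambda>m. C * (S / real (Suc m))) \<longlonglongrightarrow> C * 0"
    by (intro tendsto_intros LIMSEQ_Suc lim_const_over_n)
  then have lim: "\<forall>\<^sub>F m in sequentially. C * (S / real (Suc m)) < e" if "e > 0" for e
    using that by (auto simp: order_tendsto_iff)
  have "uniform_limit (cball 0 R) (\<lambda>m z. f (scal w (s m) z) / s m ^ n) P sequentially"
    unfolding uniform_limit_iff
  proof (intro allI impI)
    fix e :: real assume "e > 0"
    from lim[OF this] show "\<forall>\<^sub>F m in sequentially. \<forall>z\<in>cball 0 R. dist (f (scal w (s m) z) / s m ^ n) (P z) < e"
    proof (rule eventually_mono, intro ballI)
      fix m and z :: "complex^4" assume "C * (S / real (Suc m)) < e" "z \<in> cball 0 R"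
      then show "dist (f (scal w (s m) z) / s m ^ n) (P z) < e"
        using bd[of z m] by (simp add: dist_norm)
    qed
  qed
  moreover have "\<forall>m z. norm z \<le> R \<longrightarrow> scal w (s m) z \<in> N"
    using S(3) s(1) by blast
  ultimately show ?thesis by blast
qed

text \<open>Dilation enlarges the domain: \<open>P\<close> is a limit, uniform on every ball, of
  rescaled copies of \<open>f\<close> that are defined on that ball. Hence \<open>P\<close> is
  entire although \<open>f\<close> may be given only near the origin.\<close>

lemma lead_curve_hol:
  assumes f: "curve_hol f N" and N: "dilatable w N" and L: "lead w f n P"
  shows "curve_hol P UNIV"
  unfolding curve_hol_def
proof (intro conjI allI impI)
  have cont: "continuous_on (cball 0 R) P" for R
  proof -
    obtain s where s: "\<And>m z. norm z \<le> R \<Longrightarrow> scal w (s m) z \<in> N"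
      "uniform_limit (cball 0 R) (\<lambda>m z. f (scal w (s m) z) / s m ^ n) P sequentially"
      using lead_uniform[OF f N L, of R] by blast
    have cf: "continuous_on N f" using f by (simp add: curve_hol_def)
    have "continuous_on (cball 0 R) (\<lambda>z. f (scal w (s m) z) / s m ^ n)" for m
      unfolding divide_inverse using s(1)
      by (intro continuous_intros continuous_on_compose2[OF cf, where f = "\<lambda>z. scal w (s m) z"]) auto
    then show ?thesis
      by (intro uniform_limit_theorem[OF _ s(2)]) auto
  qed
  have "isCont P z" for z
    using cont[of "norm z + 1"] continuous_on_interior[of "cball 0 (norm z + 1)" P z] by (auto simp: dist_norm)
  then show "continuous_on UNIV P" by (simp add: continuous_at_imp_continuous_on)
  fix \<phi> :: "complex \<Rightarrow> complex^4" and T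
  assume T: "open T" and \<phi>: "\<forall>i. (\<lambda>t. \<phi> t $ i) holomorphic_on T"
  show "(\<lambda>t. P (\<phi> t)) holomorphic_on T"
    unfolding holomorphic_on_open[OF T]
  proof
    fix t assume t: "t \<in> T"
    obtain d where d: "d > 0" "cball t d \<subseteq> T"
      using T t open_contains_cball by blast
    have "compact (\<phi> ` cball t d)"
      using d \<phi> by (intro compact_continuous_image continuous_curve) (auto intro: holomorphic_on_subset)
    then obtain R where R: "\<And>u. u \<in> cball t d \<Longrightarrow> norm (\<phi> u) \<le> R"
      by (meson compact_imp_bounded bounded_iff image_eqI)
    obtain s where s: "\<And>m z. norm z \<le> R \<Longrightarrow> scal w (s m) z \<in> N"
      "uniform_limit (cball 0 R) (\<lambda>m z. f (scal w (s m) z) / s m ^ n) P sequentially"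
      using lead_uniform[OF f N L, of R] by blast
    have ul: "uniform_limit (cball t d) (\<lambda>m u. f (scal w (s m) (\<phi> u)) / s m ^ n) (\<lambda>u. P (\<phi> u)) sequentially"
      unfolding uniform_limit_iff
    proof (intro allI impI)
      fix e :: real assume "e > 0"
      with s(2) have "\<forall>\<^sub>F m in sequentially. \<forall>z\<in>cball 0 R. dist (f (scal w (s m) z) / s m ^ n) (P z) < e"
        unfolding uniform_limit_iff by blast
      then show "\<forall>\<^sub>F m in sequentially. \<forall>u\<in>cball t d. dist (f (scal w (s m) (\<phi> u)) / s m ^ n) (P (\<phi> u)) < e"
        by (rule eventually_mono) (use R in auto)
    qed
    have "(\<lambda>u. P (\<phi> u)) holomorphic_on ball t d"
    proof (rule holomorphic_uniform_sequence)
      show "(\<lambda>u. f (scal w (s m) (\<phi> u)) / s m ^ n) holomorphic_on ball t d" for m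
        unfolding divide_inverse
      proof (intro holomorphic_intros curve_hol_compose[OF f])
        have "(\<lambda>u. \<phi> u $ i) holomorphic_on ball t d" for i
          using d \<phi> by (meson ball_subset_cball holomorphic_on_subset)
        then show "(\<lambda>u. scal w (s m) (\<phi> u) $ i) holomorphic_on ball t d" for i
          by (auto intro!: holomorphic_intros)
      qed (use s(1) R in auto)
      fix x assume "x \<in> ball t d"
      then obtain e where "e > 0" "cball x e \<subseteq> ball t d"
        using open_contains_cball[of "ball t d"] by blast
      moreover from this have "uniform_limit (cball x e) (\<lambda>m u. f (scal w (s m) (\<phi> u)) / s m ^ n) (\<lambda>u. P (\<phi> u)) sequentially"
        by (intro uniform_limit_on_subset[OF ul]) (use ball_subset_cball in blast)
      ultimately show "\<exists>e>0. cball x e \<subseteq> ball t d \<and>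
          uniform_limit (cball x e) (\<lambda>m u. f (scal w (s m) (\<phi> u)) / s m ^ n) (\<lambda>u. P (\<phi> u)) sequentially"
        by blast
    qed auto
    then show "\<exists>f'. ((\<lambda>t. P (\<phi> t)) has_field_derivative f') (at t)"
      using d holomorphic_on_open[of "ball t d"] by auto
  qed
qed

lemma lead_next:
  assumes f: "curve_hol f N" and N: "dilatable w N" and L: "lead w f n (\<lambda>z. 0)"
  shows "\<exists>P. lead w f (Suc n) P"
proof -
  have "\<exists>L. ((\<lambda>s. f (scal w s z) / s^Suc n) \<longlongrightarrow> L) (at 0)" for z
  proof -
    obtain S where S: "S > 0" "\<And>s. norm s \<le> S \<Longrightarrow> scal w s z \<in> N"
      using dilatable_point[OF N] by blast
    show ?thesis
      using L S by (intro taylor_next_coeff[OF dilation_holomorphic[OF f]]) (auto simp: lead_def)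
  qed
  then show ?thesis unfolding lead_def by (intro choice allI)
qed

lemma lead_zero_exists:
  assumes f: "curve_hol f N" and N: "dilatable w N"
  shows "\<exists>P. lead w f 0 P"
proof -
  have "((\<lambda>s. f (scal w s z) / s^0) \<longlongrightarrow> f (scal w 0 z)) (at 0)" for z
  proof -
    obtain S where S: "S > 0" "\<And>s. norm s \<le> S \<Longrightarrow> scal w s z \<in> N"
      using dilatable_point[OF N] by blast
    have "(\<lambda>s. f (scal w s z)) holomorphic_on ball 0 S"
      using S by (intro dilation_holomorphic[OF f]) auto
    then have "isCont (\<lambda>s. f (scal w s z)) 0"
      using S(1) by (metis centre_in_ball continuous_on_eq_continuous_at holomorphic_on_imp_continuous_on open_ball)
    then show ?thesis by (simp add: isCont_def)
  qed
  then show ?thesis unfolding lead_def by (intro exI[of _ "\<lambda>z. f (scal w 0 z)"] allI)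
qed

lemma lead_infinite_order:
  assumes f: "curve_hol f N" and N: "dilatable w N" and L: "\<And>n. lead w f n (\<lambda>z. 0)"
  shows "\<exists>S>0. \<forall>s. norm s < S \<longrightarrow> f (scal w s z) = 0"
proof -
  obtain S where S: "S > 0" "\<And>s. norm s \<le> S \<Longrightarrow> scal w s z \<in> N"
    using dilatable_point[OF N] by blast
  have "f (scal w s z) = 0" if "norm s < S/2" for s
    by (rule taylor_all_zero[OF dilation_holomorphic[OF f, of "ball 0 S"], where r = "S/2"])
       (use S L that in \<open>auto simp: lead_def\<close>)
  then show ?thesis using S(1) by (intro exI[of _ "S/2"]) auto
qed

text \<open>If all leading terms vanished, \<open>lead_next\<close> would climb through every order,
  and \<open>f\<close> would be zero along the dilation curve through \<open>z\<close>.\<close>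

lemma lead_exists:
  assumes f: "curve_hol f N" and N: "dilatable w N"
    and nz: "\<not> (\<exists>S>0. \<forall>s. norm s < S \<longrightarrow> f (scal w s z) = 0)"
  shows "\<exists>n P. lead w f n P \<and> (\<exists>z. P z \<noteq> 0)"
proof (rule ccontr)
  assume *: "\<not> ?thesis"
  have "lead w f n (\<lambda>z. 0)" for n
  proof (induction n)
    case 0
    obtain P where P: "lead w f 0 P" using lead_zero_exists[OF f N] by blast
    with * have "P = (\<lambda>z. 0)" by blast
    with P show ?case by simp
  next
    case (Suc n)
    obtain P where P: "lead w f (Suc n) P" using lead_next[OF f N Suc] by blast
    with * have "P = (\<lambda>z. 0)" by blast
    with P show ?case by simp
  qed
  with lead_infinite_order[OF f N] nz show False by blast
qed

lemma lead_homogeneous: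
  assumes L: "lead w f n P" and s: "s \<noteq> 0"
  shows "P (scal w s z) = s^n * P z"
proof -
  have "((\<lambda>t. t * s) \<longlongrightarrow> 0 * s) (at 0)" by (intro tendsto_intros)
  moreover have "\<forall>\<^sub>F t in at 0. t * s \<noteq> 0"
    unfolding eventually_at_filter using s by simp
  ultimately have fl: "filterlim (\<lambda>t. t * s) (at 0) (at 0)"
    by (simp add: filterlim_at)
  have "((\<lambda>t. s^n * (f (scal w (t * s) z) / (t * s)^n)) \<longlongrightarrow> s^n * P z) (at 0)"
    by (intro tendsto_mult tendsto_const filterlim_compose[OF L[unfolded lead_def, rule_format] fl])
  moreover have "s^n * (f (scal w (t * s) z) / (t * s)^n) = f (scal w t (scal w s z)) / t^n" for t
    using s by (simp add: scal_scal power_mult_distrib)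
  ultimately have "((\<lambda>t. f (scal w t (scal w s z)) / t^n) \<longlongrightarrow> s^n * P z) (at 0)"
    by (simp only:)
  moreover have "((\<lambda>t. f (scal w t (scal w s z)) / t^n) \<longlongrightarrow> P (scal w s z)) (at 0)"
    using L unfolding lead_def by (rule spec)
  ultimately show ?thesis
    by (rule tendsto_unique[OF trivial_limit_at, rotated])
qed

text \<open>Dilations with different weights commute, so a leading term for one keeps the
  homogeneity already obtained for another. This is how several successive passages to leading terms
  can be combined.\<close>

lemma lead_homogeneous_other:
  assumes L: "lead w f n P" and h: "\<And>z. f (scal w' s z) = s^k * f z"
  shows "P (scal w' s z) = s^k * P z"
proof -
  have "((\<lambda>t. s^k * (f (scal w t z) / t^n)) \<longlongrightarrow> s^k * P z) (at 0)"
    using L by (intro tendsto_intros) (auto simp: lead_def)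
  moreover have "s^k * (f (scal w t z) / t^n) = f (scal w t (scal w' s z)) / t^n" for t
    unfolding scal_commute[of w t w' s z] h by simp
  ultimately have "((\<lambda>t. f (scal w t (scal w' s z)) / t^n) \<longlongrightarrow> s^k * P z) (at 0)"
    by (simp only:)
  moreover have "((\<lambda>t. f (scal w t (scal w' s z)) / t^n) \<longlongrightarrow> P (scal w' s z)) (at 0)"
    using L unfolding lead_def by (rule spec)
  ultimately show ?thesis
    by (rule tendsto_unique[OF trivial_limit_at, rotated])
qed

text \<open>Restricting to the complex line through \<open>a\<close> and \<open>z\<close> reduces this to one variable.\<close>

lemma curve_hol_identity:
  assumes f: "curve_hol f UNIV" and S: "open S" "a \<in> S" and 0: "\<And>z. z \<in> S \<Longrightarrow> f z = 0"
  shows "f z = 0"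
proof -
  define \<phi> where "\<phi> t = a + t *s (z - a)" for t :: complex
  have \<phi>: "(\<lambda>t. \<phi> t $ i) holomorphic_on UNIV" for i
    unfolding \<phi>_def vector_add_component vector_smult_component by (intro holomorphic_intros)
  have hol: "(\<lambda>t. f (\<phi> t)) holomorphic_on UNIV"
    by (rule curve_hol_compose[OF f open_UNIV \<phi> UNIV_I])
  have op: "open (\<phi> -` S)"
    by (rule open_vimage[OF S(1) continuous_curve[OF \<phi>]])
  have "\<phi> 0 = a" unfolding \<phi>_def vec_eq_iff by simp
  then have ne: "\<phi> -` S \<noteq> {}" using S(2) by blast
  have f1: "f (\<phi> 1) = 0"
  proof (rule analytic_continuation_open[OF op open_UNIV ne connected_UNIV subset_UNIV hol])
    show "f (\<phi> t) = 0" if "t \<in> \<phi> -` S" for t using 0 that by blast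
  qed auto
  have p1: "\<phi> 1 = z" unfolding \<phi>_def vec_eq_iff by simp
  from f1 show ?thesis unfolding p1 .
qed

lemma curve_hol_mult_zero:
  assumes f: "curve_hol f UNIV" and g: "curve_hol g UNIV" and a: "f a \<noteq> 0" and b: "g b \<noteq> 0"
  shows "\<exists>z. f z * g z \<noteq> 0"
proof (rule ccontr)
  assume *: "\<not> ?thesis"
  have "open {z. f z \<noteq> 0}"
    by (rule open_Collect_neq[OF curve_hol_imp_continuous[OF f] continuous_on_const])
  then have "g b = 0"
  proof (rule curve_hol_identity[OF g])
    show "a \<in> {z. f z \<noteq> 0}" using a by simp
    show "g z = 0" if "z \<in> {z. f z \<noteq> 0}" for z using * that by auto
  qed
  with b show False by simp
qed

section \<open>Binary forms and their projective symmetries\<close>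

type_synonym vec2 = "complex \<times> complex"

definition det2 :: "vec2 \<Rightarrow> vec2 \<Rightarrow> complex" where
  "det2 v w = fst v * snd w - snd v * fst w"

definition smul :: "complex \<Rightarrow> vec2 \<Rightarrow> vec2" where
  "smul s v = (s * fst v, s * snd v)"

datatype mat2 = Mat2 (e11: complex) (e12: complex) (e21: complex) (e22: complex)

definition app :: "mat2 \<Rightarrow> vec2 \<Rightarrow> vec2" where
  "app g v = (e11 g * fst v + e12 g * snd v, e21 g * fst v + e22 g * snd v)"

definition mul :: "mat2 \<Rightarrow> mat2 \<Rightarrow> mat2" where
  "mul g h = Mat2 (e11 g * e11 h + e12 g * e21 h) (e11 g * e12 h + e12 g * e22 h)
                  (e21 g * e11 h + e22 g * e21 h) (e21 g * e12 h + e22 g * e22 h)"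

text \<open>Stands for the inverse; the missing factor 1 / \<open>mdet g\<close> is invisible
  projectively and polynomial identities stay free of division.\<close>

definition adj :: "mat2 \<Rightarrow> mat2" where
  "adj g = Mat2 (e22 g) (- e12 g) (- e21 g) (e11 g)"

definition mdet :: "mat2 \<Rightarrow> complex" where
  "mdet g = e11 g * e22 g - e12 g * e21 g"

text \<open>The cross-ratio of \<open>0\<close>, \<open>\<infinity>\<close> and their images under \<open>g\<close>; it depends only on the
  projective class of \<open>g\<close>.\<close>

definition axis_ratio :: "mat2 \<Rightarrow> complex" where
  "axis_ratio g = e11 g * e22 g / mdet g"

text \<open>The effect of y -> i y on initial data: the two basic solutions of the variational
  equation are multiplied by 1 and by i.\<close>

definition rot4 :: mat2 where "rot4 = Mat2 1 0 0 \<i>"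

lemma app_mul: "app (mul g h) v = app g (app h v)"
  by (simp add: app_def mul_def algebra_simps)

lemma mdet_mul: "mdet (mul g h) = mdet g * mdet h"
  by (simp add: mdet_def mul_def algebra_simps)

lemma mdet_adj [simp]: "mdet (adj g) = mdet g"
  by (simp add: mdet_def adj_def)

lemma adj_adj [simp]: "adj (adj g) = g"
  by (cases g) (simp add: adj_def)

lemma adj_mul: "adj (mul g h) = mul (adj h) (adj g)"
  by (simp add: adj_def mul_def algebra_simps)

lemma det2_swap: "det2 v w = - det2 w v"
  by (simp add: det2_def)

lemma det2_smul [simp]: "det2 (smul t v) w = t * det2 v w"
  by (simp add: det2_def smul_def algebra_simps)

lemma det2_app: "det2 (app g v) a = det2 v (app (adj g) a)"
  by (simp add: det2_def app_def adj_def algebra_simps)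

lemma app_adj: "app (adj g) (app g v) = smul (mdet g) v"
  by (simp add: app_def adj_def smul_def mdet_def algebra_simps)

lemma smul_zero_iff: "smul s v = 0 \<longleftrightarrow> s = 0 \<or> v = 0"
  by (auto simp: smul_def prod_eq_iff)

lemma smul_1 [simp]: "smul 1 v = v"
  by (simp add: smul_def)

lemma app_nonzero:
  assumes "mdet g \<noteq> 0" "v \<noteq> 0" shows "app g v \<noteq> 0"
proof
  assume "app g v = 0"
  then have "smul (mdet g) v = 0"
    by (simp flip: app_adj) (simp add: app_def prod_eq_iff)
  with assms show False by (simp add: smul_zero_iff)
qed

lemma det2_zero_parallel:
  assumes "det2 v w = 0" "v \<noteq> 0" "w \<noteq> 0"
  obtains t where "t \<noteq> 0" "v = smul t w"
proof (cases "fst w = 0")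
  case True
  with assms have "snd w \<noteq> 0" "fst v = 0" by (auto simp: det2_def prod_eq_iff)
  with True assms that[of "snd v / snd w"] show ?thesis by (auto simp: smul_def prod_eq_iff)
next
  case False
  with assms have "v = smul (fst v / fst w) w" by (auto simp: det2_def smul_def prod_eq_iff field_simps)
  moreover from this assms have "fst v / fst w \<noteq> 0" by (metis smul_zero_iff)
  ultimately show ?thesis using that by blast
qed

lemma det2_trans:
  assumes "det2 v l = 0" "det2 w l = 0" "l \<noteq> 0"
  shows "det2 v w = 0"
proof -
  have "det2 v w * fst l = 0" "det2 v w * snd l = 0"
    using assms(1,2) unfolding det2_def by algebra+
  with assms(3) show ?thesis by (auto simp: prod_eq_iff)
qed

text \<open>Diagonal factors on the left or right do not change \<open>axis_ratio\<close>, so new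
  values require words that alternate \<open>rot4\<close> with \<open>g\<close> and its inverse.
  Here x = ad/(ad - bc) and 1 - x = -bc/(ad - bc), and the diagonal product of the word is a
  polynomial in these. The resulting map increases every positive x other than 1.\<close>

lemma axis_ratio_up:
  assumes "mdet g \<noteq> 0"
  shows "axis_ratio (mul (mul (mul (mul g rot4) (adj g)) rot4) g) =
         axis_ratio g * (1 + 4 * (1 - axis_ratio g)^2)"
proof (cases g)
  case (Mat2 a b c d)
  have D: "a * d - b * c \<noteq> 0" using assms Mat2 by (simp add: mdet_def)
  have "mdet (mul (mul (mul (mul g rot4) (adj g)) rot4) g) = - ((a*d - b*c)^3)"
    by (simp only: mdet_mul mdet_adj) (simp add: Mat2 mdet_def rot4_def power3_eq_cube, use i_squared in algebra)
  moreover have "e11 (mul (mul (mul (mul g rot4) (adj g)) rot4) g) * e22 (mul (mul (mul (mul g rot4) (adj g)) rot4) g)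
    = - (a * d * ((a*d - b*c)^2 + 4 * (b * c)^2))"
    by (simp add: Mat2 mul_def rot4_def adj_def, use i_squared in algebra)
  ultimately have "axis_ratio (mul (mul (mul (mul g rot4) (adj g)) rot4) g) =
     a * d * ((a*d - b*c)^2 + 4 * (b * c)^2) / (a*d - b*c)^3"
    by (simp add: axis_ratio_def)
  also have "\<dots> = axis_ratio g * (1 + 4 * (1 - axis_ratio g)^2)"
  proof -
    have "1 - axis_ratio g = - (b * c) / (a * d - b * c)"
      using D by (simp add: Mat2 axis_ratio_def mdet_def field_simps)
    moreover have "axis_ratio g = a * d / (a*d - b*c)"
      by (simp add: Mat2 axis_ratio_def mdet_def)
    moreover have "x * (E^2 + 4 * y^2) / E^3 = x / E * (1 + 4 * (- y / E)^2)" if "E \<noteq> 0" for x y E :: complex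
      using that by (simp add: field_simps power2_eq_square power3_eq_cube)
    ultimately show ?thesis using D by simp
  qed
  finally show ?thesis .
qed

text \<open>Inverting one of the two rotations changes a sign in the word above, and the resulting
  map decreases x on the interval (0, 1/2).\<close>

lemma axis_ratio_down:
  assumes "mdet g \<noteq> 0"
  shows "axis_ratio (mul (mul (mul (mul g (adj rot4)) (adj g)) rot4) g) =
         axis_ratio g * (1 - 2 * axis_ratio g)^2"
proof (cases g)
  case (Mat2 a b c d)
  have D: "a * d - b * c \<noteq> 0" using assms Mat2 by (simp add: mdet_def)
  have "mdet (mul (mul (mul (mul g (adj rot4)) (adj g)) rot4) g) = - ((a*d - b*c)^3)"
    by (simp only: mdet_mul mdet_adj) (simp add: Mat2 mdet_def rot4_def power3_eq_cube, use i_squared in algebra)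
  moreover have "e11 (mul (mul (mul (mul g (adj rot4)) (adj g)) rot4) g) * e22 (mul (mul (mul (mul g (adj rot4)) (adj g)) rot4) g)
    = - (a * d * (a*d + b*c)^2)"
    by (simp add: Mat2 mul_def rot4_def adj_def, use i_squared in algebra)
  ultimately have "axis_ratio (mul (mul (mul (mul g (adj rot4)) (adj g)) rot4) g) =
     a * d * (a*d + b*c)^2 / (a*d - b*c)^3"
    by (simp add: axis_ratio_def)
  also have "\<dots> = axis_ratio g * (1 - 2 * axis_ratio g)^2"
  proof -
    have "1 - 2 * axis_ratio g = - (a * d + b * c) / (a * d - b * c)"
      using D by (simp add: Mat2 axis_ratio_def mdet_def field_simps)
    moreover have "axis_ratio g = a * d / (a*d - b*c)"
      by (simp add: Mat2 axis_ratio_def mdet_def)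
    moreover have "x * y^2 / E^3 = x / E * (- y / E)^2" if "E \<noteq> 0" for x y E :: complex
      using that by (simp add: field_simps power2_eq_square power3_eq_cube)
    moreover have "- (a * d + b * c) = - a * d - b * c" by simp
    ultimately show ?thesis using D by (metis add.commute minus_add_distrib)
  qed
  finally show ?thesis .
qed

text \<open>As a function of w, \<open>det2 (app g w) (app h w)\<close> is a quadratic form P x^2 +
  Q x y + R y^2. Vanishing on three distinct lines it is zero: P and R make corresponding columns of
  \<open>g\<close> and \<open>h\<close> proportional, and Q makes the two factors equal.\<close>

lemma axis_ratio_determined:
  assumes v: "fst v \<noteq> 0" "snd v \<noteq> 0" and det: "mdet g \<noteq> 0" "mdet h \<noteq> 0"
    and p: "det2 (app g v) (app h v) = 0"
      "det2 (app g (app rot4 v)) (app h (app rot4 v)) = 0"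
      "det2 (app g (app rot4 (app rot4 v))) (app h (app rot4 (app rot4 v))) = 0"
  shows "axis_ratio g = axis_ratio h"
proof (cases g; cases h)
  fix a b c d a' b' c' d' assume g: "g = Mat2 a b c d" and h: "h = Mat2 a' b' c' d'"
  obtain x y where xy: "v = (x, y)" by (cases v)
  define P Q R where "P = a * c' - c * a'" and "Q = a * d' + b * c' - c * b' - d * a'" and "R = b * d' - d * b'"
  have 1: "P * x^2 + Q * x * y + R * y^2 = 0"
    using p(1) unfolding g h xy P_def Q_def R_def det2_def app_def by (simp add: algebra_simps power2_eq_square)
  have 2: "P * x^2 + Q * x * (\<i> * y) + R * (\<i> * y)^2 = 0"
    using p(2) unfolding g h xy P_def Q_def R_def det2_def app_def rot4_def by (simp add: algebra_simps power2_eq_square)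
  have 3: "P * x^2 + Q * x * (\<i> * (\<i> * y)) + R * (\<i> * (\<i> * y))^2 = 0"
    using p(3) unfolding g h xy P_def Q_def R_def det2_def app_def rot4_def by (simp add: algebra_simps power2_eq_square)
  have "2 * Q * (x * y) = 0" using 1 3 i_squared by algebra
  then have Q: "Q = 0" using v xy by simp
  have "2 * P * x^2 = 0" "2 * R * y^2 = 0" using 1 2 Q i_squared by algebra+
  then have P: "P = 0" and R: "R = 0" using v xy by simp_all
  have D: "a * d - b * c \<noteq> 0" "a' * d' - b' * c' \<noteq> 0" using det g h by (simp_all add: mdet_def)
  have "\<exists>s. a' = s * a \<and> c' = s * c"
  proof (cases "a = 0")
    case True
    then have "c \<noteq> 0" using D by auto
    with True P show ?thesis by (intro exI[of _ "c' / c"]) (auto simp: P_def)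
  next
    case False
    with P show ?thesis by (intro exI[of _ "a' / a"]) (auto simp: P_def field_simps)
  qed
  then obtain s where s: "a' = s * a" "c' = s * c" by blast
  have "\<exists>t. b' = t * b \<and> d' = t * d"
  proof (cases "b = 0")
    case True
    then have "d \<noteq> 0" using D by auto
    with True R show ?thesis by (intro exI[of _ "d' / d"]) (auto simp: R_def)
  next
    case False
    with R show ?thesis by (intro exI[of _ "b' / b"]) (auto simp: R_def field_simps)
  qed
  then obtain t where t: "b' = t * b" "d' = t * d" by blast
  have "(t - s) * (a * d - b * c) = 0" using Q unfolding Q_def s t by (simp add: algebra_simps)
  then have ts: "t = s" using D by simp
  have s0: "s \<noteq> 0" using D(2) s by auto
  have "a' * d' / (a' * d' - b' * c') = (s^2 * (a * d)) / (s^2 * (a * d - b * c))"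
    unfolding s t ts by (simp add: power2_eq_square algebra_simps)
  also have "\<dots> = a * d / (a * d - b * c)" using s0 by simp
  finally show ?thesis unfolding g h by (simp add: axis_ratio_def mdet_def)
qed

text \<open>A finite set of points of the projective line, encoded as a cone of non-zero vectors;
  \<open>L\<close> holds direction vectors of finitely many lines that cover it.\<close>

locale finite_cone =
  fixes Z :: "vec2 set" and L :: "vec2 set"
  assumes nonzero: "v \<in> Z \<Longrightarrow> v \<noteq> 0" and scale: "v \<in> Z \<Longrightarrow> s \<noteq> 0 \<Longrightarrow> smul s v \<in> Z"
    and finL: "finite L" and L: "l \<in> L \<Longrightarrow> l \<noteq> 0" "v \<in> Z \<Longrightarrow> \<exists>l\<in>L. det2 v l = 0"
begin

definition pres :: "mat2 \<Rightarrow> bool" where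
  "pres g \<longleftrightarrow> mdet g \<noteq> 0 \<and> (\<forall>v\<in>Z. app g v \<in> Z) \<and> (\<forall>v\<in>Z. app (adj g) v \<in> Z)"

lemma pres_mul: "pres g \<Longrightarrow> pres h \<Longrightarrow> pres (mul g h)"
  unfolding pres_def by (auto simp: mdet_mul adj_mul app_mul)

lemma pres_adj: "pres g \<Longrightarrow> pres (adj g)"
  unfolding pres_def by auto

text \<open>Pigeonhole: each \<open>G n\<close> sends the lines of v, Sv and S^2 v, where S is
  \<open>rot4\<close>, to lines of \<open>L\<close>. Two members with the same triple of target
  lines have equal axis ratios by \<open>axis_ratio_determined\<close>.\<close>

lemma finitely_many_axis_ratios:
  assumes rot: "pres rot4" and v: "v \<in> Z" "fst v \<noteq> 0" "snd v \<noteq> 0" and G: "\<And>n::nat. pres (G n)"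
  shows "\<not> inj (\<lambda>n. axis_ratio (G n))"
proof
  assume inj: "inj (\<lambda>n. axis_ratio (G n))"
  define V where "V i = (app rot4 ^^ i) v" for i
  have VZ: "V i \<in> Z" for i
    by (induction i) (use v rot in \<open>auto simp: V_def pres_def\<close>)
  have "\<exists>l\<in>L. det2 (app (G n) (V i)) l = 0" for n i
    using G[of n] VZ[of i] L(2) by (auto simp: pres_def)
  then obtain l where l: "\<And>n i. l n i \<in> L" "\<And>n i. det2 (app (G n) (V i)) (l n i) = 0"
    by metis
  have "range (\<lambda>n. (l n 0, l n 1, l n 2)) \<subseteq> L \<times> L \<times> L" using l by auto
  then have "finite (range (\<lambda>n. (l n 0, l n 1, l n 2)))"
    using finL finite_subset by blast
  then have "\<not> inj (\<lambda>n. (l n 0, l n 1, l n 2))"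
    using finite_imageD infinite_UNIV_nat by blast
  then obtain n m where nm: "n \<noteq> m" "l n 0 = l m 0" "l n 1 = l m 1" "l n 2 = l m 2"
    unfolding inj_def by auto
  have par: "det2 (app (G n) (V i)) (app (G m) (V i)) = 0" if "l n i = l m i" for i
    by (rule det2_trans[of _ "l n i"]) (use l[of n i] l(2)[of m i] L(1) that in auto)
  have "axis_ratio (G n) = axis_ratio (G m)"
    by (rule axis_ratio_determined[OF v(2,3)])
      (use G par[OF nm(2)] par[OF nm(3)] par[OF nm(4)] in \<open>auto simp: pres_def V_def numeral_2_eq_2\<close>)
  with inj nm(1) show False by (auto simp: inj_def)
qed

text \<open>The matrix has trace 0 and determinant -1, so it is an involution, and its axis ratio is
  c^2 = k. Unless k is exceptional, iterating one of the two words above from it gives infinitely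
  many axis ratios, against the pigeonhole bound.\<close>

lemma invariant_cone_axis_ratio:
  assumes ne: "Z \<noteq> {}" and S: "\<And>v. v \<in> Z \<Longrightarrow> app rot4 v \<in> Z"
    and T: "\<And>v. v \<in> Z \<Longrightarrow> app (Mat2 c b a (- c)) v \<in> Z"
    and det: "c^2 + a * b = 1" and c: "c^2 = of_real k" and k: "0 \<le> k"
  shows "k \<in> {0, 1/2, 1}"
proof (rule ccontr)
  assume nk: "k \<notin> {0, 1/2, 1}"
  let ?T = "Mat2 c b a (- c)"
  have dT: "mdet ?T = -1" using det by (simp add: mdet_def power2_eq_square algebra_simps)
  have "app (adj rot4) v = smul \<i> (app rot4 (app rot4 (app rot4 v)))" for v
    by (simp add: app_def adj_def rot4_def smul_def)
  then have rot: "pres rot4" using S scale by (auto simp: pres_def) (simp add: mdet_def rot4_def)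
  have "app (adj ?T) v = smul (- 1) (app ?T v)" for v
    by (simp add: app_def adj_def smul_def)
  then have presT: "pres ?T" using T scale dT by (auto simp: pres_def)
  have arT: "axis_ratio ?T = of_real k"
    using dT c by (simp add: axis_ratio_def power2_eq_square)
  \<comment> \<open>If \<open>Z\<close> lay on the coordinate axes, the involution would map an axis
    to an axis, so c = 0 or a b = 0, and k would be 0 or 1.\<close>
  have "\<exists>v\<in>Z. fst v \<noteq> 0 \<and> snd v \<noteq> 0"
  proof (rule ccontr)
    assume *: "\<not> ?thesis"
    obtain v where v: "v \<in> Z" using ne by blast
    then have nz: "v \<noteq> 0" by (rule nonzero)
    have Tv: "app ?T v \<in> Z" using T v .
    have "c = 0 \<or> a = 0 \<or> b = 0"
      using *[simplified, rule_format, OF v] *[simplified, rule_format, OF Tv] nz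
      by (auto simp: app_def prod_eq_iff)
    then have "c^2 = 0 \<or> c^2 = 1" using det by auto
    then show False using c nk by (metis insert_iff of_real_eq_0_iff of_real_eq_1_iff)
  qed
  then obtain v where v: "v \<in> Z" "fst v \<noteq> 0" "snd v \<noteq> 0" by blast
  \<comment> \<open>Below 1/2 the descending word keeps the value inside (0, 1/2); above 1/2 the
    ascending word keeps it on its side of 1. Both iterations are strictly monotone there.\<close>
  define E where "E = (if k < 1/2 then adj rot4 else rot4)"
  define step where "step g = mul (mul (mul (mul g E) (adj g)) rot4) g" for g
  define G where "G n = (step ^^ n) ?T" for n
  have presE: "pres E" using rot pres_adj by (auto simp: E_def)
  have presG: "pres (G n)" for n
  proof (induction n)
    case (Suc n)
    then have "pres (step (G n))" unfolding step_def by (intro pres_mul pres_adj presE rot)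
    then show ?case by (simp add: G_def)
  qed (simp add: G_def presT)
  define \<phi> where "\<phi> x = (if k < 1/2 then x * (1 - 2 * x)^2 else x * (1 + 4 * (1 - x)^2))" for x :: real
  define \<kappa> where "\<kappa> n = (\<phi> ^^ n) k" for n
  have ar: "axis_ratio (G n) = of_real (\<kappa> n)" for n
  proof (induction n)
    case (Suc n)
    have "mdet (G n) \<noteq> 0" using presG by (simp add: pres_def)
    then have "axis_ratio (G (Suc n)) = of_real (\<phi> (\<kappa> n))"
      using axis_ratio_up[of "G n"] axis_ratio_down[of "G n"] Suc
      by (simp add: G_def step_def E_def \<phi>_def)
    then show ?case by (simp add: \<kappa>_def)
  qed (simp add: G_def \<kappa>_def arT)
  have "inj \<kappa>"
  proof (cases "k < 1/2")
    case True
    have step: "0 < x * (1 - 2 * x)^2 \<and> x * (1 - 2 * x)^2 < x" if "0 < x" "x < 1/2" for x :: real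
    proof -
      have "(1 - 2 * x)^2 < 1" using that by (simp add: power2_eq_square) (smt (verit) mult_le_one mult_less_cancel_left2)
      moreover have "0 < (1 - 2 * x)^2" using that by simp
      ultimately show ?thesis using that by simp
    qed
    have rng: "0 < \<kappa> n \<and> \<kappa> n < 1/2" for n
    proof (induction n)
      case 0 show ?case using k nk True by (auto simp: \<kappa>_def)
    next
      case (Suc n)
      moreover have "\<kappa> (Suc n) = \<kappa> n * (1 - 2 * \<kappa> n)^2" using True by (simp add: \<kappa>_def \<phi>_def)
      ultimately show ?case using step[of "\<kappa> n"] by linarith
    qed
    have "\<kappa> (Suc n) < \<kappa> n" for n
      using step[of "\<kappa> n"] rng[of n] True by (simp add: \<kappa>_def \<phi>_def)
    then have "strict_mono (\<lambda>n. - \<kappa> n)" by (intro strict_mono_Suc_iff[THEN iffD2]) auto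
    then have "inj (\<lambda>n. - \<kappa> n)" by (rule strict_mono_imp_inj_on)
    then show ?thesis by (simp add: inj_def)
  next
    case False
    have \<kappa>_Suc: "\<kappa> (Suc n) = \<kappa> n * (1 + 4 * (1 - \<kappa> n)^2)" for n
      using False by (simp add: \<kappa>_def \<phi>_def)
    have step: "x < x * (1 + 4 * (1 - x)^2)" if "0 < x" "x \<noteq> 1" for x :: real
      using that by (simp add: algebra_simps) 
    have lt1: "x * (1 + 4 * (1 - x)^2) < 1" if "1/2 < x" "x < 1" for x :: real
    proof -
      have "1 - x * (1 + 4 * (1 - x)^2) = (1 - x) * (1 - 2 * x)^2"
        by (simp add: power2_eq_square algebra_simps)
      moreover have "0 < (1 - x) * (1 - 2 * x)^2" using that by simp
      ultimately show ?thesis by linarith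
    qed
    have rng: "1/2 < \<kappa> n \<and> (k < 1 \<longrightarrow> \<kappa> n < 1) \<and> (1 < k \<longrightarrow> 1 < \<kappa> n)" for n
    proof (induction n)
      case 0 show ?case using k nk False by (auto simp: \<kappa>_def)
    next
      case (Suc n)
      have "k < 1 \<or> 1 < k" using nk by auto
      then have "\<kappa> n < \<kappa> (Suc n)" "k < 1 \<longrightarrow> \<kappa> (Suc n) < 1"
        using step[of "\<kappa> n"] lt1[of "\<kappa> n"] Suc unfolding \<kappa>_Suc by auto
      with Suc show ?case by auto
    qed
    have "\<kappa> n < \<kappa> (Suc n)" for n
    proof -
      have "k < 1 \<or> 1 < k" using nk by auto
      then show ?thesis using step[of "\<kappa> n"] rng[of n] unfolding \<kappa>_Suc by auto
    qed
    then have "strict_mono \<kappa>" by (intro strict_mono_Suc_iff[THEN iffD2]) auto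
    then show ?thesis by (rule strict_mono_imp_inj_on)
  qed
  then have "inj (\<lambda>n. axis_ratio (G n))" unfolding ar by (auto simp: inj_def)
  with finitely_many_axis_ratios[OF rot v, of G] presG show False by blast
qed

end

section \<open>Products of linear forms and cancellation of common factors\<close>

definition lprod :: "vec2 list \<Rightarrow> vec2 \<Rightarrow> complex" where
  "lprod as v = (\<Prod>a\<leftarrow>as. det2 v a)"

lemma lprod_simps [simp]: "lprod [] v = 1" "lprod (a # as) v = det2 v a * lprod as v"
  "lprod (as @ bs) v = lprod as v * lprod bs v"
  by (simp_all add: lprod_def)

lemma lprod_zero_iff: "lprod as v = 0 \<longleftrightarrow> (\<exists>a\<in>set as. det2 v a = 0)"
  by (induction as) auto

lemma lprod_app: "lprod as (app g v) = lprod (map (app (adj g)) as) v"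
  by (induction as) (auto simp: det2_app)

lemma continuous_lprod: "continuous_on UNIV (lprod as)"
proof -
  have "continuous_on UNIV (\<lambda>v. lprod as v)"
    by (induction as) (auto simp: det2_def intro!: continuous_intros)
  then show ?thesis .
qed

text \<open>Any \<open>v\<close> is a limit of points off the finitely many lines, approached in a
  direction parallel to none of them. This density argument underlies every later cancellation of a
  form.\<close>

lemma eq_off_lines:
  assumes f: "continuous_on UNIV f" and g: "continuous_on UNIV g"
    and as: "\<And>a. a \<in> set as \<Longrightarrow> a \<noteq> 0"
    and eq: "\<And>v. lprod as v \<noteq> 0 \<Longrightarrow> f v = (g v :: complex)"
  shows "f v = g v"
proof -
  \<comment> \<open>The slope \<open>w\<close> avoids the finitely many slopes of the given lines;
    vertical lines never contain (1, w).\<close>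
  have "\<exists>w. \<forall>a\<in>set as. det2 (1, w) a \<noteq> 0"
  proof -
    have "finite ((\<lambda>a. snd a / fst a) ` set as)" by simp
    then obtain w where w: "w \<notin> (\<lambda>a. snd a / fst a) ` set as"
      using ex_new_if_finite[OF infinite_UNIV_char_0] by blast
    have "det2 (1, w) a \<noteq> 0" if "a \<in> set as" for a
    proof
      assume "det2 (1, w) a = 0"
      then have "snd a = w * fst a" by (simp add: det2_def)
      with as[OF that] have "fst a \<noteq> 0" "w = snd a / fst a" by (auto simp: prod_eq_iff)
      with w that show False by blast
    qed
    then show ?thesis by blast
  qed
  then obtain w where w: "\<And>a. a \<in> set as \<Longrightarrow> det2 (1, w) a \<noteq> 0" by blast
  define u where "u e = v + smul e (1, w)" for e
  have d: "det2 (u e) a = det2 v a + e * det2 (1, w) a" for e a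
    by (simp add: u_def det2_def smul_def algebra_simps)
  have "\<forall>\<^sub>F e in at 0. det2 (u e) a \<noteq> 0" if "a \<in> set as" for a
  proof (cases "det2 v a = 0")
    case True
    then show ?thesis using w[OF that] unfolding d eventually_at_filter by auto
  next
    case False
    have "((\<lambda>e. det2 v a + e * det2 (1, w) a) \<longlongrightarrow> det2 v a + 0 * det2 (1, w) a) (at 0)"
      by (intro tendsto_intros)
    then show ?thesis using tendsto_imp_eventually_ne[of _ "det2 v a" "at 0" 0] False unfolding d by simp
  qed
  then have "\<forall>\<^sub>F e in at 0. \<forall>a\<in>set as. det2 (u e) a \<noteq> 0"
    by (simp add: eventually_ball_finite)
  then have ev: "\<forall>\<^sub>F e in at 0. f (u e) = g (u e)"
    by (rule eventually_mono) (use eq lprod_zero_iff in blast)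
  have "((\<lambda>e. u e) \<longlongrightarrow> v + (0 * 1, 0 * w)) (at 0)"
    unfolding u_def smul_def fst_conv snd_conv by (intro tendsto_intros)
  then have u: "(u \<longlongrightarrow> v) (at 0)" by (simp add: zero_prod_def[symmetric])
  have fl: "((\<lambda>e. f (u e)) \<longlongrightarrow> f v) (at 0)"
    by (rule continuous_on_tendsto_compose[OF f u]) auto
  have gl: "((\<lambda>e. g (u e)) \<longlongrightarrow> g v) (at 0)"
    by (rule continuous_on_tendsto_compose[OF g u]) auto
  have "((\<lambda>e. g (u e)) \<longlongrightarrow> f v) (at 0)"
    by (rule Lim_transform_eventually[OF fl ev])
  from tendsto_unique[OF trivial_limit_at this gl] show ?thesis .
qed

text \<open>Removal of the greatest common divisor at the level of lists of linear factors: each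
  \<open>a\<close> is struck out against a parallel factor among the \<open>bs\<close>, and the
  proportionality constants are collected in \<open>k\<close>.\<close>

lemma cancel_parallel:
  assumes "\<And>a. a \<in> set as \<Longrightarrow> a \<noteq> 0" "\<And>b. b \<in> set bs \<Longrightarrow> b \<noteq> 0"
  shows "\<exists>as' bs' k. k \<noteq> 0 \<and> set as' \<subseteq> set as \<and> set bs' \<subseteq> set bs \<and>
    (\<forall>a\<in>set as'. \<forall>b\<in>set bs'. det2 a b \<noteq> 0) \<and>
    length as + length bs' = length as' + length bs \<and>
    (\<forall>v. lprod as v * lprod bs' v = k * lprod as' v * lprod bs v)"
  using assms(1)
proof (induction as)
  case Nil
  show ?case by (intro exI[of _ "[]"] exI[of _ bs] exI[of _ 1]) auto
next
  case (Cons a as)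
  then obtain as' bs' k where IH: "k \<noteq> 0" "set as' \<subseteq> set as" "set bs' \<subseteq> set bs"
    "\<forall>a\<in>set as'. \<forall>b\<in>set bs'. det2 a b \<noteq> 0" "length as + length bs' = length as' + length bs"
    "\<And>v. lprod as v * lprod bs' v = k * lprod as' v * lprod bs v" by auto
  show ?case
  proof (cases "\<exists>b\<in>set bs'. det2 a b = 0")
    case True
    then obtain b where b: "b \<in> set bs'" "det2 a b = 0" by blast
    then obtain t where t: "t \<noteq> 0" "a = smul t b"
      using det2_zero_parallel Cons.prems assms(2) IH(3) by (metis list.set_intros(1) subsetD)
    obtain us vs where bs': "bs' = us @ b # vs" using b(1) by (meson split_list)
    have "det2 v a = t * det2 v b" for v by (simp add: t det2_def smul_def algebra_simps)
    then have "lprod (a # as) v * lprod (us @ vs) v = t * (lprod as v * lprod bs' v)" for v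
      by (simp add: bs')
    then have "\<forall>v. lprod (a # as) v * lprod (us @ vs) v = (t * k) * lprod as' v * lprod bs v"
      by (simp add: IH(6))
    then show ?thesis using IH t bs'
      by (intro exI[of _ as'] exI[of _ "us @ vs"] exI[of _ "t * k"]) auto
  next
    case False
    then show ?thesis using IH
      by (intro exI[of _ "a # as'"] exI[of _ bs'] exI[of _ k]) (auto simp: algebra_simps)
  qed
qed

text \<open>A form is only required to be entire in the affine coordinate: homogeneity and continuity at the
  line at infinity make it a polynomial.\<close>

definition binary_form :: "nat \<Rightarrow> (vec2 \<Rightarrow> complex) \<Rightarrow> bool" where
  "binary_form m f \<longleftrightarrow> continuous_on UNIV f \<and> (\<forall>s v. s \<noteq> 0 \<longrightarrow> f (smul s v) = s^m * f v) \<and>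
     (\<lambda>w. f (1, w)) holomorphic_on UNIV"

text \<open>Homogeneity turns boundedness of f(u, 1) on the unit disc into growth of order w^m for
  f(1, w). Liouville then yields a polynomial of degree at most m, and its roots give the linear
  factors.\<close>

lemma binary_form_factor:
  assumes f: "binary_form m f" and nz: "f v0 \<noteq> 0"
  shows "\<exists>c as. c \<noteq> 0 \<and> length as = m \<and> (\<forall>a\<in>set as. a \<noteq> 0) \<and> (\<forall>v. f v = c * lprod as v)"
proof -
  have cont: "continuous_on UNIV f" and hom: "\<And>s v. s \<noteq> 0 \<Longrightarrow> f (smul s v) = s^m * f v"
    and hol: "(\<lambda>w. f (1, w)) holomorphic_on UNIV"
    using f unfolding binary_form_def by auto
  have "compact ((\<lambda>u. f (u, 1)) ` cball 0 1)"
    by (intro compact_continuous_image continuous_on_compose2[OF cont] continuous_intros) auto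
  then obtain B where B: "\<And>u. norm u \<le> 1 \<Longrightarrow> norm (f (u, 1)) \<le> B"
    by (meson compact_imp_bounded bounded_iff image_eqI mem_cball_0)
  have growth: "norm (f (1, w)) \<le> B * norm w ^ m" if "1 \<le> norm w" for w
  proof -
    have w0: "w \<noteq> 0" using that by auto
    have "f (1, w) = f (smul w (1 / w, 1))" using w0 by (simp add: smul_def)
    also have "\<dots> = w ^ m * f (1 / w, 1)" using w0 by (rule hom)
    finally have "norm (f (1, w)) = norm w ^ m * norm (f (1 / w, 1))" by (simp add: norm_mult norm_power)
    also have "\<dots> \<le> norm w ^ m * B"
      using that w0 by (intro mult_left_mono B) (auto simp: norm_divide)
    finally show ?thesis by (simp add: mult.commute)
  qed
  define p where "p = (\<Sum>k\<le>m. monom ((deriv ^^ k) (\<lambda>w. f (1, w)) 0 / fact k) k)"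
  have p: "poly p w = f (1, w)" for w
    unfolding p_def using Liouville_polynomial[OF hol growth, where \<xi> = w] by (simp add: poly_sum poly_monom)
  have degp: "degree p \<le> m"
    unfolding p_def by (intro degree_sum_le) (auto intro: order_trans[OF degree_monom_le])
  have fx: "f (x, y) = x^m * poly p (y / x)" if "x \<noteq> 0" for x y
    using hom[OF that, of "(1, y / x)"] that by (simp add: p smul_def)
  have p0: "p \<noteq> 0"
  proof
    assume "p = 0"
    have "f v0 = 0"
    proof (rule eq_off_lines[OF cont, of "\<lambda>v. 0" "[(0,1)]"])
      fix v :: vec2 assume "lprod [(0, 1)] v \<noteq> 0"
      then show "f v = 0" using fx[of "fst v" "snd v"] \<open>p = 0\<close> by (simp add: det2_def)
    qed (auto simp: prod_eq_iff)
    with nz show False by simp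
  qed
  define A where "A = proots p"
  have A: "size A = degree p" "smult (lead_coeff p) (\<Prod>x\<in>#A. [:-x, 1:]) = p"
    unfolding A_def by (rule size_proots_complex complex_poly_decompose_multiset)+
  obtain xs where xs: "mset xs = A" using ex_mset by blast
  have pw: "poly p w = lead_coeff p * (\<Prod>x\<leftarrow>xs. w - x)" for w
  proof -
    have "poly p w = poly (smult (lead_coeff p) (\<Prod>x\<in>#A. [:-x, 1:])) w" unfolding A(2) ..
    moreover have "poly (\<Prod>x\<in>#A. [:-x, 1:]) w = (\<Prod>x\<leftarrow>xs. w - x)"
      unfolding xs[symmetric] by (induction xs) (auto simp: algebra_simps)
    ultimately show ?thesis by simp
  qed
  \<comment> \<open>The defect m - degree p is made up by roots at infinity:
    \<open>det2 v (0, 1)\<close> is the first coordinate of \<open>v\<close>.\<close>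
  define as :: "vec2 list" where "as = map (\<lambda>z. (1, z)) xs @ replicate (m - degree p) (0, 1 :: complex)"
  \<comment> \<open>The sign comes from \<open>det2 (x, y) (1, z)\<close> = -x (y/x - z), once for
    each finite root.\<close>
  define c where "c = lead_coeff p * (-1) ^ degree p"
  have len: "length xs = degree p" using A(1) unfolding xs[symmetric] by simp
  have rep: "lprod (replicate n (0, 1)) v = fst v ^ n" for n v
    by (induction n) (auto simp: det2_def)
  have map: "lprod (map (\<lambda>z. (1, z)) xs) (x, y) = (-1) ^ length xs * x ^ length xs * (\<Prod>z\<leftarrow>xs. y / x - z)"
    if "x \<noteq> 0" for x y
    using that by (induction xs) (auto simp: det2_def field_simps)
  have eq: "f v = c * lprod as v" for v
  proof (rule eq_off_lines[OF cont, of "\<lambda>v. c * lprod as v" "[(0,1)]"])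
    show "continuous_on UNIV (\<lambda>v. c * lprod as v)" by (intro continuous_intros continuous_lprod)
    fix v :: vec2 assume v: "lprod [(0, 1)] v \<noteq> 0"
    obtain x y where xy: "v = (x, y)" by (cases v)
    have x: "x \<noteq> 0" using v xy by (simp add: det2_def)
    have xm: "x ^ m = x ^ degree p * x ^ (m - degree p)" using degp by (simp flip: power_add)
    have e: "(- 1) ^ degree p * (- 1) ^ degree p = (1 :: complex)" by (simp flip: power_mult_distrib)
    have gen: "X * (l * Q) = l * e * (e * Y * Q * W)" if "e * e = 1" "X = Y * W" for X l Q e Y W :: complex
      using that by algebra
    show "f v = c * lprod as v"
      unfolding xy fx[OF x] pw as_def lprod_simps map[OF x] rep len c_def fst_conv
      by (rule gen[OF e xm])
  qed (auto simp: prod_eq_iff)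
  have "length as = m" using degp len by (simp add: as_def)
  moreover have "\<forall>a\<in>set as. a \<noteq> 0" by (auto simp: as_def prod_eq_iff)
  moreover have "c \<noteq> 0" using p0 by (simp add: c_def)
  ultimately show ?thesis using eq by blast
qed

text \<open>With R = f/g and S = \<open>rot4\<close>, the two relations read R o T o S = k1 R and R
  o S = k2 R o T. If \<open>Z\<close> denotes the zeros and poles of R, then TS maps
  \<open>Z\<close> into itself, and Tv in \<open>Z\<close> implies Sv in \<open>Z\<close>. So the
  union of \<open>Z\<close> and its image under T is stable under S and T, hence empty for
  non-exceptional k, and R is constant.\<close>

lemma ratio_symmetric_imp_constant:
  assumes f: "binary_form m f" "\<exists>v. f v \<noteq> 0" and g: "binary_form m' g" "\<exists>v. g v \<noteq> 0"
    and T: "T = Mat2 c b a (- c)" "c^2 + a * b = 1" "c^2 = of_real k" "0 \<le> k" "k \<notin> {0, 1/2, 1}"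
    and r1: "k1 \<noteq> 0" "\<And>v. f (app T (app rot4 v)) * g v = k1 * f v * g (app T (app rot4 v))"
    and r2: "k2 \<noteq> 0" "\<And>v. f (app rot4 v) * g (app T v) = k2 * f (app T v) * g (app rot4 v)"
  shows "m = m' \<and> (\<exists>k. k \<noteq> 0 \<and> (\<forall>v. f v = k * g v))"
proof -
  obtain cf as0 where F: "cf \<noteq> 0" "length as0 = m" "\<And>a. a \<in> set as0 \<Longrightarrow> a \<noteq> 0" "\<And>v. f v = cf * lprod as0 v"
    using binary_form_factor[OF f(1)] f(2) by blast
  obtain cg bs0 where G: "cg \<noteq> 0" "length bs0 = m'" "\<And>a. a \<in> set bs0 \<Longrightarrow> a \<noteq> 0" "\<And>v. g v = cg * lprod bs0 v"
    using binary_form_factor[OF g(1)] g(2) by blast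
  obtain as bs k0 where R: "k0 \<noteq> 0" "set as \<subseteq> set as0" "set bs \<subseteq> set bs0"
    "\<forall>a\<in>set as. \<forall>b\<in>set bs. det2 a b \<noteq> 0" "length as0 + length bs = length as + length bs0"
    "\<forall>v. lprod as0 v * lprod bs v = k0 * lprod as v * lprod bs0 v"
    using cancel_parallel[OF F(3) G(3)] by blast
  have nz: "a \<noteq> 0" if "a \<in> set as \<union> set bs" for a using that R F(3) G(3) by blast
  define Z where "Z = {v. v \<noteq> 0 \<and> (\<exists>a\<in>set as \<union> set bs. det2 v a = 0)}"
  have detS: "mdet rot4 \<noteq> 0" by (simp add: mdet_def rot4_def)
  have "mdet T = - (c^2 + a * b)" by (simp add: T(1) mdet_def power2_eq_square)
  then have detT: "mdet T \<noteq> 0" using T(2) by simp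
  \<comment> \<open>The cross-multiplied relation is first divided by the common factors of
    \<open>f\<close> and \<open>g\<close>, which is legitimate off finitely many lines. In the
    reduced relation a root of one list is never a root of the other, so a zero or pole at
    \<open>app Y v\<close> forces one at \<open>app X v\<close>.\<close>
  have transfer: "app X v \<in> Z"
    if X: "mdet X \<noteq> 0" and Y: "mdet Y \<noteq> 0" and \<kappa>: "\<kappa> \<noteq> 0"
      and rel: "\<And>v. f (app X v) * g (app Y v) = \<kappa> * f (app Y v) * g (app X v)"
      and v: "app Y v \<in> Z" "v \<noteq> 0" for X Y \<kappa> v
  proof -
    have *: "lprod as (app X v) * lprod bs (app Y v) = \<kappa> * lprod as (app Y v) * lprod bs (app X v)" for v
    proof (rule eq_off_lines[where f = "\<lambda>v. lprod as (app X v) * lprod bs (app Y v)"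
          and g = "\<lambda>v. \<kappa> * lprod as (app Y v) * lprod bs (app X v)" and as = "map (app (adj Y)) as0 @ map (app (adj X)) bs0"])
      have ca: "continuous_on UNIV (app h)" for h
        unfolding app_def by (intro continuous_intros)
      have cl: "continuous_on UNIV (\<lambda>v. lprod cs (app h v))" for cs h
        unfolding lprod_app by (rule continuous_lprod)
      show "continuous_on UNIV (\<lambda>v. lprod as (app X v) * lprod bs (app Y v))"
        "continuous_on UNIV (\<lambda>v. \<kappa> * lprod as (app Y v) * lprod bs (app X v))"
        by (intro continuous_intros cl)+
      show "\<And>a. a \<in> set (map (app (adj Y)) as0 @ map (app (adj X)) bs0) \<Longrightarrow> a \<noteq> 0"
        using app_nonzero[of "adj X"] app_nonzero[of "adj Y"] X Y F(3) G(3) by auto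
      fix v assume "lprod (map (app (adj Y)) as0 @ map (app (adj X)) bs0) v \<noteq> 0"
      then have n0: "lprod as0 (app Y v) * lprod bs0 (app X v) \<noteq> 0" by (simp add: lprod_app)
      have "lprod as0 (app X v) * lprod bs0 (app Y v) = \<kappa> * lprod as0 (app Y v) * lprod bs0 (app X v)"
        using rel[of v] F(1) G(1) by (simp add: F(4) G(4))
      then have "k0 * (lprod as0 (app Y v) * lprod bs0 (app X v)) * (lprod as (app X v) * lprod bs (app Y v))
        = k0 * (lprod as0 (app Y v) * lprod bs0 (app X v)) * (\<kappa> * lprod as (app Y v) * lprod bs (app X v))"
        using R(6)[rule_format, of "app X v"] R(6)[rule_format, of "app Y v"] by algebra
      then show "lprod as (app X v) * lprod bs (app Y v) = \<kappa> * lprod as (app Y v) * lprod bs (app X v)"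
        using n0 R(1) by simp
    qed
    have Xv: "app X v \<noteq> 0" using X v app_nonzero by blast
    from v obtain a where a: "a \<in> set as \<union> set bs" "det2 (app Y v) a = 0" "app Y v \<noteq> 0" by (auto simp: Z_def)
    obtain t where t: "t \<noteq> 0" "app Y v = smul t a"
      using det2_zero_parallel[OF a(2,3) nz[OF a(1)]] by blast
    have par: "det2 (app Y v) b \<noteq> 0" if "det2 a b \<noteq> 0" for b
      using that t by simp
    have "lprod as (app X v) = 0 \<or> lprod bs (app X v) = 0"
    proof (cases "a \<in> set as")
      case True
      then have "lprod as (app Y v) = 0" "lprod bs (app Y v) \<noteq> 0"
        using a par R(4) by (auto simp: lprod_zero_iff)
      with *[of v] show ?thesis by simp
    next
      case False
      then have ab: "a \<in> set bs" using a by simp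
      have "det2 a b \<noteq> 0" if "b \<in> set as" for b
        using R(4) that ab det2_swap[of a b] by auto
      then have "lprod bs (app Y v) = 0" "lprod as (app Y v) \<noteq> 0"
        using a ab par by (auto simp: lprod_zero_iff)
      with *[of v] \<kappa> show ?thesis by simp
    qed
    with Xv show ?thesis by (auto simp: Z_def lprod_zero_iff)
  qed
  have TT: "app T (app T v) = v" for v
  proof -
    have "app T (app T v) = smul (c^2 + a * b) v" by (simp add: T(1) app_def smul_def power2_eq_square algebra_simps)
    then show ?thesis using T(2) by simp
  qed
  \<comment> \<open>T is an involution, so adding the T-image makes the set T-stable, and the two
    relations then carry each half under \<open>rot4\<close> into the other half.\<close>
  define Z' where "Z' = Z \<union> app T ` Z"
  have Zmem: "v \<in> Z' \<longleftrightarrow> v \<in> Z \<or> app T v \<in> Z" for v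
  proof -
    have "v \<in> app T ` Z" if "app T v \<in> Z" using that TT[of v] by (intro image_eqI[of _ _ "app T v"]) auto
    then show ?thesis unfolding Z'_def using TT by auto
  qed
  have Znz: "v \<noteq> 0" if "v \<in> Z" for v using that by (simp add: Z_def)
  have T0: "app T 0 = 0" by (simp add: app_def prod_eq_iff)
  have Z'nz: "v \<noteq> 0" if "v \<in> Z'" for v using that Znz[of v] Znz[of "app T v"] T0 unfolding Zmem by metis
  have TZ: "app T v \<in> Z'" if "v \<in> Z'" for v using that unfolding Zmem TT by blast
  have SZ: "app rot4 v \<in> Z'" if vZ: "v \<in> Z'" for v
  proof -
    consider "v \<in> Z" | "app T v \<in> Z" using vZ unfolding Zmem by blast
    then show ?thesis
    proof cases
      case 1
      have one: "app (Mat2 1 0 0 1) w = w" for w by (simp add: app_def)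
      have "app (mul T rot4) v \<in> Z"
        by (rule transfer[where Y = "Mat2 1 0 0 1" and \<kappa> = k1])
          (use 1 Znz detS detT r1 in \<open>auto simp: one app_mul mdet_mul mdet_def[of "Mat2 1 0 0 1"]\<close>)
      then show ?thesis by (simp add: Zmem app_mul)
    next
      case 2
      have "app rot4 v \<in> Z"
        by (rule transfer[where Y = T and \<kappa> = k2]) (use 2 detS detT r2 Z'nz[OF vZ] in auto)
      then show ?thesis by (simp add: Zmem)
    qed
  qed
  define L where "L = (set as \<union> set bs) \<union> app (adj T) ` (set as \<union> set bs)"
  interpret finite_cone Z' L
  proof
    show "finite L" by (simp add: L_def)
    show "l \<noteq> 0" if "l \<in> L" for l
    proof -
      have "app (adj T) a \<noteq> 0" if "a \<in> set as \<union> set bs" for a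
        using app_nonzero[of "adj T" a] nz[OF that] detT by simp
      moreover from \<open>l \<in> L\<close> have "l \<in> set as \<union> set bs \<or> (\<exists>a\<in>set as \<union> set bs. l = app (adj T) a)"
        unfolding L_def image_iff Un_iff[of l "set as \<union> set bs"] .
      ultimately show ?thesis using nz[of l] by metis
    qed
    show "\<exists>l\<in>L. det2 v l = 0" if "v \<in> Z'" for v
    proof -
      from that have "(\<exists>a\<in>set as \<union> set bs. det2 v a = 0) \<or> (\<exists>a\<in>set as \<union> set bs. det2 (app T v) a = 0)"
        unfolding Zmem Z_def by blast
      then show ?thesis unfolding L_def det2_app by blast
    qed
    show "smul s v \<in> Z'" if "v \<in> Z'" "s \<noteq> 0" for s v
    proof -
      have "app T (smul s v) = smul s (app T v)"
        by (simp add: app_def smul_def algebra_simps)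
      moreover have "smul s w \<in> Z" if "w \<in> Z" for w
        using that \<open>s \<noteq> 0\<close> by (auto simp: Z_def smul_zero_iff)
      ultimately show ?thesis using that(1) unfolding Zmem by metis
    qed
  qed (fact Z'nz)
  have "Z' = {}"
    using invariant_cone_axis_ratio[OF _ SZ TZ[unfolded T(1)] T(2-4)] T(5) by blast
  then have Z0: "Z = {}" by (simp add: Z'_def)
  \<comment> \<open>Every remaining root lies on its own line and hence in \<open>Z\<close>; an
    empty \<open>Z\<close> therefore empties both reduced lists.\<close>
  have aZ: "a \<in> Z" if "a \<in> set as \<union> set bs" for a
    using nz[OF that] that det2_swap[of a a] unfolding Z_def by auto
  have "as = []" using aZ[unfolded Z0] by (cases as) auto
  moreover have "bs = []" using aZ[unfolded Z0] by (cases bs) auto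
  ultimately have "as = []" "bs = []" by auto
  then have "m = m'" "\<And>v. lprod as0 v = k0 * lprod bs0 v" using R(5,6) F(2) G(2) by auto
  moreover from this have "f v = (cf * k0 / cg) * g v" for v using F(4) G(1,4) by simp
  moreover have "cf * k0 / cg \<noteq> 0" using F(1) G(1) R(1) by simp
  ultimately show ?thesis by blast
qed

section \<open>The hypergeometric series at the singularity 1\<close>

definition hyp :: "complex \<Rightarrow> complex \<Rightarrow> complex \<Rightarrow> complex fps" where
  "hyp A B C = Abs_fps (\<lambda>k. pochhammer A k * pochhammer B k / (pochhammer C k * fact k))"

text \<open>Gauss' operator x(1 - x) F'' + (C - (A + B + 1) x) F' - A B F on formal power
  series.\<close>

definition hyp_op :: "complex \<Rightarrow> complex \<Rightarrow> complex \<Rightarrow> complex fps \<Rightarrow> complex fps" where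
  "hyp_op A B C F = fps_X * fps_deriv (fps_deriv F) - fps_X * (fps_X * fps_deriv (fps_deriv F))
     + fps_const C * fps_deriv F - fps_const (A + B + 1) * (fps_X * fps_deriv F) - fps_const (A * B) * F"

lemma hyp_op_nth:
  "fps_nth (hyp_op A B C F) n =
     of_nat (Suc n) * (of_nat n + C) * fps_nth F (Suc n) - (of_nat n + A) * (of_nat n + B) * fps_nth F n"
proof (cases n)
  case 0
  then show ?thesis by (simp add: hyp_op_def)
next
  case (Suc m)
  then show ?thesis by (cases m) (simp_all add: hyp_op_def algebra_simps)
qed

lemma hyp_nth_Suc:
  assumes C: "\<And>k::nat. of_nat k + C \<noteq> 0"
  shows "of_nat (Suc n) * (of_nat n + C) * fps_nth (hyp A B C) (Suc n) = (of_nat n + A) * (of_nat n + B) * fps_nth (hyp A B C) n"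
proof -
  have "pochhammer C n \<noteq> 0"
    using C by (auto simp: pochhammer_eq_0_iff) (metis add.right_inverse)
  moreover have "of_nat n + C \<noteq> 0" by (rule C)
  moreover have "of_nat (Suc n) \<noteq> (0::complex)" by (rule of_nat_neq_0)
  ultimately show ?thesis
    unfolding hyp_def fps_nth_Abs_fps pochhammer_Suc fact_Suc
    by (simp add: divide_simps add.commute del: of_nat_Suc)
qed

lemma hyp_ode:
  assumes "\<And>k::nat. of_nat k + C \<noteq> 0"
  shows "hyp_op A B C (hyp A B C) = 0"
  by (rule fps_ext) (simp add: hyp_op_nth hyp_nth_Suc[OF assms] del: of_nat_Suc)

lemma hyp_unique:
  assumes C: "\<And>k::nat. of_nat k + C \<noteq> 0" and G: "hyp_op A B C G = 0" "fps_nth G 0 = 1"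
  shows "G = hyp A B C"
proof (rule fps_ext)
  fix n show "fps_nth G n = fps_nth (hyp A B C) n"
  proof (induction n)
    case 0 show ?case using G by (simp add: hyp_def)
  next
    case (Suc n)
    have "fps_nth (hyp_op A B C G) n = 0" using G by simp
    then have "of_nat (Suc n) * (of_nat n + C) * fps_nth G (Suc n) = of_nat (Suc n) * (of_nat n + C) * fps_nth (hyp A B C) (Suc n)"
      unfolding hyp_op_nth hyp_nth_Suc[OF C] Suc by simp
    moreover have "of_nat (Suc n) * (of_nat n + C) \<noteq> 0" using C[of n] of_nat_neq_0[of n] by simp
    ultimately show ?case by simp
  qed
qed

text \<open>The binomial series of (1 - x)^(1/2).\<close>

definition sqrt_fps :: "complex fps" where
  "sqrt_fps = Abs_fps (\<lambda>k. pochhammer (-1/2) k / fact k)"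

lemma sqrt_fps_deriv: "2 * ((1 - fps_X) * fps_deriv sqrt_fps) = - sqrt_fps"
proof (rule fps_ext)
  fix n
  have rec: "of_nat (Suc k) * fps_nth sqrt_fps (Suc k) = (of_nat k - 1/2) * fps_nth sqrt_fps k" for k
    by (simp add: sqrt_fps_def pochhammer_Suc field_simps del: of_nat_Suc)
  show "fps_nth (2 * ((1 - fps_X) * fps_deriv sqrt_fps)) n = fps_nth (- sqrt_fps) n"
  proof -
    have "fps_nth ((1 - fps_X) * fps_deriv sqrt_fps) n =
        of_nat (Suc n) * fps_nth sqrt_fps (Suc n) - of_nat n * fps_nth sqrt_fps n"
      by (cases n) (simp_all add: left_diff_distrib del: of_nat_Suc)
    also have "\<dots> = - (1/2) * fps_nth sqrt_fps n" 
    proof -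
      have "(t - 1/2) * s - t * s = - (1/2) * s" for t s :: complex
        by (simp add: field_simps)
      then show ?thesis unfolding rec[of n] .
    qed
    finally have "fps_nth ((1 - fps_X) * fps_deriv sqrt_fps) n = - (1/2) * fps_nth sqrt_fps n" .
    then show ?thesis unfolding mult_2 fps_add_nth fps_neg_nth by simp
  qed
qed

text \<open>The algebra behind Euler's transformation: \<open>F\<close> solves Gauss' equation with
  parameters c - a, c - b, c, and S times F solves the one with a, b, c. The factor 4 (1 - X) clears
  the denominators of \<open>S1\<close> and \<open>S2\<close> in terms of \<open>S\<close>, so the
  computation stays in an integral domain.\<close>

lemma euler_identity:
  fixes X :: "'a :: idom"
  assumes abc: "2 * (c - a - b) = 1" and s1: "2 * ((1 - X) * S1) = - S" and s2: "2 * ((1 - X) * S2) = S1"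
    and F: "X * F2 - X * (X * F2) + c * F1 - ((c - a) + (c - b) + 1) * (X * F1) - (c - a) * (c - b) * F = 0"
  shows "4 * (1 - X) * (X * (S2 * F + 2 * S1 * F1 + S * F2) - X * (X * (S2 * F + 2 * S1 * F1 + S * F2))
      + c * (S1 * F + S * F1) - (a + b + 1) * (X * (S1 * F + S * F1)) - a * b * (S * F)) = 0"
    (is "4 * (1 - X) * ?L = 0")
proof -
  define u where "u = 1 - X"
  have e1: "2 * (u * S1) = - S" using s1 by (simp add: u_def)
  have e2: "2 * (u * (2 * (u * S2))) = - S" unfolding u_def s2 s1 ..
  have "4 * u * ?L = X * ((2 * (u * (2 * (u * S2)))) * F + 4 * u * (2 * (u * S1)) * F1 + 4 * u * u * S * F2)
      + (c - (a + b + 1) * X) * (2 * (2 * (u * S1)) * F + 4 * u * (S * F1)) - 4 * u * a * b * S * F"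
    unfolding u_def by (simp add: algebra_simps)
  also have "\<dots> = 4 * u * S * (X * F2 - X * (X * F2) - X * F1 + (c - (a + b + 1) * X) * F1)
      + S * F * (- X - 2 * c + 2 * (a + b + 1) * X - 4 * a * b * u)"
    unfolding e1 e2 unfolding u_def by (simp add: algebra_simps)
  also have "X * F2 - X * (X * F2) - X * F1 + (c - (a + b + 1) * X) * F1
      = (2 * (c - a - b) - 1) * (X * F1) + (c - a) * (c - b) * F"
    using F by (simp add: algebra_simps)
  also have "\<dots> = (c - a) * (c - b) * F" unfolding abc by simp
  also have "4 * u * S * ((c - a) * (c - b) * F) + S * F * (- X - 2 * c + 2 * (a + b + 1) * X - 4 * a * b * u)
      = S * F * (2 * c * u * (2 * (c - a - b)) - X - 2 * c + (2 * (a + b) + 2) * X)"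
    by (simp add: algebra_simps)
  also have "\<dots> = S * F * (2 * c * u - X - 2 * c + (2 * (a + b) + 2) * X)"
    unfolding abc by simp
  also have "\<dots> = S * F * (X * (1 - 2 * (c - a - b)))"
    unfolding u_def by (simp add: algebra_simps)
  also have "\<dots> = 0" unfolding abc by simp
  finally show ?thesis unfolding u_def .
qed

text \<open>For both hypergeometric solutions the exponent \<open>C - A - B\<close> at \<open>1\<close> is \<open>1/2\<close>, so that Euler's
  transformation reduces the behaviour of their derivatives at \<open>1\<close> to Abel's theorem.\<close>

lemma hyp_euler:
  assumes C: "\<And>k::nat. of_nat k + C \<noteq> 0" and half: "C - A - B = 1/2"
  shows "hyp A B C = sqrt_fps * hyp (C - A) (C - B) C"
proof (rule sym, rule hyp_unique[OF C])
  define F where "F = hyp (C - A) (C - B) C"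
  define S where "S = sqrt_fps"
  define F1 F2 S1 S2 where "F1 = fps_deriv F" and "F2 = fps_deriv F1" and "S1 = fps_deriv S" and "S2 = fps_deriv S1"
  define a b c X where "a = fps_const A" and "b = fps_const B" and "c = fps_const C" and "X = (fps_X :: complex fps)"
  have abc: "2 * (c - a - b) = 1"
  proof -
    have "2 * (c - a - b) = fps_const (2 * (C - A - B))"
      unfolding a_def b_def c_def numeral_fps_const by simp
    then show ?thesis using half by simp
  qed
  have s1: "2 * ((1 - X) * S1) = - S" unfolding X_def S1_def S_def by (rule sqrt_fps_deriv)
  have "fps_deriv (2 * ((1 - X) * S1)) = fps_deriv (- S)" by (simp only: s1)
  then have "2 * ((1 - X) * S2 - S1) = - S1"
    unfolding numeral_fps_const by (simp add: S1_def S2_def X_def algebra_simps)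
  then have s2: "2 * ((1 - X) * S2) = S1" by (simp add: algebra_simps)
  have k12: "fps_const (C - A + (C - B) + 1) = (c - a) + (c - b) + 1"
    "fps_const ((C - A) * (C - B)) = (c - a) * (c - b)"
    unfolding a_def b_def c_def by (simp_all flip: fps_const_1_eq_1)
  have k34: "fps_const (A + B + 1) = a + b + 1" "fps_const (A * B) = a * b"
    unfolding a_def b_def c_def by (simp_all flip: fps_const_1_eq_1)
  have F: "X * F2 - X * (X * F2) + c * F1 - ((c - a) + (c - b) + 1) * (X * F1) - (c - a) * (c - b) * F = 0"
    using hyp_ode[OF C, of "C - A" "C - B"]
    unfolding hyp_op_def F_def[symmetric] F1_def[symmetric] F2_def[symmetric] c_def[symmetric] X_def[symmetric] k12 .
  have op: "hyp_op A B C (S * F) = X * (S2 * F + 2 * S1 * F1 + S * F2) - X * (X * (S2 * F + 2 * S1 * F1 + S * F2))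
      + c * (S1 * F + S * F1) - (a + b + 1) * (X * (S1 * F + S * F1)) - a * b * (S * F)"
    unfolding hyp_op_def k34 c_def[symmetric] X_def[symmetric]
    by (simp add: S2_def F2_def S1_def F1_def algebra_simps)
  have "4 * (1 - X) * hyp_op A B C (S * F) = 0"
    unfolding op by (rule euler_identity[OF abc s1 s2 F])
  moreover have "1 - X \<noteq> 0" unfolding X_def by (metis fps_X_neq_one right_minus_eq)
  ultimately show "hyp_op A B C (sqrt_fps * hyp (C - A) (C - B) C) = 0"
    unfolding S_def F_def by simp
  show "fps_nth (sqrt_fps * hyp (C - A) (C - B) C) 0 = 1"
    by (simp add: sqrt_fps_def hyp_def)
qed

text \<open>The coefficient of index n + 1, multiplied by n + 1, is a quotient of the approximating
  products of 1/Gamma at stage n. The factors n^A, n^B and n^C of these products combine to n^(C - A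
  - B).\<close>

lemma hyp_asymp:
  assumes C: "\<And>k::nat. of_nat k + C \<noteq> 0"
  shows "(\<lambda>n. fps_nth (hyp A B C) (Suc n) * of_nat (Suc n) * exp ((C - A - B) * of_real (ln (of_nat n))))
     \<longlonglongrightarrow> Gamma C * rGamma A * rGamma B"
proof -
  have "C \<notin> \<int>\<^sub>\<le>\<^sub>0"
  proof
    assume "C \<in> \<int>\<^sub>\<le>\<^sub>0"
    then obtain n where "C = - of_nat n" by (rule nonpos_Ints_cases')
    with C[of n] show False by simp
  qed
  then have rC: "rGamma C \<noteq> 0" by (simp add: rGamma_eq_zero_iff)
  have "(\<lambda>n. rGamma_series A n * rGamma_series B n / rGamma_series C n) \<longlonglongrightarrow> rGamma A * rGamma B / rGamma C"
    by (intro tendsto_intros rGamma_series_LIMSEQ rC)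
  moreover have "rGamma_series A n * rGamma_series B n / rGamma_series C n =
     fps_nth (hyp A B C) (Suc n) * of_nat (Suc n) * exp ((C - A - B) * of_real (ln (of_nat n)))" for n
  proof -
    define l where "l = complex_of_real (ln (of_nat n))"
    have e: "exp (C * l) = exp ((C - A - B) * l) * exp (A * l) * exp (B * l)"
      by (simp add: algebra_simps flip: exp_add)
    have gen: "pa / (f * ea) * (pb / (f * eb)) / (pc / (f * (E * ea * eb))) = pa * pb / (pc * (g * f)) * g * E"
      if "f \<noteq> 0" "g \<noteq> 0" "ea \<noteq> 0" "eb \<noteq> 0" for pa pb pc f ea eb E g :: complex
      using that by (simp add: field_simps)
    show ?thesis
      unfolding rGamma_series_def hyp_def fps_nth_Abs_fps l_def[symmetric] fact_Suc e Suc_eq_plus1[symmetric] of_nat_mult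
      by (rule gen) (simp_all del: of_nat_Suc)
  qed
  ultimately show ?thesis by (simp add: Gamma_def field_simps)
qed

text \<open>By \<open>hyp_asymp\<close> the coefficients grow at most like n^(-1-s), and s >= -1/2
  keeps them bounded. The values s = 1/2 and s = -1/2 occur, before and after Euler's
  transformation.\<close>

lemma hyp_conv_radius:
  assumes C: "\<And>k::nat. of_nat k + C \<noteq> 0" and s: "C - A - B = of_real s" "- (1/2) \<le> s"
  shows "1 \<le> fps_conv_radius (hyp A B C)"
proof -
  have "convergent (\<lambda>n. fps_nth (hyp A B C) (Suc n) * of_nat (Suc n) * exp ((C - A - B) * of_real (ln (of_nat n))))"
    using hyp_asymp[OF C] by (rule convergentI)
  then have "Bseq (\<lambda>n. fps_nth (hyp A B C) (Suc n) * of_nat (Suc n) * exp ((C - A - B) * of_real (ln (of_nat n))))"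
    by (rule convergent_imp_Bseq)
  then obtain M where M: "\<And>n. norm (fps_nth (hyp A B C) (Suc n) * of_nat (Suc n) * exp ((C - A - B) * of_real (ln (of_nat n)))) \<le> M"
    unfolding Bseq_def by blast
  have M0: "0 \<le> M" using M[of 0] norm_ge_zero order_trans by blast
  have bd: "norm (fps_nth (hyp A B C) (Suc n)) \<le> M" if n: "n \<ge> 1" for n
  proof -
    let ?f = "norm (fps_nth (hyp A B C) (Suc n))"
    have "exp (- (1/2) * ln (real n)) \<le> exp (s * ln (real n))"
      using s(2) n by (intro iffD2[OF exp_le_cancel_iff] mult_right_mono) auto
    moreover have "exp (- ln (real (Suc n))) \<le> exp (- (1/2) * ln (real n))"
    proof -
      have "ln (real n) \<le> ln (real (Suc n))" "0 \<le> ln (real n)" using n by auto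
      then have "- ln (real (Suc n)) \<le> - (1/2) * ln (real n)" by linarith
      then show ?thesis by (rule iffD2[OF exp_le_cancel_iff])
    qed
    ultimately have "exp (- ln (real (Suc n))) \<le> exp (s * ln (real n))" by linarith
    then have "1 \<le> real (Suc n) * exp (s * ln (real n))"
      by (simp add: exp_minus field_simps)
    then have "?f * 1 \<le> ?f * (real (Suc n) * exp (s * ln (real n)))"
      by (intro mult_left_mono) auto
    also have "\<dots> = norm (fps_nth (hyp A B C) (Suc n) * of_nat (Suc n) * exp ((C - A - B) * of_real (ln (of_nat n))))"
      unfolding s(1) norm_mult norm_of_nat norm_exp_eq_Re by simp
    also have "\<dots> \<le> M" by (rule M)
    finally show ?thesis by simp
  qed
  show ?thesis
    unfolding fps_conv_radius_def
  proof (rule conv_radius_geI_ex')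
    fix r :: real assume r: "0 < r" "ereal r < 1"
    have "summable (\<lambda>n. M * r ^ n)" using r by (intro summable_mult summable_geometric) auto
    then show "summable (\<lambda>n. fps_nth (hyp A B C) n * of_real r ^ n)"
    proof (rule summable_comparison_test')
      fix n :: nat assume "n \<ge> 2"
      then obtain m where m: "n = Suc m" "m \<ge> 1" by (cases n) auto
      show "norm (fps_nth (hyp A B C) n * of_real r ^ n) \<le> M * r ^ n"
        using bd[OF m(2)] r unfolding m(1) norm_mult norm_power
        by (intro mult_mono power_mono) (auto simp: M0)
    qed
  qed
qed

text \<open>Abel's theorem relative to the comparison series of (1 - x)^(-1/2). In c = K d + e the
  tail of e is at most (\<epsilon>/2) d, and its finite head is annihilated by the factor sqrt(1 -
  x).\<close>

lemma abel_ratio: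
  fixes c :: "nat \<Rightarrow> complex" and d :: "nat \<Rightarrow> real"
  assumes d: "\<And>n. 0 < d n" and D: "\<And>x. 0 < x \<Longrightarrow> x < 1 \<Longrightarrow> (\<lambda>n. d n * x^n) sums (1 / sqrt (1 - x))"
    and lim: "(\<lambda>n. c n / of_real (d n)) \<longlonglongrightarrow> K"
  shows "((\<lambda>x. of_real (sqrt (1 - x)) * (\<Sum>n. c n * of_real x ^ n)) \<longlongrightarrow> K) (at_left 1)"
proof (rule tendstoI)
  fix \<epsilon> :: real assume \<epsilon>: "\<epsilon> > 0"
  define e where "e n = c n - K * of_real (d n)" for n
  obtain N where N: "\<And>n. n \<ge> N \<Longrightarrow> norm (c n / of_real (d n) - K) < \<epsilon> / 2"
    using LIMSEQ_D[OF lim, of "\<epsilon>/2"] \<epsilon> by auto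
  have eN: "norm (e n) \<le> \<epsilon> / 2 * d n" if "n \<ge> N" for n
  proof -
    have "e n = (c n / of_real (d n) - K) * of_real (d n)" using d[of n] by (simp add: e_def field_simps)
    then have "norm (e n) = norm (c n / of_real (d n) - K) * d n" using d[of n] by (simp only: norm_mult norm_of_real abs_of_pos)
    then show ?thesis using N[OF that] d[of n] by simp
  qed
  define m where "m n = (if n < N then norm (e n) else 0)" for n
  define M where "M = (\<Sum>n<N. norm (e n))"
  have key: "dist (of_real (sqrt (1 - x)) * (\<Sum>n. c n * of_real x ^ n)) K \<le> sqrt (1 - x) * M + \<epsilon> / 2"
    if x: "0 < x" "x < 1" for x
  proof -
    have sm: "summable (\<lambda>n. m n * x ^ n)" and Mle: "(\<Sum>n. m n * x ^ n) \<le> M"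
    proof -
      have 1: "\<And>n. n \<notin> {..<N} \<Longrightarrow> m n * x ^ n = 0" by (auto simp: m_def)
      show "summable (\<lambda>n. m n * x ^ n)" by (rule summable_finite[of "{..<N}", OF _ 1]) auto
      have "(\<Sum>n. m n * x ^ n) = (\<Sum>n<N. m n * x ^ n)" by (rule suminf_finite[of "{..<N}", OF _ 1]) auto
      also have "\<dots> \<le> M" unfolding M_def
        using x by (intro sum_mono) (auto simp: m_def mult_left_le power_le_one)
      finally show "(\<Sum>n. m n * x ^ n) \<le> M" .
    qed
    note Ds = D[OF x]
    have sg: "(\<lambda>n. m n * x^n + \<epsilon> / 2 * (d n * x^n)) sums ((\<Sum>n. m n * x ^ n) + \<epsilon> / 2 * (1 / sqrt (1 - x)))"
      by (intro sums_add sums_mult summable_sums sm Ds)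
    have le: "norm (e n * of_real x ^ n) \<le> m n * x^n + \<epsilon> / 2 * (d n * x^n)" for n
    proof -
      have "norm (e n) \<le> m n + \<epsilon> / 2 * d n"
        using eN[of n] d[of n] \<epsilon> by (cases "n < N") (auto simp: m_def)
      then have "norm (e n) * x^n \<le> (m n + \<epsilon> / 2 * d n) * x^n"
        using x by (intro mult_right_mono) auto
      then show ?thesis using x by (simp add: norm_mult norm_power algebra_simps)
    qed
    have se: "summable (\<lambda>n. e n * of_real x ^ n)"
      by (rule summable_comparison_test'[OF sums_summable[OF sg], of 0]) (rule le)
    have "norm (\<Sum>n. e n * of_real x ^ n) \<le> (\<Sum>n. m n * x^n + \<epsilon> / 2 * (d n * x^n))"
      by (rule norm_suminf_le[OF le sums_summable[OF sg]])
    also have "\<dots> = (\<Sum>n. m n * x ^ n) + \<epsilon> / 2 * (1 / sqrt (1 - x))"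
      using sg by (rule sums_unique[symmetric])
    finally have eb: "norm (\<Sum>n. e n * of_real x ^ n) \<le> M + \<epsilon> / 2 * (1 / sqrt (1 - x))" using Mle by simp
    have cd: "(\<lambda>n. K * of_real (d n * x^n)) sums (K * of_real (1 / sqrt (1 - x)))"
      by (intro sums_mult sums_of_real Ds)
    have "(\<Sum>n. c n * of_real x ^ n) = (\<Sum>n. e n * of_real x ^ n + K * of_real (d n * x^n))"
      by (simp add: e_def algebra_simps)
    also have "\<dots> = (\<Sum>n. e n * of_real x ^ n) + K * of_real (1 / sqrt (1 - x))"
      using suminf_add[OF se sums_summable[OF cd]] sums_unique[OF cd] by simp
    finally have split: "(\<Sum>n. c n * of_real x ^ n) = (\<Sum>n. e n * of_real x ^ n) + K * of_real (1 / sqrt (1 - x))" .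
    have "of_real (sqrt (1 - x)) * (\<Sum>n. c n * of_real x ^ n) - K = of_real (sqrt (1 - x)) * (\<Sum>n. e n * of_real x ^ n)"
      unfolding split using x by (simp add: distrib_left)
    then have "dist (of_real (sqrt (1 - x)) * (\<Sum>n. c n * of_real x ^ n)) K = sqrt (1 - x) * norm (\<Sum>n. e n * of_real x ^ n)"
      using x by (simp add: dist_norm norm_mult)
    also have "\<dots> \<le> sqrt (1 - x) * (M + \<epsilon> / 2 * (1 / sqrt (1 - x)))"
      using eb x by (intro mult_left_mono) auto
    also have "\<dots> = sqrt (1 - x) * M + \<epsilon> / 2" using x by (simp add: distrib_left)
    finally show ?thesis .
  qed
  have "((\<lambda>x. sqrt (1 - x) * M + \<epsilon> / 2) \<longlongrightarrow> sqrt (1 - 1) * M + \<epsilon> / 2) (at_left 1)"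
    by (intro tendsto_intros)
  then have "\<forall>\<^sub>F x in at_left 1. sqrt (1 - x) * M + \<epsilon> / 2 < \<epsilon>"
    by (rule order_tendstoD(2)) (use \<epsilon> in simp)
  moreover have "\<forall>\<^sub>F x in at_left (1::real). 0 < x \<and> x < 1"
    using eventually_at_left_real[of 0 "1::real"] by simp
  ultimately show "\<forall>\<^sub>F x in at_left 1. dist (of_real (sqrt (1 - x)) * (\<Sum>n. c n * of_real x ^ n)) K < \<epsilon>"
    by eventually_elim (use key in force)
qed

lemma inverse_sqrt_series:
  fixes x :: real assumes "0 < x" "x < 1"
  shows "(\<lambda>n. pochhammer (1/2) n / fact n * x^n) sums (1 / sqrt (1 - x))"
proof -
  have "(\<lambda>n. ((-1/2) gchoose n) * (-x)^n) sums (1 + (-x)) powr (-1/2)"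
    using assms by (intro gen_binomial_real) auto
  moreover have "((-1/2) gchoose n) * (-x)^n = pochhammer (1/2) n / fact n * x^n" for n
  proof -
    have "(-1) ^ n * (-1) ^ n = (1 :: real)" by (simp flip: power_mult_distrib)
    then show ?thesis by (simp add: gbinomial_pochhammer power_minus[of x])
  qed
  moreover have "(1 + (-x)) powr (-1/2) = 1 / sqrt (1 - x)"
    using assms by (simp add: powr_minus_divide powr_half_sqrt)
  ultimately show ?thesis by simp
qed

text \<open>The comparison coefficients are those of \<open>hyp (1/2) 1 1\<close>, so
  \<open>hyp_asymp\<close> applies to them too; their limit 1/Gamma(1/2) is the source of the factor
  sqrt pi.\<close>

lemma abel_half:
  fixes c :: "nat \<Rightarrow> complex"
  assumes lim: "(\<lambda>n. c (Suc n) * of_nat (Suc n) * exp (- (1/2) * of_real (ln (of_nat n)))) \<longlonglongrightarrow> L"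
  shows "((\<lambda>x. of_real (sqrt (1 - x)) * (\<Sum>n. c n * of_real x ^ n)) \<longlongrightarrow> L * of_real (sqrt pi)) (at_left 1)"
proof -
  define d :: "nat \<Rightarrow> real" where "d n = pochhammer (1/2) n / fact n" for n
  define w :: "nat \<Rightarrow> complex" where "w n = of_nat (Suc n) * exp (- (1/2) * of_real (ln (of_nat n)))" for n
  have w: "w n \<noteq> 0" for n unfolding w_def using of_nat_neq_0[of n] by simp
  have d0: "0 < d n" for n by (auto simp: d_def intro!: divide_pos_pos pochhammer_pos)
  have C: "of_nat k + 1 \<noteq> (0::complex)" for k :: nat using of_nat_neq_0[of k] by (simp add: add.commute)
  have hd: "fps_nth (hyp (1/2) 1 1) n = of_real (d n)" for n
    by (simp add: hyp_def d_def pochhammer_of_real[symmetric] pochhammer_fact[symmetric])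
  have "(\<lambda>n. of_real (d (Suc n)) * w n) \<longlonglongrightarrow> Gamma 1 * rGamma (1/2) * rGamma 1"
    using hyp_asymp[OF C, of "1/2" 1] unfolding hd w_def by (simp add: mult.assoc)
  also have "Gamma 1 * rGamma (1/2) * rGamma 1 = (1 / of_real (sqrt pi) :: complex)"
    using Gamma_one_half_complex by (simp add: rGamma_inverse_Gamma field_simps)
  finally have dl: "(\<lambda>n. of_real (d (Suc n)) * w n) \<longlonglongrightarrow> 1 / of_real (sqrt pi)" .
  have cl: "(\<lambda>n. c (Suc n) * w n) \<longlonglongrightarrow> L" using lim unfolding w_def by (simp add: mult.assoc)
  have "(\<lambda>n. (c (Suc n) * w n) / (of_real (d (Suc n)) * w n)) \<longlonglongrightarrow> L / (1 / of_real (sqrt pi))"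
    by (intro tendsto_divide cl dl) simp
  then have "(\<lambda>n. c (Suc n) / of_real (d (Suc n))) \<longlonglongrightarrow> L * of_real (sqrt pi)"
    using w by simp
  then have ratio: "(\<lambda>n. c n / of_real (d n)) \<longlonglongrightarrow> L * of_real (sqrt pi)"
    by (rule LIMSEQ_imp_Suc)
  show ?thesis
    by (rule abel_ratio[OF d0 _ ratio]) (use inverse_sqrt_series in \<open>simp add: d_def\<close>)
qed

text \<open>With exponent 1/2 at the singularity the derivative blows up like (1 - x)^(-1/2). The
  factor x realigns the coefficients n f_n of F' with their index.\<close>

lemma hyp_deriv_limit:
  assumes C: "\<And>k::nat. of_nat k + C \<noteq> 0" and half: "C - A - B = 1/2"
  shows "((\<lambda>x. of_real (sqrt (1 - x)) * (of_real x * eval_fps (fps_deriv (hyp A B C)) (of_real x)))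
     \<longlongrightarrow> Gamma C * rGamma A * rGamma B * of_real (sqrt pi)) (at_left 1)"
proof -
  define c where "c = fps_nth (fps_X * fps_deriv (hyp A B C))"
  have c: "c (Suc n) = of_nat (Suc n) * fps_nth (hyp A B C) (Suc n)" for n by (simp add: c_def)
  have "(\<lambda>n. complex_of_real (real n / real (Suc n))) \<longlonglongrightarrow> of_real 1"
    by (intro tendsto_of_real LIMSEQ_n_over_Suc_n)
  then have "(\<lambda>n. complex_of_real (real (Suc n) / real n)) \<longlonglongrightarrow> of_real 1"
    using tendsto_inverse[of "\<lambda>n. complex_of_real (real n / real (Suc n))" "of_real 1" sequentially] by simp
  \<comment> \<open>\<open>abel_half\<close> expects n^(-1/2) where \<open>hyp_asymp\<close> has
    n^(1/2), but the derivative supplies one more factor n + 1; the discrepancy (n + 1)/n tends to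
    1.\<close>
  then have "(\<lambda>n. (fps_nth (hyp A B C) (Suc n) * of_nat (Suc n) * exp ((C - A - B) * of_real (ln (of_nat n))))
      * complex_of_real (real (Suc n) / real n)) \<longlonglongrightarrow> Gamma C * rGamma A * rGamma B * of_real 1"
    by (intro tendsto_mult hyp_asymp[OF C])
  moreover have "\<forall>\<^sub>F n in sequentially. (fps_nth (hyp A B C) (Suc n) * of_nat (Suc n) * exp ((C - A - B) * of_real (ln (of_nat n))))
      * complex_of_real (real (Suc n) / real n) = c (Suc n) * of_nat (Suc n) * exp (- (1/2) * of_real (ln (of_nat n)))"
  proof (rule eventually_mono[OF eventually_gt_at_top[of 0]])
    fix n :: nat assume n: "n > 0"
    define l where "l = complex_of_real (ln (of_nat n))"
    have "exp ((C - A - B) * l) = exp (l + (- (1/2) * l))" unfolding half by (simp add: field_simps)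
    also have "\<dots> = of_nat n * exp (- (1/2) * l)"
      using n unfolding exp_add l_def by (simp add: exp_of_real)
    finally show "(fps_nth (hyp A B C) (Suc n) * of_nat (Suc n) * exp ((C - A - B) * of_real (ln (of_nat n))))
      * complex_of_real (real (Suc n) / real n) = c (Suc n) * of_nat (Suc n) * exp (- (1/2) * of_real (ln (of_nat n)))"
      unfolding c l_def[symmetric] using n by (simp add: field_simps del: of_nat_Suc)
  qed
  ultimately have "(\<lambda>n. c (Suc n) * of_nat (Suc n) * exp (- (1/2) * of_real (ln (of_nat n)))) \<longlonglongrightarrow> Gamma C * rGamma A * rGamma B * of_real 1"
    by (rule Lim_transform_eventually)
  from abel_half[OF this]
  have lim: "((\<lambda>x. of_real (sqrt (1 - x)) * eval_fps (fps_X * fps_deriv (hyp A B C)) (of_real x))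
     \<longlongrightarrow> Gamma C * rGamma A * rGamma B * of_real (sqrt pi)) (at_left 1)"
    by (simp add: c_def eval_fps_def)
  have rad: "1 \<le> fps_conv_radius (hyp A B C)"
    by (rule hyp_conv_radius[OF C, where s = "1/2"]) (simp_all add: half)
  show ?thesis
  proof (rule Lim_transform_eventually[OF lim])
    have "\<forall>\<^sub>F x in at_left (1::real). 0 < x \<and> x < 1"
      using eventually_at_left_real[of 0 "1::real"] by simp
    then show "\<forall>\<^sub>F x in at_left 1. of_real (sqrt (1 - x)) * eval_fps (fps_X * fps_deriv (hyp A B C)) (of_real x)
       = of_real (sqrt (1 - x)) * (of_real x * eval_fps (fps_deriv (hyp A B C)) (of_real x))"
    proof eventually_elim
      case (elim x)
      have "ereal (norm (complex_of_real x)) < 1" using elim by simp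
      also have "1 \<le> fps_conv_radius (fps_deriv (hyp A B C))"
        using rad fps_conv_radius_deriv order_trans by blast
      finally show ?case by (simp add: eval_fps_mult)
    qed
  qed
qed

text \<open>Gauss' value at 1, with Gamma(C - A - B) = Gamma(1/2) = sqrt pi. Euler's transformation
  writes F as sqrt(1 - x) times a series of exponent -1/2, to which \<open>abel_half\<close>
  applies.\<close>

lemma hyp_limit:
  assumes C: "\<And>k::nat. of_nat k + C \<noteq> 0" and half: "C - A - B = 1/2"
  shows "((\<lambda>x. eval_fps (hyp A B C) (of_real x))
     \<longlongrightarrow> Gamma C * rGamma (C - A) * rGamma (C - B) * of_real (sqrt pi)) (at_left 1)"
proof -
  let ?G = "hyp (C - A) (C - B) C"
  have "C - (C - A) - (C - B) = - (C - A - B)" by simp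
  then have mh: "C - (C - A) - (C - B) = - (1/2)" unfolding half .
  have "(\<lambda>n. fps_nth ?G (Suc n) * of_nat (Suc n) * exp (- (1/2) * of_real (ln (of_nat n)))) \<longlonglongrightarrow> Gamma C * rGamma (C - A) * rGamma (C - B)"
    using hyp_asymp[OF C, of "C - A" "C - B"] unfolding mh .
  from abel_half[OF this]
  have lim: "((\<lambda>x. of_real (sqrt (1 - x)) * eval_fps ?G (of_real x))
     \<longlongrightarrow> Gamma C * rGamma (C - A) * rGamma (C - B) * of_real (sqrt pi)) (at_left 1)"
    by (simp add: eval_fps_def)
  show ?thesis
  proof (rule Lim_transform_eventually[OF lim])
    have "\<forall>\<^sub>F x in at_left (1::real). 0 < x \<and> x < 1"
      using eventually_at_left_real[of 0 "1::real"] by simp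
    then show "\<forall>\<^sub>F x in at_left 1. of_real (sqrt (1 - x)) * eval_fps ?G (of_real x) = eval_fps (hyp A B C) (of_real x)"
    proof eventually_elim
      case (elim x)
      have x1: "ereal (norm (complex_of_real x)) < 1" using elim by simp
      have "1 \<le> fps_conv_radius ?G"
        by (rule hyp_conv_radius[OF C, where s = "- (1/2)"]) (unfold mh, simp_all)
      then have xG: "ereal (norm (complex_of_real x)) < fps_conv_radius ?G" by (rule less_le_trans[OF x1])
      have co: "fps_nth sqrt_fps n = ((1/2) gchoose n) * (-1)^n" for n
      proof -
        have "(-1) ^ n * (-1) ^ n = (1 :: complex)" by (simp flip: power_mult_distrib)
        then show ?thesis by (simp add: sqrt_fps_def gbinomial_pochhammer)
      qed
      have "1 \<le> fps_conv_radius sqrt_fps"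
        unfolding fps_conv_radius_def
      proof (rule conv_radius_geI_ex')
        fix r :: real assume r: "0 < r" "ereal r < 1"
        then have "(\<lambda>n. ((1/2) gchoose n) * (- complex_of_real r)^n) sums (1 + (- complex_of_real r)) powr (1/2)"
          by (intro gen_binomial_complex) auto
        then show "summable (\<lambda>n. fps_nth sqrt_fps n * of_real r ^ n)"
          unfolding co by (simp add: sums_iff power_minus[of "complex_of_real r"] mult.assoc)
      qed
      then have xS: "ereal (norm (complex_of_real x)) < fps_conv_radius sqrt_fps" by (rule less_le_trans[OF x1])
      have "(\<lambda>n. ((1/2) gchoose n) * (- x)^n) sums (1 + (- x)) powr (1/2)"
        using elim by (intro gen_binomial_real) auto
      then have "(\<lambda>n. complex_of_real (((1/2) gchoose n) * (- x)^n)) sums of_real ((1 + (- x)) powr (1/2))"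
        by (rule sums_of_real)
      moreover have "complex_of_real (((1/2) gchoose n) * (- x)^n) = fps_nth sqrt_fps n * of_real x ^ n" for n
      proof -
        have "complex_of_real ((1/2) gchoose n) = (1/2) gchoose n"
          by (simp add: gbinomial_pochhammer flip: pochhammer_of_real)
        then show ?thesis unfolding co by (simp add: power_minus[of x])
      qed
      ultimately have "(\<lambda>n. fps_nth sqrt_fps n * of_real x ^ n) sums of_real ((1 + (- x)) powr (1/2))" by simp
      then have "eval_fps sqrt_fps (of_real x) = of_real (sqrt (1 - x))"
        using elim unfolding eval_fps_def by (simp add: sums_iff powr_half_sqrt)
      then show ?case using eval_fps_mult[OF xS xG] hyp_euler[OF C half] by simp
    qed
  qed
qed

lemma hyp_ode_eval:
  assumes C: "\<And>k::nat. of_nat k + C \<noteq> 0" and r: "1 \<le> fps_conv_radius (hyp A B C)" and x: "norm x < 1"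
  defines "F \<equiv> hyp A B C"
  shows "(eval_fps F has_field_derivative eval_fps (fps_deriv F) x) (at x)"
    "(eval_fps (fps_deriv F) has_field_derivative eval_fps (fps_deriv (fps_deriv F)) x) (at x)"
    "x * (1 - x) * eval_fps (fps_deriv (fps_deriv F)) x + (C - (A + B + 1) * x) * eval_fps (fps_deriv F) x
       - A * B * eval_fps F x = 0"
proof -
  have r0: "1 \<le> fps_conv_radius F" using r by (simp add: F_def)
  have r1: "1 \<le> fps_conv_radius (fps_deriv F)" using r0 fps_conv_radius_deriv order_trans by blast
  have r2: "1 \<le> fps_conv_radius (fps_deriv (fps_deriv F))" using r1 fps_conv_radius_deriv order_trans by blast
  have x1: "ereal (norm x) < 1" using x by simp
  have xr: "ereal (norm x) < fps_conv_radius G" if "1 \<le> fps_conv_radius G" for G using x1 that by (rule less_le_trans)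
  show "(eval_fps F has_field_derivative eval_fps (fps_deriv F) x) (at x)"
    "(eval_fps (fps_deriv F) has_field_derivative eval_fps (fps_deriv (fps_deriv F)) x) (at x)"
    by (intro has_field_derivative_eval_fps xr r0 r1)+
  have m: "1 \<le> fps_conv_radius (G * H)" if "1 \<le> fps_conv_radius G" "1 \<le> fps_conv_radius H" for G H :: "complex fps"
    using fps_conv_radius_mult[of G H] that by (meson min.boundedI order_trans)
  have ad: "1 \<le> fps_conv_radius (G + H)" if "1 \<le> fps_conv_radius G" "1 \<le> fps_conv_radius H" for G H :: "complex fps"
    using fps_conv_radius_add[of G H] that by (meson min.boundedI order_trans)
  have di: "1 \<le> fps_conv_radius (G - H)" if "1 \<le> fps_conv_radius G" "1 \<le> fps_conv_radius H" for G H :: "complex fps"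
    using fps_conv_radius_diff[of G H] that by (meson min.boundedI order_trans)
  have c: "1 \<le> fps_conv_radius (fps_const k :: complex fps)" "1 \<le> fps_conv_radius (fps_X :: complex fps)" for k by simp_all
  have "eval_fps (hyp_op A B C F) x = 0" unfolding F_def hyp_ode[OF C] by simp
  also have "eval_fps (hyp_op A B C F) x = x * eval_fps (fps_deriv (fps_deriv F)) x - x * (x * eval_fps (fps_deriv (fps_deriv F)) x)
     + C * eval_fps (fps_deriv F) x - (A + B + 1) * (x * eval_fps (fps_deriv F) x) - A * B * eval_fps F x"
    unfolding hyp_op_def
    by (simp only: eval_fps_add eval_fps_diff eval_fps_mult eval_fps_const eval_fps_X xr m ad di c r0 r1 r2)
  finally show "x * (1 - x) * eval_fps (fps_deriv (fps_deriv F)) x + (C - (A + B + 1) * x) * eval_fps (fps_deriv F) x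
       - A * B * eval_fps F x = 0" by (simp add: algebra_simps)
qed

section \<open>The normal variational equation\<close>

text \<open>The momentum p1 along the planar orbit up to a constant factor. On |y| < 1 the number 1
  - y^4 has positive real part, so the principal branch is holomorphic there.\<close>

definition root4 :: "complex \<Rightarrow> complex" where "root4 y = csqrt (1 - y^4)"

lemma Re_one_minus_power4: "norm y < 1 \<Longrightarrow> Re (1 - y^4) > 0"
proof -
  assume "norm y < 1"
  then have "norm (y^4) < 1" by (simp add: norm_power power_less_one_iff)
  then show ?thesis using complex_Re_le_cmod[of "y^4"] by simp
qed

lemma root4_sq [simp]: "root4 y ^ 2 = 1 - y^4"
  by (simp add: root4_def)

lemma root4_nonzero: "norm y < 1 \<Longrightarrow> root4 y \<noteq> 0"
  using Re_one_minus_power4[of y] by (auto simp: root4_def)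

lemma root4_deriv:
  assumes "norm y < 1" shows "(root4 has_field_derivative - 2 * y^3 / root4 y) (at y)"
proof -
  have "1 - y^4 \<notin> \<real>\<^sub>\<le>\<^sub>0" using Re_one_minus_power4[OF assms] complex_nonpos_Reals_iff by force
  then have c: "(csqrt has_field_derivative inverse (2 * csqrt (1 - y^4))) (at (1 - y^4))"
    by (rule has_field_derivative_csqrt)
  have p: "((\<lambda>y. 1 - y^4) has_field_derivative - (4 * y^3)) (at y)"
    by (auto intro!: derivative_eq_intros)
  have "inverse (2 * c) * (- (4 * t)) = - 2 * t / c" for c t :: complex
    by (cases "c = 0") (simp_all add: field_simps)
  then show ?thesis using DERIV_chain2[OF c p] unfolding root4_def by (simp only:)
qed

text \<open>The first-order system u' = v / root4, v' = -2 lam y^2 u / root4 is the normal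
  variational equation with q1 = y as independent variable. In x = y^4 it becomes Gauss' equation
  with exponents 0 and 1/4 at x = 0; this is the solution with exponent 0.\<close>

lemma first_solution:
  fixes lam :: complex
  assumes C: "\<And>k::nat. of_nat k + C \<noteq> 0" and r: "1 \<le> fps_conv_radius (hyp A B C)"
    and par: "C = 3/4" "A + B = 1/4" "A * B = - lam / 8" and y: "norm y < 1"
  defines "F \<equiv> hyp A B C"
  shows "((\<lambda>y. eval_fps F (y^4)) has_field_derivative root4 y * (4 * y^3 * eval_fps (fps_deriv F) (y^4)) / root4 y) (at y)"
    "((\<lambda>y. root4 y * (4 * y^3 * eval_fps (fps_deriv F) (y^4))) has_field_derivative - 2 * lam * y^2 * eval_fps F (y^4) / root4 y) (at y)"
proof -
  have x: "norm (y^4) < 1" using y by (simp add: norm_power power_less_one_iff)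
  note H = hyp_ode_eval[OF C r x, folded F_def]
  note R = root4_nonzero[OF y]
  have p: "((\<lambda>y. y^4) has_field_derivative 4 * y^3) (at y)" by (auto intro!: derivative_eq_intros)
  show "((\<lambda>y. eval_fps F (y^4)) has_field_derivative root4 y * (4 * y^3 * eval_fps (fps_deriv F) (y^4)) / root4 y) (at y)"
    using DERIV_chain2[OF H(1) p] R by (simp add: mult_ac)
  define f0 f1 f2 where "f0 = eval_fps F (y^4)" and "f1 = eval_fps (fps_deriv F) (y^4)" and "f2 = eval_fps (fps_deriv (fps_deriv F)) (y^4)"
  have d1: "((\<lambda>y. eval_fps (fps_deriv F) (y^4)) has_field_derivative f2 * (4 * y^3)) (at y)"
    unfolding f2_def by (rule DERIV_chain2[OF H(2) p])
  have D: "((\<lambda>y. root4 y * (4 * y^3 * eval_fps (fps_deriv F) (y^4))) has_field_derivative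
     (- 2 * y^3 / root4 y) * (4 * y^3 * f1) + root4 y * (12 * y^2 * f1 + 4 * y^3 * (f2 * (4 * y^3)))) (at y)"
    unfolding f1_def by (rule derivative_eq_intros root4_deriv[OF y] d1 refl | simp add: algebra_simps)+
  have "y^4 * (1 - y^4) * f2 + (3/4 - 5/4 * y^4) * f1 + lam / 8 * f0 = 0"
  proof -
    have s1: "A + B + 1 = 5/4" unfolding par(2) by simp
    show ?thesis using H(3) unfolding f0_def f1_def f2_def par(3) s1 par(1) by simp
  qed
  \<comment> \<open>The factor 16 clears the fractions and matches the square of 4 y^3 from the
    chain rule.\<close>
  from arg_cong[OF this, of "\<lambda>t. 16 * t"]
  have "16 * (y^4 * (1 - y^4) * f2) + (12 - 20 * y^4) * f1 + 2 * lam * f0 = 0" by (simp add: algebra_simps)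
  then have ode: "- 8 * y^6 * f1 + (1 - y^4) * (12 * y^2 * f1 + 16 * y^6 * f2) = - 2 * lam * y^2 * f0" by algebra
  have "(- 2 * y^3 / root4 y) * (4 * y^3 * f1) + root4 y * (12 * y^2 * f1 + 4 * y^3 * (f2 * (4 * y^3)))
     = (- 8 * y^6 * f1 + root4 y ^ 2 * (12 * y^2 * f1 + 16 * y^6 * f2)) / root4 y"
    using R by (simp add: field_simps power2_eq_square flip: power_add)
  also have "\<dots> = - 2 * lam * y^2 * f0 / root4 y" unfolding root4_sq ode ..
  finally show "((\<lambda>y. root4 y * (4 * y^3 * eval_fps (fps_deriv F) (y^4))) has_field_derivative - 2 * lam * y^2 * eval_fps F (y^4) / root4 y) (at y)"
    using D unfolding f0_def by simp
qed

text \<open>The exponent 1/4 in x = y^4 is the prefactor y; the parameters are A + 1/4, B + 1/4 and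
  2 - C in terms of those of the first solution.\<close>

lemma second_solution:
  fixes lam :: complex
  assumes C: "\<And>k::nat. of_nat k + C \<noteq> 0" and r: "1 \<le> fps_conv_radius (hyp A B C)"
    and par: "C = 5/4" "A + B = 3/4" "A * B = (1 - lam) / 8" and y: "norm y < 1"
  defines "F \<equiv> hyp A B C"
  shows "((\<lambda>y. y * eval_fps F (y^4)) has_field_derivative root4 y * (eval_fps F (y^4) + 4 * y^4 * eval_fps (fps_deriv F) (y^4)) / root4 y) (at y)"
    "((\<lambda>y. root4 y * (eval_fps F (y^4) + 4 * y^4 * eval_fps (fps_deriv F) (y^4))) has_field_derivative - 2 * lam * y^2 * (y * eval_fps F (y^4)) / root4 y) (at y)"
proof -
  have x: "norm (y^4) < 1" using y by (simp add: norm_power power_less_one_iff)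
  note H = hyp_ode_eval[OF C r x, folded F_def]
  note R = root4_nonzero[OF y]
  have p: "((\<lambda>y. y^4) has_field_derivative 4 * y^3) (at y)" by (auto intro!: derivative_eq_intros)
  define f0 f1 f2 where "f0 = eval_fps F (y^4)" and "f1 = eval_fps (fps_deriv F) (y^4)" and "f2 = eval_fps (fps_deriv (fps_deriv F)) (y^4)"
  have d0: "((\<lambda>y. eval_fps F (y^4)) has_field_derivative f1 * (4 * y^3)) (at y)"
    unfolding f1_def by (rule DERIV_chain2[OF H(1) p])
  have d1: "((\<lambda>y. eval_fps (fps_deriv F) (y^4)) has_field_derivative f2 * (4 * y^3)) (at y)"
    unfolding f2_def by (rule DERIV_chain2[OF H(2) p])
  have "((\<lambda>y. y * eval_fps F (y^4)) has_field_derivative 1 * f0 + y * (f1 * (4 * y^3))) (at y)"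
    unfolding f0_def by (rule derivative_eq_intros d0 refl | simp)+
  moreover have "1 * f0 + y * (f1 * (4 * y^3)) = root4 y * (f0 + 4 * y^4 * f1) / root4 y"
    using R by (simp add: power4_eq_xxxx power3_eq_cube)
  ultimately show "((\<lambda>y. y * eval_fps F (y^4)) has_field_derivative root4 y * (eval_fps F (y^4) + 4 * y^4 * eval_fps (fps_deriv F) (y^4)) / root4 y) (at y)"
    unfolding f0_def f1_def by simp
  have D: "((\<lambda>y. root4 y * (eval_fps F (y^4) + 4 * y^4 * eval_fps (fps_deriv F) (y^4))) has_field_derivative
     (- 2 * y^3 / root4 y) * (f0 + 4 * y^4 * f1) + root4 y * (f1 * (4 * y^3) + (16 * y^3 * f1 + 4 * y^4 * (f2 * (4 * y^3))))) (at y)"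
    unfolding f0_def f1_def by (rule derivative_eq_intros root4_deriv[OF y] d1 d0[unfolded f1_def] refl | simp add: algebra_simps)+
  have "y^4 * (1 - y^4) * f2 + (5/4 - 7/4 * y^4) * f1 - (1 - lam) / 8 * f0 = 0"
  proof -
    have s1: "A + B + 1 = 7/4" unfolding par(2) by simp
    show ?thesis using H(3) unfolding f0_def f1_def f2_def par(3) s1 par(1) by simp
  qed
  from arg_cong[OF this, of "\<lambda>t. 16 * t"]
  have "16 * (y^4 * (1 - y^4) * f2) + (20 - 28 * y^4) * f1 - 2 * (1 - lam) * f0 = 0"
    by (simp add: algebra_simps diff_divide_distrib)
  then have ode: "- 2 * y^3 * (f0 + 4 * y^4 * f1) + (1 - y^4) * (20 * y^3 * f1 + 16 * y^7 * f2) = - 2 * lam * y^2 * (y * f0)" by algebra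
  have "(- 2 * y^3 / root4 y) * (f0 + 4 * y^4 * f1) + root4 y * (f1 * (4 * y^3) + (16 * y^3 * f1 + 4 * y^4 * (f2 * (4 * y^3))))
     = (- 2 * y^3 * (f0 + 4 * y^4 * f1) + root4 y ^ 2 * (20 * y^3 * f1 + 16 * y^7 * f2)) / root4 y"
    using R by (simp add: field_simps power2_eq_square flip: power_add)
  also have "\<dots> = - 2 * lam * y^2 * (y * f0) / root4 y" unfolding root4_sq ode ..
  finally show "((\<lambda>y. root4 y * (eval_fps F (y^4) + 4 * y^4 * eval_fps (fps_deriv F) (y^4))) has_field_derivative - 2 * lam * y^2 * (y * eval_fps F (y^4)) / root4 y) (at y)"
    using D unfolding f0_def by simp
qed

lemma filterlim_power4_at_left: "filterlim (\<lambda>y::real. y^4) (at_left 1) (at_left 1)"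
  unfolding filterlim_at
proof
  have "\<forall>\<^sub>F y in at_left (1::real). 0 < y \<and> y < 1"
    using eventually_at_left_real[of 0 "1::real"] by simp
  then show "\<forall>\<^sub>F y::real in at_left 1. y^4 \<in> {..<1} \<and> y^4 \<noteq> 1"
  proof eventually_elim
    case (elim y)
    then have "y^4 < 1" by (simp add: power_less_one_iff)
    then show ?case by simp
  qed
  have "((\<lambda>y::real. y^4) \<longlongrightarrow> 1^4) (at_left 1)" by (intro tendsto_intros)
  then show "((\<lambda>y::real. y^4) \<longlongrightarrow> 1) (at_left 1)" by simp
qed

lemma eventually_unit_at_left: "\<forall>\<^sub>F y in at_left (1::real). 0 < y \<and> y < 1"
  using eventually_at_left_real[of 0 "1::real"] by simp

lemma root4_of_real:
  assumes "0 < y" "y < 1" shows "root4 (of_real y) = of_real (sqrt (1 - y^4))"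
proof -
  have "0 \<le> 1 - y^4" using assms by (simp add: power_le_one)
  then have "csqrt (of_real (1 - y^4)) = of_real (sqrt (1 - y^4))"
    by (rule of_real_sqrt[symmetric])
  then show ?thesis unfolding root4_def by simp
qed

lemma root4_tendsto: "((\<lambda>y. root4 (of_real y)) \<longlongrightarrow> 0) (at_left (1::real))"
proof -
  have "((\<lambda>y. complex_of_real (sqrt (1 - y^4))) \<longlongrightarrow> of_real (sqrt (1 - 1^4))) (at_left (1::real))"
    by (intro tendsto_intros)
  then have "((\<lambda>y. complex_of_real (sqrt (1 - y^4))) \<longlongrightarrow> 0) (at_left (1::real))" by simp
  then show ?thesis
    by (rule Lim_transform_eventually)
      (rule eventually_mono[OF eventually_unit_at_left], simp add: root4_of_real)
qed

text \<open>The difference of the first two parameters of the hypergeometric solutions.\<close>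

definition exponent_diff :: "real \<Rightarrow> complex" where
  "exponent_diff lam = csqrt (of_real (1 + 8 * lam)) / 4"

text \<open>Arguments adding up to 1 are paired, 3/8 + \<rho>/2 with 5/8 - \<rho>/2 and 3/8 -
  \<rho>/2 with 5/8 + \<rho>/2, so that the reflection formula produces two sines. The rest is 4
  Gamma(5/4) = Gamma(1/4) and Gamma(1/4) Gamma(3/4) = pi sqrt 2.\<close>

lemma connection_product:
  fixes \<rho> :: complex
  shows "Gamma (3/4) * rGamma (5/8 - \<rho>/2) * rGamma (5/8 + \<rho>/2) * of_real (sqrt pi) *
     (4 * (Gamma (5/4) * rGamma (3/8 + \<rho>/2) * rGamma (3/8 - \<rho>/2) * of_real (sqrt pi)))
     = (1 + of_real (sqrt 2) * cos (of_real pi * \<rho>)) / 2" (is "?L = _")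
proof -
  define p q where "p = of_real pi * (3/8 + \<rho>/2)" and "q = of_real pi * (3/8 - \<rho>/2)"
  have r1: "rGamma (3/8 + \<rho>/2) * rGamma (5/8 - \<rho>/2) = sin p / of_real pi"
    using rGamma_reflection_complex[of "3/8 + \<rho>/2"] by (simp add: p_def algebra_simps)
  have r2: "rGamma (3/8 - \<rho>/2) * rGamma (5/8 + \<rho>/2) = sin q / of_real pi"
    using rGamma_reflection_complex[of "3/8 - \<rho>/2"] by (simp add: q_def algebra_simps)
  have "(1/4 :: complex) \<notin> \<int>\<^sub>\<le>\<^sub>0" by (auto elim!: nonpos_Ints_cases' simp: complex_eq_iff)
  then have g1: "4 * Gamma (5/4) = (Gamma (1/4) :: complex)"
    using Gamma_plus1[of "1/4 :: complex"] by (simp add: mult.commute)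
  have "sin (complex_of_real pi * (3/4)) = of_real (sin (pi * (3/4)))"
    unfolding sin_of_real[symmetric] by simp
  also have "sin (pi * (3/4)) = sqrt 2 / 2"
  proof -
    have "pi * (3/4) = pi - pi / 4" by simp
    then show ?thesis by (simp only: sin_pi_minus sin_45)
  qed
  finally have s34: "sin (complex_of_real pi * (3/4)) = of_real (sqrt 2 / 2)" .
  have g2: "Gamma (3/4) * Gamma (1/4 :: complex) = of_real pi * of_real (sqrt 2)"
  proof -
    have q: "1 - 3/4 = (1/4 :: complex)" by simp
    have "Gamma (3/4) * Gamma (1/4 :: complex) = of_real pi / of_real (sqrt 2 / 2)"
      using Gamma_reflection_complex[of "3/4"] unfolding s34 q .
    also have "\<dots> = of_real (pi / (sqrt 2 / 2))" by simp
    also have "pi / (sqrt 2 / 2) = pi * sqrt 2" by (simp add: field_simps)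
    finally show ?thesis by simp
  qed
  have sp: "of_real (sqrt pi) * of_real (sqrt pi) = (of_real pi :: complex)"
    by (simp flip: of_real_mult)
  have s2: "of_real (sqrt 2) * of_real (sqrt 2) = (2 :: complex)"
    by (simp flip: of_real_mult)
  have "?L = (Gamma (3/4) * (4 * Gamma (5/4))) * (of_real (sqrt pi) * of_real (sqrt pi))
     * (rGamma (3/8 + \<rho>/2) * rGamma (5/8 - \<rho>/2)) * (rGamma (3/8 - \<rho>/2) * rGamma (5/8 + \<rho>/2))"
    by (simp only: mult_ac)
  also have "\<dots> = of_real (sqrt 2) * (sin p * sin q)"
    unfolding g1 g2 sp r1 r2 by (simp add: field_simps)
  also have "sin p * sin q = (cos (p - q) - cos (p + q)) / 2" by (simp add: cos_diff cos_add)
  also have "p - q = of_real pi * \<rho>" by (simp add: p_def q_def algebra_simps)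
  also have "cos (p + q) = - of_real (sqrt 2 / 2)"
  proof -
    have "p + q = of_real (pi * (3/4))" by (simp add: p_def q_def algebra_simps)
    then have "cos (p + q) = of_real (cos (pi * (3/4)))" by (simp only: cos_of_real)
    moreover have "pi * (3/4) = pi - pi / 4" by simp
    ultimately show ?thesis by (simp only: cos_pi_minus cos_45 of_real_minus)
  qed
  finally have "?L = of_real (sqrt 2) * ((cos (of_real pi * \<rho>) + of_real (sqrt 2) / 2) / 2)" by simp
  also have "\<dots> = (of_real (sqrt 2) * cos (of_real pi * \<rho>) + (of_real (sqrt 2) * of_real (sqrt 2)) / 2) / 2"
    by (simp add: algebra_simps)
  finally show ?thesis unfolding s2 by (simp add: add.commute)
qed

text \<open>The four limits are the entries of the connection matrix from the basis at y = 0 to the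
  values of (u, v) at y = 1. Its determinant is the constant Wronskian 1, so \<alpha>\<delta> +
  \<beta>\<gamma> = 2\<alpha>\<delta> - 1 = sqrt 2 cos(pi \<rho>), whose square is the quantity that
  decides between the exceptional cases.\<close>

lemma variational_solutions:
  fixes lam :: real
  obtains u1 u2 v1 v2 :: "complex \<Rightarrow> complex" and \<alpha> \<beta> \<gamma> \<delta> :: complex where
    "\<And>y. norm y < 1 \<Longrightarrow> (u1 has_field_derivative v1 y / root4 y) (at y)"
    "\<And>y. norm y < 1 \<Longrightarrow> (v1 has_field_derivative - 2 * of_real lam * y^2 * u1 y / root4 y) (at y)"
    "\<And>y. norm y < 1 \<Longrightarrow> (u2 has_field_derivative v2 y / root4 y) (at y)"
    "\<And>y. norm y < 1 \<Longrightarrow> (v2 has_field_derivative - 2 * of_real lam * y^2 * u2 y / root4 y) (at y)"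
    "\<And>y. u1 (\<i> * y) = u1 y" "\<And>y. v1 (\<i> * y) = - \<i> * v1 y"
    "\<And>y. u2 (\<i> * y) = \<i> * u2 y" "\<And>y. v2 (\<i> * y) = v2 y"
    "\<And>y. norm y < 1 \<Longrightarrow> u1 y * v2 y - u2 y * v1 y = 1"
    "((\<lambda>y. u1 (of_real y)) \<longlongrightarrow> \<alpha>) (at_left 1)" "((\<lambda>y. u2 (of_real y)) \<longlongrightarrow> \<beta>) (at_left 1)"
    "((\<lambda>y. v1 (of_real y)) \<longlongrightarrow> \<gamma>) (at_left 1)" "((\<lambda>y. v2 (of_real y)) \<longlongrightarrow> \<delta>) (at_left 1)"
    "\<alpha> * \<delta> - \<beta> * \<gamma> = 1"
    "(\<alpha> * \<delta> + \<beta> * \<gamma>)^2 = 1 + cos (2 * of_real pi * exponent_diff lam)"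
proof -
  define \<rho> where "\<rho> = exponent_diff lam"
  have \<rho>2: "16 * \<rho>^2 = 1 + 8 * of_real lam"
    by (simp add: \<rho>_def exponent_diff_def power_divide)
  define A B C A' B' C' :: complex where "A = 1/8 + \<rho>/2" and "B = 1/8 - \<rho>/2" and "C = 3/4"
    and "A' = 3/8 + \<rho>/2" and "B' = 3/8 - \<rho>/2" and "C' = 5/4"
  have pos: "of_nat k + complex_of_real r \<noteq> 0" if "r > 0" for k r
  proof -
    have "real k + r \<noteq> 0" using that by (metis add_nonneg_pos less_irrefl of_nat_0_le_iff)
    then show ?thesis by (metis of_real_add of_real_eq_0_iff of_real_of_nat_eq)
  qed
  have C: "of_nat k + C \<noteq> 0" for k :: nat using pos[of "3/4" k] by (simp add: C_def)
  have C': "of_nat k + C' \<noteq> 0" for k :: nat using pos[of "5/4" k] by (simp add: C'_def)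
  have half: "C - A - B = 1/2" "C' - A' - B' = 1/2" by (simp_all add: A_def B_def C_def A'_def B'_def C'_def)
  have r: "1 \<le> fps_conv_radius (hyp A B C)"
    by (rule hyp_conv_radius[OF C, where s = "1/2"]) (unfold half, simp_all)
  have r': "1 \<le> fps_conv_radius (hyp A' B' C')"
    by (rule hyp_conv_radius[OF C', where s = "1/2"]) (unfold half, simp_all)
  have AB: "A + B = 1/4" "A * B = - of_real lam / 8"
    using \<rho>2 by (simp_all add: A_def B_def field_simps power2_eq_square)
  have AB': "A' + B' = 3/4" "A' * B' = (1 - of_real lam) / 8"
    using \<rho>2 by (simp_all add: A'_def B'_def field_simps power2_eq_square)
  define F F' where "F = hyp A B C" and "F' = hyp A' B' C'"
  define u1 v1 u2 v2 where "u1 y = eval_fps F (y^4)" and "v1 y = root4 y * (4 * y^3 * eval_fps (fps_deriv F) (y^4))"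
    and "u2 y = y * eval_fps F' (y^4)" and "v2 y = root4 y * (eval_fps F' (y^4) + 4 * y^4 * eval_fps (fps_deriv F') (y^4))" for y
  have d: "(u1 has_field_derivative v1 y / root4 y) (at y)"
    "(v1 has_field_derivative - 2 * of_real lam * y^2 * u1 y / root4 y) (at y)" if "norm y < 1" for y
    using first_solution[OF C r C_def AB that] unfolding u1_def v1_def F_def by blast+
  have d': "(u2 has_field_derivative v2 y / root4 y) (at y)"
    "(v2 has_field_derivative - 2 * of_real lam * y^2 * u2 y / root4 y) (at y)" if "norm y < 1" for y
    using second_solution[OF C' r' C'_def AB' that] unfolding u2_def v2_def F'_def by blast+
  have i4: "(\<i> * y)^4 = y^4" "(\<i> * y)^3 = - \<i> * y^3" for y
  proof -
    have "\<i>^4 = 1" "\<i>^3 = - \<i>" by (simp_all add: power4_eq_xxxx power3_eq_cube)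
    then show "(\<i> * y)^4 = y^4" "(\<i> * y)^3 = - \<i> * y^3" by (simp_all only: power_mult_distrib mult_1)
  qed
  have ri: "root4 (\<i> * y) = root4 y" for y by (simp add: root4_def i4)
  have rot: "u1 (\<i> * y) = u1 y" "v1 (\<i> * y) = - \<i> * v1 y" "u2 (\<i> * y) = \<i> * u2 y" "v2 (\<i> * y) = v2 y" for y
    unfolding u1_def v1_def u2_def v2_def ri i4 by simp_all
  have W: "u1 y * v2 y - u2 y * v1 y = 1" if y: "norm y < 1" for y
  proof -
    have "((\<lambda>y. u1 y * v2 y - u2 y * v1 y) has_field_derivative 0) (at z)" if "norm z < 1" for z
    proof -
      have "((\<lambda>y. u1 y * v2 y - u2 y * v1 y) has_field_derivative
         (v1 z / root4 z * v2 z + (- 2 * of_real lam * z^2 * u2 z / root4 z) * u1 z) -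
         (v2 z / root4 z * v1 z + (- 2 * of_real lam * z^2 * u1 z / root4 z) * u2 z)) (at z)"
        by (intro DERIV_diff DERIV_mult d d' that)
      then show ?thesis by simp
    qed
    then have "(\<lambda>y. u1 y * v2 y - u2 y * v1 y) constant_on ball 0 1"
      by (intro has_field_derivative_0_imp_constant_on) auto
    then have "u1 y * v2 y - u2 y * v1 y = u1 0 * v2 0 - u2 0 * v1 0"
      using y unfolding constant_on_def by (metis mem_ball_0 norm_zero zero_less_one)
    also have "\<dots> = 1"
      by (simp add: u1_def v1_def u2_def v2_def root4_def eval_fps_at_0 F_def F'_def hyp_def)
    finally show ?thesis .
  qed
  define L L' D D' where "L = Gamma C * rGamma (C - A) * rGamma (C - B) * of_real (sqrt pi)"
    and "L' = Gamma C' * rGamma (C' - A') * rGamma (C' - B') * of_real (sqrt pi)"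
    and "D = Gamma C * rGamma A * rGamma B * of_real (sqrt pi)"
    and "D' = Gamma C' * rGamma A' * rGamma B' * of_real (sqrt pi)"
  have lim1: "((\<lambda>y. eval_fps F (of_real y ^ 4)) \<longlongrightarrow> L) (at_left 1)"
    using filterlim_compose[OF hyp_limit[OF C half(1)] filterlim_power4_at_left] by (simp add: L_def F_def)
  have lim2: "((\<lambda>y. eval_fps F' (of_real y ^ 4)) \<longlongrightarrow> L') (at_left 1)"
    using filterlim_compose[OF hyp_limit[OF C' half(2)] filterlim_power4_at_left] by (simp add: L'_def F'_def)
  have ry: "\<forall>\<^sub>F y in at_left 1. of_real (sqrt (1 - y^4)) * G y = root4 (of_real y) * G y" for G :: "real \<Rightarrow> complex"
    by (rule eventually_mono[OF eventually_unit_at_left]) (simp add: root4_of_real)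
  have lim3: "((\<lambda>y. root4 (of_real y) * (of_real y ^ 4 * eval_fps (fps_deriv F) (of_real y ^ 4))) \<longlongrightarrow> D) (at_left 1)"
    using filterlim_compose[OF hyp_deriv_limit[OF C half(1)] filterlim_power4_at_left]
    by (intro Lim_transform_eventually[OF _ ry]) (simp add: D_def F_def)
  have lim4: "((\<lambda>y. root4 (of_real y) * (of_real y ^ 4 * eval_fps (fps_deriv F') (of_real y ^ 4))) \<longlongrightarrow> D') (at_left 1)"
    using filterlim_compose[OF hyp_deriv_limit[OF C' half(2)] filterlim_power4_at_left]
    by (intro Lim_transform_eventually[OF _ ry]) (simp add: D'_def F'_def)
  have l1: "((\<lambda>y. u1 (of_real y)) \<longlongrightarrow> L) (at_left 1)" unfolding u1_def by (rule lim1)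
  have yl: "((\<lambda>y. complex_of_real y) \<longlongrightarrow> of_real 1) (at_left 1)" by (intro tendsto_intros)
  have l2: "((\<lambda>y. u2 (of_real y)) \<longlongrightarrow> L') (at_left 1)"
    using tendsto_mult[OF yl lim2] unfolding u2_def by simp
  have "((\<lambda>y. 4 * inverse (complex_of_real y) * (root4 (of_real y) * (of_real y ^ 4 * eval_fps (fps_deriv F) (of_real y ^ 4)))) \<longlongrightarrow> 4 * inverse (of_real 1) * D) (at_left 1)"
    by (intro tendsto_intros lim3) simp
  then have l3: "((\<lambda>y. v1 (of_real y)) \<longlongrightarrow> 4 * D) (at_left 1)"
    unfolding of_real_1 inverse_1 mult_1_right
    by (rule Lim_transform_eventually)
      (rule eventually_mono[OF eventually_unit_at_left], simp add: v1_def power4_eq_xxxx power3_eq_cube)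
  have "((\<lambda>y. root4 (of_real y) * eval_fps F' (of_real y ^ 4) + 4 * (root4 (of_real y) * (of_real y ^ 4 * eval_fps (fps_deriv F') (of_real y ^ 4)))) \<longlongrightarrow> 0 * L' + 4 * D') (at_left 1)"
    by (intro tendsto_intros lim2 lim4 root4_tendsto)
  then have l4: "((\<lambda>y. v2 (of_real y)) \<longlongrightarrow> 4 * D') (at_left 1)"
    unfolding v2_def by (simp add: algebra_simps)
  have "((\<lambda>y. u1 (of_real y) * v2 (of_real y) - u2 (of_real y) * v1 (of_real y)) \<longlongrightarrow> L * (4 * D') - L' * (4 * D)) (at_left 1)"
    by (intro tendsto_intros l1 l2 l3 l4)
  then have one: "((\<lambda>y. 1) \<longlongrightarrow> L * (4 * D') - L' * (4 * D)) (at_left (1::real))"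
    by (rule Lim_transform_eventually)
      (rule eventually_mono[OF eventually_unit_at_left], simp add: W)
  have det: "L * (4 * D') - L' * (4 * D) = 1"
    by (rule tendsto_unique[OF trivial_limit_at_left_real one tendsto_const])
  have CA: "C - A = 5/8 - \<rho>/2" "C - B = 5/8 + \<rho>/2" by (simp_all add: A_def B_def C_def)
  have prod: "L * (4 * D') = (1 + of_real (sqrt 2) * cos (of_real pi * \<rho>)) / 2"
    unfolding L_def D'_def CA unfolding C_def C'_def A'_def B'_def by (rule connection_product)
  have "L * (4 * D') + L' * (4 * D) = of_real (sqrt 2) * cos (of_real pi * \<rho>)"
  proof -
    have "X + Z = Y" if "X = (1 + Y) / 2" "X - Z = 1" for X Y Z :: complex
      proof -
      have "2 * X = 1 + Y" unfolding that(1) by simp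
      with that(2) show ?thesis by algebra
    qed
    from this[OF prod det] show ?thesis .
  qed
  then have "(L * (4 * D') + L' * (4 * D))^2 = (of_real (sqrt 2))^2 * cos (of_real pi * \<rho>)^2"
    by (simp add: power_mult_distrib)
  also have "(of_real (sqrt 2))^2 = (2::complex)" by (simp flip: of_real_power)
  also have "2 * cos (of_real pi * \<rho>)^2 = 1 + cos (2 * (of_real pi * \<rho>))" by (simp add: cos_double_cos)
  finally have "(L * (4 * D') + L' * (4 * D))^2 = 1 + cos (2 * of_real pi * exponent_diff lam)"
    by (simp add: \<rho>_def mult.assoc)
  from that[OF d d' rot W l1 l2 l3 l4 det this] show ?thesis .
qed

lemma complex_cosh_of_real: "cosh (complex_of_real x) = of_real (cosh x)"
proof -
  have "exp (- complex_of_real x) = of_real (exp (- x))" by (metis exp_of_real of_real_minus)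
  then show ?thesis unfolding cosh_field_def exp_of_real by simp
qed

text \<open>Write \<rho> for \<open>exponent_diff lam\<close>, so lam = (16 \<rho>^2 - 1)/8. For
  real \<rho>, k = 0, 1/2, 1 means cos(2 pi \<rho>) = -1, -1/2, 0, so \<rho> is an integer plus or
  minus 1/2, 1/3, 1/4, which gives \<open>I3\<close>, \<open>I2\<close>, \<open>I1\<close>. For
  imaginary \<rho> the cosine becomes cosh and k >= 2.\<close>

lemma exponent_diff_exceptional:
  fixes lam :: real
  obtains k :: real where "0 \<le> k" "1 + cos (2 * of_real pi * exponent_diff lam) = of_real k"
    "k \<in> {0, 1/2, 1} \<Longrightarrow> lam \<in> I1 \<union> I2 \<union> I3"
proof (cases "0 \<le> 1 + 8 * lam")
  case True
  define r where "r = sqrt (1 + 8 * lam) / 4"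
  have "exponent_diff lam = of_real r"
    using True unfolding exponent_diff_def r_def csqrt_of_real' by simp
  then have "2 * of_real pi * exponent_diff lam = of_real (2 * pi * r)" by simp
  then have "1 + cos (2 * of_real pi * exponent_diff lam) = of_real (1 + cos (2 * pi * r))"
    by (simp only: cos_of_real of_real_add of_real_1)
  moreover have "0 \<le> 1 + cos (2 * pi * r)" using cos_ge_minus_one[of "2 * pi * r"] by linarith
  moreover have "lam \<in> I1 \<union> I2 \<union> I3" if k: "1 + cos (2 * pi * r) \<in> {0, 1/2, 1}"
  proof -
    have lam: "lam = (16 * r^2 - 1) / 8" using True by (simp add: r_def power_divide field_simps)
    have cs: "\<exists>n\<in>\<int>. r = t + n \<or> r = - t + n" if "cos (2 * pi * r) = cos (2 * pi * t)" for t
    proof -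
      from that obtain n where "n \<in> \<int>" "2 * pi * r = 2 * pi * t + 2 * n * pi \<or> 2 * pi * r = - (2 * pi * t) + 2 * n * pi"
        unfolding cos_eq by blast
      moreover from this(2) have "2 * pi * r = 2 * pi * (t + n) \<or> 2 * pi * r = 2 * pi * (- t + n)"
        by (simp add: algebra_simps)
      ultimately show ?thesis by (intro bexI[of _ n]) auto
    qed
    consider "cos (2 * pi * r) = cos (2 * pi * (1/2))" | "cos (2 * pi * r) = cos (2 * pi * (1/3))" | "cos (2 * pi * r) = cos (2 * pi * (1/4))"
    proof -
      have "2 * pi * (1/3) = pi - pi/3" "2 * pi * (1/4) = pi/2" "2 * pi * (1/2) = pi" by simp_all
      then have "cos (2 * pi * (1/3)) = - (1/2)" "cos (2 * pi * (1/4)) = 0" "cos (2 * pi * (1/2)) = -1"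
        by (simp_all only: cos_pi_minus cos_60 cos_pi_half cos_pi)
      moreover have "cos (2 * pi * r) = -1 \<or> cos (2 * pi * r) = - (1/2) \<or> cos (2 * pi * r) = 0"
        using k by auto
      ultimately show ?thesis using that by metis
    qed
    then show ?thesis
    proof cases
      case 1
      then obtain n where n: "n \<in> \<int>" "r = 1/2 + n \<or> r = - (1/2) + n" using cs by blast
      then have "lam = 1/2 * (3/4 + 4 * (n + 1) * ((n + 1) - 1)) \<or> lam = 1/2 * (3/4 + 4 * n * (n - 1))"
      proof -
        have "(16 * (1/2 + n)^2 - 1) / 8 = 1/2 * (3/4 + 4 * (n + 1) * ((n + 1) - 1))" "(16 * (- (1/2) + n)^2 - 1) / 8 = 1/2 * (3/4 + 4 * n * (n - 1))"
          by (simp_all add: power2_eq_square field_simps)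
        with n(2) show ?thesis unfolding lam by metis
      qed
      then have "lam \<in> I3" unfolding I3_def using n(1) Ints_add[OF n(1) Ints_1] by blast
      then show ?thesis by blast
    next
      case 2
      then obtain n where n: "n \<in> \<int>" "r = 1/3 + n \<or> r = - (1/3) + n" using cs by blast
      then have "lam = 1/8 * (-1 + 16 * (1/3 + n)^2) \<or> lam = 1/8 * (-1 + 16 * (1/3 + (- n))^2)"
      proof -
        have "(16 * (1/3 + n)^2 - 1) / 8 = 1/8 * (-1 + 16 * (1/3 + n)^2)" "(16 * (- (1/3) + n)^2 - 1) / 8 = 1/8 * (-1 + 16 * (1/3 + (- n))^2)"
          by (simp_all add: power2_eq_square field_simps)
        with n(2) show ?thesis unfolding lam by metis
      qed
      then have "lam \<in> I2" unfolding I2_def using n(1) Ints_minus[OF n(1)] by blast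
      then show ?thesis by blast
    next
      case 3
      then obtain n where n: "n \<in> \<int>" "r = 1/4 + n \<or> r = - (1/4) + n" using cs by blast
      then have "lam = n * (2 * n - 1) \<or> lam = (- n) * (2 * (- n) - 1)"
      proof -
        have "(16 * (1/4 + n)^2 - 1) / 8 = (- n) * (2 * (- n) - 1)" "(16 * (- (1/4) + n)^2 - 1) / 8 = n * (2 * n - 1)"
          by (simp_all add: power2_eq_square field_simps)
        with n(2) show ?thesis unfolding lam by metis
      qed
      then have "lam \<in> I1" unfolding I1_def using n(1) Ints_minus[OF n(1)] by blast
      then show ?thesis by blast
    qed
  qed
  ultimately show ?thesis using that by blast
next
  case False
  define s where "s = sqrt (- (1 + 8 * lam)) / 4"
  have "csqrt (of_real (1 + 8 * lam)) = \<i> * of_real (sqrt \<bar>1 + 8 * lam\<bar>)"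
    using False unfolding csqrt_of_real' by simp
  then have "exponent_diff lam = \<i> * of_real s"
    using False by (simp add: exponent_diff_def s_def)
  then have "2 * of_real pi * exponent_diff lam = \<i> * of_real (2 * pi * s)" by simp
  then have "cos (2 * of_real pi * exponent_diff lam) = of_real (cosh (2 * pi * s))"
    by (simp only: cosh_conv_cos[symmetric] complex_cosh_of_real)
  then have "1 + cos (2 * of_real pi * exponent_diff lam) = of_real (1 + cosh (2 * pi * s))"
    by (simp only: of_real_add of_real_1)
  moreover have "1 \<le> cosh (2 * pi * s)" by (rule cosh_real_ge_1)
  ultimately show ?thesis using that[of "1 + cosh (2 * pi * s)"] by auto
qed

section \<open>Leading terms of first integrals\<close>

definition cderiv :: "(complex^'n \<Rightarrow> complex) \<Rightarrow> (complex^'n \<Rightarrow> complex) \<Rightarrow> complex^'n \<Rightarrow> bool" where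
  "cderiv f D z \<longleftrightarrow> (f has_derivative D) (at z) \<and> (\<forall>c v. D (c *s v) = c * D v)"

lemma mv_holomorphic_on_cderiv: "mv_holomorphic_on f S \<longleftrightarrow> (\<forall>z\<in>S. \<exists>D. cderiv f D z)"
  unfolding mv_holomorphic_on_def cderiv_def ..

lemma cderiv_add: "cderiv f D z \<Longrightarrow> D (u + v) = D u + D v"
  unfolding cderiv_def using has_derivative_bounded_linear linear_simps(1) by blast

lemma cderiv_scale: "cderiv f D z \<Longrightarrow> D (c *s v) = c * D v"
  unfolding cderiv_def by blast

lemma cderiv_diff:
  "cderiv f D z \<Longrightarrow> cderiv g E z \<Longrightarrow> cderiv (\<lambda>z. f z - g z) (\<lambda>v. D v - E v) z"
  unfolding cderiv_def by (auto intro!: has_derivative_diff simp: right_diff_distrib)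

lemma cderiv_mult:
  "cderiv f D z \<Longrightarrow> cderiv g E z \<Longrightarrow> cderiv (\<lambda>z. f z * g z) (\<lambda>v. f z * E v + D v * g z) z"
  unfolding cderiv_def using has_derivative_mult[of f D z UNIV g E] by (auto simp: distrib_left distrib_right mult_ac)

lemma cderiv_chain:
  assumes "cderiv f D z" and "(p has_field_derivative p') (at (f z))"
  shows "cderiv (\<lambda>z. p (f z)) (\<lambda>v. p' * D v) z"
  unfolding cderiv_def
proof
  show "((\<lambda>z. p (f z)) has_derivative (\<lambda>v. p' * D v)) (at z)"
    using has_derivative_compose[of f D z UNIV p "(*) p'"] assms
    unfolding cderiv_def has_field_derivative_def by simp
qed (use assms in \<open>auto simp: cderiv_def\<close>)

lemma cderiv_divide:
  assumes g: "cderiv g Dg z" and h: "cderiv h Dh z" and hz: "h z \<noteq> 0"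
  shows "cderiv (\<lambda>z. g z / h z) (\<lambda>v. (Dg v * h z - g z * Dh v) / (h z)^2) z"
proof -
  have "(inverse has_field_derivative - (inverse (h z) ^ 2)) (at (h z))"
    using DERIV_inverse[OF hz] by (simp add: numeral_2_eq_2)
  from cderiv_mult[OF g cderiv_chain[OF h this]]
  have "cderiv (\<lambda>z. g z * inverse (h z)) (\<lambda>v. g z * (- (inverse (h z) ^ 2) * Dh v) + Dg v * inverse (h z)) z" .
  moreover have "g z * (- (inverse (h z) ^ 2) * Dh v) + Dg v * inverse (h z) = (Dg v * h z - g z * Dh v) / (h z)^2" for v
    using hz by (simp add: field_simps power2_eq_square)
  ultimately show ?thesis by (simp add: divide_inverse)
qed

lemma cderiv_along_curve:
  assumes "cderiv f D (\<phi> t)" "\<And>i. ((\<lambda>t. \<phi> t $ i) has_field_derivative v $ i) (at t)"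
  shows "((\<lambda>t. f (\<phi> t)) has_field_derivative D v) (at t)"
  using has_field_derivative_along_curve[of f D \<phi> t v] assms unfolding cderiv_def by blast

lemma cderiv_partial: "cderiv f D z \<Longrightarrow> partial_deriv i f z = D (axis i 1)"
  unfolding cderiv_def using partial_deriv_eq by blast

lemma cderiv_transform:
  assumes "cderiv f D z" "open S" "z \<in> S" "\<And>w. w \<in> S \<Longrightarrow> f w = g w"
  shows "cderiv g D z"
  using assms has_derivative_transform_within_open[of f D z UNIV S g] unfolding cderiv_def by auto

lemma vec4_expand:
  fixes v :: "complex^4"
  shows "v = v$1 *s axis 1 1 + (v$2 *s axis 2 1 + (v$3 *s axis 3 1 + v$4 *s axis 4 1))"
  by (simp add: vec_eq_iff forall_4 axis_def)

lemma cderiv_expand: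
  fixes v :: "complex^4"
  assumes "cderiv f D z"
  shows "D v = v$1 * D (axis 1 1) + v$2 * D (axis 2 1) + v$3 * D (axis 3 1) + v$4 * D (axis 4 1)"
  by (subst vec4_expand[of v]) (simp only: cderiv_add[OF assms] cderiv_scale[OF assms] add.assoc)

definition vec4 :: "complex \<Rightarrow> complex \<Rightarrow> complex \<Rightarrow> complex \<Rightarrow> complex^4" where
  "vec4 a b c d = (\<chi> i. if i = 1 then a else if i = 2 then b else if i = 3 then c else d)"

lemma vec4_nth [simp]: "vec4 a b c d $ 1 = a" "vec4 a b c d $ 2 = b" "vec4 a b c d $ 3 = c" "vec4 a b c d $ 4 = d"
  by (simp_all add: vec4_def)

lemma vec4_eq_iff: "(u :: complex^4) = v \<longleftrightarrow> u$1 = v$1 \<and> u$2 = v$2 \<and> u$3 = v$3 \<and> u$4 = v$4"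
  by (simp add: vec_eq_iff forall_4)

definition wt4 :: "nat \<Rightarrow> nat \<Rightarrow> nat \<Rightarrow> nat \<Rightarrow> 4 \<Rightarrow> nat" where
  "wt4 a b c d i = (if i = 1 then a else if i = 2 then b else if i = 3 then c else d)"

lemma wt4_simps [simp]: "wt4 a b c d 1 = a" "wt4 a b c d 2 = b" "wt4 a b c d 3 = c" "wt4 a b c d 4 = d"
  by (simp_all add: wt4_def)

lemma wt4_nonzero: "a \<noteq> 0 \<Longrightarrow> b \<noteq> 0 \<Longrightarrow> c \<noteq> 0 \<Longrightarrow> d \<noteq> 0 \<Longrightarrow> wt4 a b c d i \<noteq> 0"
  by (simp add: wt4_def)

section \<open>The Hamiltonian vector field and its first integrals near the origin\<close>

locale phantom =
  fixes \<Lambda> lam \<mu> :: real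
  assumes Lambda_nonzero: "\<Lambda> \<noteq> 0"
begin

abbreviation H :: "complex^4 \<Rightarrow> complex" where "H \<equiv> phantom_hamiltonian \<Lambda> lam \<mu>"

definition X :: "complex^4 \<Rightarrow> complex^4" where
  "X z = vec4 (z$3) (z$4) (of_real \<Lambda> * z$1^3 + of_real \<mu> * z$1 * z$2^2) (of_real lam * z$2^3 + of_real \<mu> * z$1^2 * z$2)"

definition DH :: "complex^4 \<Rightarrow> complex^4 \<Rightarrow> complex" where
  "DH z v = z$3 * v$3 + z$4 * v$4 - X z $ 3 * v$1 - X z $ 4 * v$2"

text \<open>The linearisation of the Hamiltonian vector field along the plane \<open>q\<^sub>2 = p\<^sub>2 = 0\<close>, and the
  Hamiltonian restricted to that plane.\<close>

definition XV :: "complex^4 \<Rightarrow> complex^4" where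
  "XV z = vec4 (z$3) (z$4) (of_real \<Lambda> * z$1^3) (of_real \<mu> * z$1^2 * z$2)"

definition h0 :: "complex^4 \<Rightarrow> complex" where
  "h0 z = z$3^2 / 2 - of_real \<Lambda> / 4 * z$1^4"

lemma H_cderiv: "cderiv H (DH z) z"
  unfolding cderiv_def
proof
  have n: "((\<lambda>z. z $ i) has_derivative (\<lambda>v. v $ i)) (at z)" for i :: 4 and z :: "complex^4"
    by (rule bounded_linear_imp_has_derivative[OF bounded_linear_vec_nth])
  show "(H has_derivative DH z) (at z)"
    unfolding phantom_hamiltonian_def phantom_potential_def
    by (rule derivative_eq_intros n refl)+
       (simp add: fun_eq_iff DH_def X_def field_simps power2_eq_square power3_eq_cube)
  show "\<forall>c v. DH z (c *s v) = c * DH z v" by (simp add: DH_def algebra_simps)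
qed

lemma DH_X: "DH z (X z) = 0"
  by (simp add: DH_def X_def)

lemma poisson_H:
  assumes "cderiv F D z"
  shows "poisson_bracket F H z = D (X z)"
proof -
  have a: "axis i 1 $ j = (if i = j then 1 else 0 :: complex)" for i j :: 4
    by (simp add: axis_def)
  show ?thesis
    unfolding poisson_bracket_def cderiv_partial[OF assms] cderiv_partial[OF H_cderiv]
    by (subst cderiv_expand[OF assms, of "X z"]) (simp add: DH_def a X_def algebra_simps)
qed

text \<open>The vanishing of the derivative of g/h along the Hamiltonian flow, cleared of
  denominators; it is imposed only where \<open>h\<close> is non-zero, since only there g/h
  represents the integral.\<close>

definition first_integral_quotient :: "(complex^4 \<Rightarrow> complex) \<Rightarrow> (complex^4 \<Rightarrow> complex) \<Rightarrow> (complex^4) set \<Rightarrow> bool" where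
  "first_integral_quotient g h N \<longleftrightarrow> (\<forall>z\<in>N. \<exists>Dg Dh. cderiv g Dg z \<and> cderiv h Dh z \<and>
     (h z \<noteq> 0 \<longrightarrow> Dg (X z) * h z = g z * Dh (X z)))"

lemma meromorphic_first_integral_quotient:
  assumes F: "meromorphic_first_integral H F" and g: "mv_holomorphic_on g U" and h: "mv_holomorphic_on h U"
    and U: "open U" and Fgh: "\<And>w. w \<in> U \<Longrightarrow> h w \<noteq> 0 \<Longrightarrow> F w = g w / h w"
  shows "first_integral_quotient g h U"
  unfolding first_integral_quotient_def
proof
  fix z assume z: "z \<in> U"
  obtain Dg Dh where D: "cderiv g Dg z" "cderiv h Dh z"
    using g h z unfolding mv_holomorphic_on_cderiv by blast
  have "Dg (X z) * h z = g z * Dh (X z)" if hz: "h z \<noteq> 0"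
  proof -
    define V where "V = {w \<in> U. h w \<noteq> 0}"
    have "continuous_on U h" using mv_holomorphic_imp_curve_hol[OF h] by (rule curve_hol_imp_continuous)
    then have "open (U \<inter> h -` (- {0}))"
      by (rule continuous_open_preimage[OF _ U]) auto
    moreover have "U \<inter> h -` (- {0}) = V" by (auto simp: V_def)
    ultimately have V: "open V" "z \<in> V" using z hz by (auto simp: V_def)
    have FD: "\<exists>D. cderiv F D w" if w: "w \<in> V" for w
    proof -
      obtain Eg Eh where E: "cderiv g Eg w" "cderiv h Eh w" "h w \<noteq> 0"
        using g h w unfolding mv_holomorphic_on_cderiv V_def by blast
      have "cderiv F (\<lambda>v. (Eg v * h w - g w * Eh v) / (h w)^2) w"
        by (rule cderiv_transform[OF cderiv_divide[OF E] V(1) w]) (simp add: Fgh V_def)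
      then show ?thesis by blast
    qed
    then have "z \<in> regular_points F"
      using V unfolding regular_points_def mv_holomorphic_on_cderiv by blast
    then have pb: "poisson_bracket F H z = 0" using F unfolding meromorphic_first_integral_def by blast
    have "cderiv F (\<lambda>v. (Dg v * h z - g z * Dh v) / (h z)^2) z"
      by (rule cderiv_transform[OF cderiv_divide[OF D hz] V]) (simp add: Fgh V_def)
    from poisson_H[OF this] pb have "(Dg (X z) * h z - g z * Dh (X z)) / (h z)^2 = 0" by simp
    then show ?thesis using hz by simp
  qed
  with D show "\<exists>Dg Dh. cderiv g Dg z \<and> cderiv h Dh z \<and> (h z \<noteq> 0 \<longrightarrow> Dg (X z) * h z = g z * Dh (X z))"
    by blast
qed

text \<open>The new quotient is (g/h) H^M - S(H), a first integral again because H is one. The power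
  of H will raise the order of the numerator to at least that of \<open>h\<close>.\<close>

lemma first_integral_quotient_shift:
  assumes "first_integral_quotient g h N"
  shows "first_integral_quotient (\<lambda>z. g z * H z ^ M - h z * poly S (H z)) h N"
  unfolding first_integral_quotient_def
proof
  fix z assume "z \<in> N"
  then obtain Dg Dh where D: "cderiv g Dg z" "cderiv h Dh z" "h z \<noteq> 0 \<longrightarrow> Dg (X z) * h z = g z * Dh (X z)"
    using assms unfolding first_integral_quotient_def by blast
  have pM: "((\<lambda>t. t ^ M) has_field_derivative of_nat M * H z ^ (M - 1)) (at (H z))"
    by (auto intro!: derivative_eq_intros)
  have dr: "cderiv (\<lambda>z. g z * H z ^ M - h z * poly S (H z))
     (\<lambda>v. (g z * (of_nat M * H z ^ (M - 1) * DH z v) + Dg v * H z ^ M)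
        - (h z * (poly (pderiv S) (H z) * DH z v) + Dh v * poly S (H z))) z"
    by (intro cderiv_diff cderiv_mult D(1,2) cderiv_chain[OF H_cderiv] pM poly_DERIV)
  have "((g z * (of_nat M * H z ^ (M - 1) * DH z (X z)) + Dg (X z) * H z ^ M)
        - (h z * (poly (pderiv S) (H z) * DH z (X z)) + Dh (X z) * poly S (H z))) * h z
      = (g z * H z ^ M - h z * poly S (H z)) * Dh (X z)" if "h z \<noteq> 0"
  proof -
    have "(Dg (X z) * H z ^ M - Dh (X z) * poly S (H z)) * h z
      = H z ^ M * (Dg (X z) * h z) - Dh (X z) * poly S (H z) * h z" by (simp add: algebra_simps)
    also have "\<dots> = (g z * H z ^ M - h z * poly S (H z)) * Dh (X z)"
      using D(3) that by (simp add: algebra_simps)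
    finally show ?thesis by (simp add: DH_X)
  qed
  with dr D(2) show "\<exists>Dr Dh. cderiv (\<lambda>z. g z * H z ^ M - h z * poly S (H z)) Dr z \<and> cderiv h Dh z \<and>
     (h z \<noteq> 0 \<longrightarrow> Dr (X z) * h z = (g z * H z ^ M - h z * poly S (H z)) * Dh (X z))"
    by blast
qed

end

section \<open>Leading terms along solutions of the linearised system\<close>

lemma cauchy_deriv_bound:
  assumes f: "f holomorphic_on T" and T: "open T" "cball y d \<subseteq> T" "0 < d"
    and B: "\<And>w. w \<in> cball y d \<Longrightarrow> norm (f w) \<le> B" and f': "(f has_field_derivative f') (at y)"
  shows "norm f' \<le> B / d"
proof -
  have "norm ((deriv ^^ 1) f y) \<le> fact 1 * B / d ^ 1"
  proof (rule Cauchy_inequality)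
    show "f holomorphic_on ball y d" using f T ball_subset_cball by (meson holomorphic_on_subset)
    show "continuous_on (cball y d) f" using f T by (meson holomorphic_on_imp_continuous_on holomorphic_on_subset)
  qed (use T B in \<open>auto simp: dist_norm\<close>)
  then show ?thesis using DERIV_imp_deriv[OF f'] by simp
qed

abbreviation dilate :: "complex \<Rightarrow> complex^4 \<Rightarrow> complex^4" where
  "dilate \<equiv> scal (wt4 1 2 2 3)"

text \<open>Cauchy's estimate in the dilated direction \<open>dilate s (axis j 1)\<close> bounds s^w
  times the j-th partial derivative, w being the j-th weight, by the same order s^k as
  \<open>r\<close> itself. Applied along \<open>G\<close> to the remainder r - P s^k it gives the
  last bound, with one more power of s.\<close>

lemma lead_curve_bounds:
  assumes r: "curve_hol r N" and N: "dilatable (wt4 1 2 2 3) N"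
    and D: "\<And>z. z \<in> N \<Longrightarrow> cderiv r (D z) z" and L: "lead (wt4 1 2 2 3) r k P"
    and T: "open T" "y \<in> T" and G: "\<And>i. (\<lambda>t. G t $ i) holomorphic_on T"
    and G': "\<And>i. ((\<lambda>t. G t $ i) has_field_derivative G' $ i) (at y)"
    and a': "((\<lambda>t. P (G t)) has_field_derivative a') (at y)"
  shows "\<exists>S>0. \<exists>B\<ge>0. \<forall>s. norm s \<le> S \<longrightarrow> dilate s (G y) \<in> N \<and>
     norm (r (dilate s (G y))) \<le> B * norm s ^ k \<and>
     norm (s^2 * D (dilate s (G y)) (axis 3 1)) \<le> B * norm s ^ k \<and>
     norm (s^3 * D (dilate s (G y)) (axis 4 1)) \<le> B * norm s ^ k \<and>
     norm (D (dilate s (G y)) (dilate s G') - a' * s^k) \<le> B * norm s ^ Suc k"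
proof -
  obtain d where d: "0 < d" "cball y d \<subseteq> T" using T open_contains_cball by blast
  have "compact (G ` cball y d)"
    using d by (intro compact_continuous_image continuous_curve holomorphic_on_subset[OF G]) auto
  then obtain R0 where R0: "\<And>w. w \<in> cball y d \<Longrightarrow> norm (G w) \<le> R0"
    by (meson compact_imp_bounded bounded_iff image_eqI)
  \<comment> \<open>The margin 2 leaves room for a disc of radius 2 around \<open>G y\<close> in
    each coordinate direction, so that Cauchy's estimate can be used on the closed unit
    disc.\<close>
  define R where "R = R0 + 2"
  obtain S C where S: "S > 0" "C \<ge> 0" and SC: "\<And>z s. norm z \<le> R \<Longrightarrow> norm s \<le> S \<Longrightarrow> dilate s z \<in> N \<and>
       norm (r (dilate s z) - P z * s^k) \<le> C * norm s ^ Suc k"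
    using lead_bound[OF r N L, of R] by blast
  have Phol: "curve_hol P UNIV" by (rule lead_curve_hol[OF r N L])
  have "compact (P ` cball 0 R)"
    by (intro compact_continuous_image continuous_on_subset[OF curve_hol_imp_continuous[OF Phol]]) auto
  then obtain B0 where B0: "\<And>z. norm z \<le> R \<Longrightarrow> norm (P z) \<le> B0"
    by (meson compact_imp_bounded bounded_iff image_eqI mem_cball_0)
  have Gy: "norm (G y) \<le> R0" using R0[of y] d by simp
  have "norm (P (G y)) \<le> B0" by (rule B0) (use Gy in \<open>simp add: R_def\<close>)
  then have B00: "0 \<le> B0" using norm_ge_zero[of "P (G y)"] by linarith
  define S' where "S' = min S 1"
  have bd: "norm (r (dilate s z)) \<le> (B0 + C) * norm s ^ k" if z: "norm z \<le> R" and s: "norm s \<le> S'" for z s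
  proof -
    have "norm (r (dilate s z)) \<le> norm (r (dilate s z) - P z * s^k) + norm (P z * s^k)"
      using norm_triangle_ineq[of "r (dilate s z) - P z * s^k" "P z * s^k"] by simp
    also have "\<dots> \<le> C * norm s ^ Suc k + B0 * norm s ^ k"
      using SC[OF z] B0[OF z] s by (intro add_mono) (auto simp: S'_def norm_mult norm_power intro: mult_right_mono)
    also have "C * norm s ^ Suc k \<le> C * norm s ^ k"
      using s S by (intro mult_left_mono power_decreasing) (auto simp: S'_def)
    finally show ?thesis by (simp add: algebra_simps)
  qed
  define B where "B = B0 + C + 2 * (C / d)"
  have BC: "B0 + C \<le> B" "2 * (C / d) \<le> B" using S d B00 by (auto simp: B_def)
  have axis_bd: "norm (s ^ wt4 1 2 2 3 j * D (dilate s (G y)) (axis j 1)) \<le> B * norm s ^ k" if s: "norm s \<le> S'" for s j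
  proof -
    define \<phi> where "\<phi> t = dilate s (G y + t *s axis j 1)" for t
    have n2: "norm (G y + t *s axis j 1) \<le> R" if "norm t \<le> 2" for t
    proof -
      have "norm (t *s axis j 1 :: complex^4) \<le> 2"
      proof -
        have "norm (t *s axis j 1 :: complex^4) = norm (axis j t :: complex^4)"
          by (rule arg_cong[of _ _ norm]) (simp add: vec_eq_iff axis_def)
        moreover have "norm (axis j t :: complex^4) = norm t"
          using exhaust_4[of j] by (auto simp: norm_vec_def L2_set_def sum_4 axis_def)
        ultimately show ?thesis using that by simp
      qed
      then show ?thesis using Gy norm_triangle_ineq[of "G y" "t *s axis j 1"] by (simp add: R_def)
    qed
    have hol: "(\<lambda>t. r (\<phi> t)) holomorphic_on ball 0 2"
    proof (rule curve_hol_compose[OF r])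
      show "(\<lambda>t. \<phi> t $ i) holomorphic_on ball 0 2" for i
        unfolding \<phi>_def scal_nth vector_add_component vector_smult_component by (intro holomorphic_intros)
      show "\<phi> t \<in> N" if "t \<in> ball 0 2" for t
        using SC[OF n2, of t s] that s unfolding \<phi>_def by (auto simp: S'_def)
    qed auto
    have der: "((\<lambda>t. r (\<phi> t)) has_field_derivative D (\<phi> 0) (dilate s (axis j 1))) (at 0)"
    proof (rule cderiv_along_curve)
      have "norm (G y) \<le> R" using Gy by (simp add: R_def)
      then show "cderiv r (D (\<phi> 0)) (\<phi> 0)"
        using D SC[of "G y" s] s by (simp add: \<phi>_def S'_def)
      show "((\<lambda>t. \<phi> t $ i) has_field_derivative dilate s (axis j 1) $ i) (at 0)" for i
        unfolding \<phi>_def scal_nth vector_add_component vector_smult_component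
        by (auto intro!: derivative_eq_intros)
    qed
    have p0: "\<phi> 0 = dilate s (G y)" by (simp add: \<phi>_def)
    have ds: "dilate s (axis j 1) = s ^ wt4 1 2 2 3 j *s axis j 1"
      by (simp add: vec_eq_iff axis_def)
    have "norm (D (\<phi> 0) (dilate s (axis j 1))) \<le> (B0 + C) * norm s ^ k / 1"
      by (rule cauchy_deriv_bound[OF hol _ _ _ _ der])
         (use bd n2 s in \<open>auto simp: \<phi>_def\<close>)
    moreover have "cderiv r (D (\<phi> 0)) (\<phi> 0)"
      using D SC[of "G y" s] Gy s by (simp add: \<phi>_def S'_def R_def)
    ultimately have "norm (s ^ wt4 1 2 2 3 j * D (\<phi> 0) (axis j 1)) \<le> (B0 + C) * norm s ^ k"
      unfolding ds by (simp add: cderiv_scale)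
    also have "\<dots> \<le> B * norm s ^ k" using BC by (intro mult_right_mono) auto
    finally show ?thesis unfolding p0 .
  qed
  show ?thesis
  proof (intro exI conjI allI impI)
    show "0 < S'" using S by (simp add: S'_def)
    show "0 \<le> B" using B00 S d by (simp add: B_def)
    fix s :: complex assume s: "norm s \<le> S'"
    have GyR: "norm (G y) \<le> R" using Gy by (simp add: R_def)
    show inN: "dilate s (G y) \<in> N" using SC[OF GyR] s by (simp add: S'_def)
    have "norm (r (dilate s (G y))) \<le> (B0 + C) * norm s ^ k" by (rule bd[OF GyR s])
    also have "\<dots> \<le> B * norm s ^ k" using BC by (intro mult_right_mono) auto
    finally show "norm (r (dilate s (G y))) \<le> B * norm s ^ k" .
    show "norm (s^2 * D (dilate s (G y)) (axis 3 1)) \<le> B * norm s ^ k" using axis_bd[OF s, of 3] unfolding wt4_simps .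
    show "norm (s^3 * D (dilate s (G y)) (axis 4 1)) \<le> B * norm s ^ k" using axis_bd[OF s, of 4] unfolding wt4_simps .
    define f where "f t = r (dilate s (G t)) - P (G t) * s^k" for t
    have f': "(f has_field_derivative D (dilate s (G y)) (dilate s G') - a' * s^k) (at y)"
      unfolding f_def
    proof (rule DERIV_diff)
      show "((\<lambda>t. r (dilate s (G t))) has_field_derivative D (dilate s (G y)) (dilate s G')) (at y)"
      proof (rule cderiv_along_curve[where \<phi> = "\<lambda>t. dilate s (G t)", OF D[OF inN]])
        show "((\<lambda>t. dilate s (G t) $ i) has_field_derivative dilate s G' $ i) (at y)" for i
          unfolding scal_nth by (rule DERIV_cmult[OF G'])
      qed
      show "((\<lambda>t. P (G t) * s ^ k) has_field_derivative a' * s ^ k) (at y)"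
        by (rule DERIV_cmult_right[OF a'])
    qed
    have "norm (D (dilate s (G y)) (dilate s G') - a' * s^k) \<le> C * norm s ^ Suc k / (d/2)"
    proof (rule cauchy_deriv_bound[OF _ open_ball _ _ _ f'])
      show "cball y (d/2) \<subseteq> ball y d" using d by auto
      have R: "norm (G t) \<le> R" if "t \<in> ball y d" for t using R0[of t] that by (simp add: R_def)
      show "f holomorphic_on ball y d"
        unfolding f_def
      proof (intro holomorphic_on_diff holomorphic_on_mult holomorphic_on_const)
        have sub: "ball y d \<subseteq> T" using d by auto
        have Gh: "(\<lambda>t. G t $ i) holomorphic_on ball y d" for i
          by (rule holomorphic_on_subset[OF G sub])
        show "(\<lambda>t. P (G t)) holomorphic_on ball y d"
          by (rule curve_hol_compose[OF Phol open_ball Gh UNIV_I])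
        show "(\<lambda>t. r (dilate s (G t))) holomorphic_on ball y d"
        proof (rule curve_hol_compose[OF r open_ball])
          show "(\<lambda>t. dilate s (G t) $ i) holomorphic_on ball y d" for i
            unfolding scal_nth by (intro holomorphic_intros Gh)
          show "dilate s (G t) \<in> N" if "t \<in> ball y d" for t
            using SC[OF R[OF that]] s by (simp add: S'_def)
        qed
      qed
      show "norm (f t) \<le> C * norm s ^ Suc k" if "t \<in> cball y (d/2)" for t
        unfolding f_def using SC[OF R] that s d by (auto simp: S'_def)
    qed (use d in auto)
    also have "\<dots> = 2 * (C / d) * norm s ^ Suc k" using d by simp
    finally have last: "norm (D (dilate s (G y)) (dilate s G') - a' * s^k) \<le> 2 * (C / d) * norm s ^ Suc k" .
    also have "\<dots> \<le> B * norm s ^ Suc k" using BC by (intro mult_right_mono) auto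
    finally show "norm (D (dilate s (G y)) (dilate s G') - a' * s^k) \<le> B * norm s ^ Suc k" .
  qed
qed

lemma tendsto_leading:
  fixes f :: "complex \<Rightarrow> complex"
  assumes S: "0 < S" and b: "\<And>s. norm s \<le> S \<Longrightarrow> norm (f s - L * s^k) \<le> B * norm s ^ Suc k"
  shows "((\<lambda>s. f s / s^k) \<longlongrightarrow> L) (at 0)"
proof (rule Lim_null[THEN iffD2], rule Lim_null_comparison)
  have "\<forall>\<^sub>F s in at (0::complex). s \<in> ball 0 S \<and> s \<noteq> 0"
    using S by (auto simp: eventually_at intro!: exI[of _ S])
  then show "\<forall>\<^sub>F s in at 0. norm (f s / s^k - L) \<le> B * norm s"
  proof eventually_elim
    case (elim s)
    have "f s / s^k - L = (f s - L * s^k) / s^k" using elim by (simp add: field_simps)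
    then have "norm (f s / s^k - L) = norm (f s - L * s^k) / norm s ^ k" by (simp add: norm_divide norm_power)
    also have "\<dots> \<le> B * norm s ^ Suc k / norm s ^ k"
      using b[of s] elim by (intro divide_right_mono) auto
    also have "\<dots> = B * norm s" using elim by simp
    finally show ?case .
  qed
  have "((\<lambda>s::complex. B * norm s) \<longlongrightarrow> B * norm (0::complex)) (at 0)" by (intro tendsto_intros)
  then show "((\<lambda>s::complex. B * norm s) \<longlongrightarrow> 0) (at 0)" by simp
qed

context phantom
begin

text \<open>Along a curve of the linearised flow, P/Q should have derivative zero. The exact
  relation Dr(X) h = r Dh(X) is evaluated at \<open>dilate s (G y)\<close>; replacing X by its
  linear part \<open>XV\<close> costs an error of relative order s^2, which disappears as s tends to
  0.\<close>

lemma wronskian_vanishes: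
  assumes e: "0 < e" and r: "curve_hol r (ball 0 e)" and h: "curve_hol h (ball 0 e)"
    and Dr: "\<And>z. z \<in> ball 0 e \<Longrightarrow> cderiv r (Dr z) z" and Dh: "\<And>z. z \<in> ball 0 e \<Longrightarrow> cderiv h (Dh z) z"
    and fi: "\<And>z. z \<in> ball 0 e \<Longrightarrow> h z \<noteq> 0 \<Longrightarrow> Dr z (X z) * h z = r z * Dh z (X z)"
    and LP: "lead (wt4 1 2 2 3) r k P" and LQ: "lead (wt4 1 2 2 3) h l Q"
    and T: "open T" "y \<in> T" and G: "\<And>i. (\<lambda>t. G t $ i) holomorphic_on T"
    and G': "\<And>i. ((\<lambda>t. G t $ i) has_field_derivative \<phi> * XV (G y) $ i) (at y)"
    and a': "((\<lambda>t. P (G t)) has_field_derivative a') (at y)"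
    and b': "((\<lambda>t. Q (G t)) has_field_derivative b') (at y)"
    and b: "Q (G y) \<noteq> 0"
  shows "a' * Q (G y) = P (G y) * b'"
proof -
  let ?G' = "\<phi> *s XV (G y)"
  have N: "dilatable (wt4 1 2 2 3) (ball 0 e)"
    by (rule dilatable_ball[OF wt4_nonzero e]) auto
  have G'': "((\<lambda>t. G t $ i) has_field_derivative ?G' $ i) (at y)" for i using G'[of i] by simp
  obtain S1 B1 where S1: "S1 > 0" "B1 \<ge> 0" and R: "\<forall>s. norm s \<le> S1 \<longrightarrow> dilate s (G y) \<in> ball 0 e \<and>
     norm (r (dilate s (G y))) \<le> B1 * norm s ^ k \<and>
     norm (s^2 * Dr (dilate s (G y)) (axis 3 1)) \<le> B1 * norm s ^ k \<and>
     norm (s^3 * Dr (dilate s (G y)) (axis 4 1)) \<le> B1 * norm s ^ k \<and>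
     norm (Dr (dilate s (G y)) (dilate s ?G') - a' * s^k) \<le> B1 * norm s ^ Suc k"
    using lead_curve_bounds[OF r N Dr LP T G G'' a'] by blast
  obtain S2 B2 where S2: "S2 > 0" "B2 \<ge> 0" and HH: "\<forall>s. norm s \<le> S2 \<longrightarrow> dilate s (G y) \<in> ball 0 e \<and>
     norm (h (dilate s (G y))) \<le> B2 * norm s ^ l \<and>
     norm (s^2 * Dh (dilate s (G y)) (axis 3 1)) \<le> B2 * norm s ^ l \<and>
     norm (s^3 * Dh (dilate s (G y)) (axis 4 1)) \<le> B2 * norm s ^ l \<and>
     norm (Dh (dilate s (G y)) (dilate s ?G') - b' * s^l) \<le> B2 * norm s ^ Suc l"
    using lead_curve_bounds[OF h N Dh LQ T G G'' b'] by blast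
  define z where "z s = dilate s (G y)" for s
  define w where "w s = dilate s ?G'" for s
  define E where "E s = Dr (z s) (w s) * h (z s) - r (z s) * Dh (z s) (w s)" for s
  have t1: "((\<lambda>s. Dr (z s) (w s) / s^k) \<longlongrightarrow> a') (at 0)"
    by (rule tendsto_leading[OF S1(1)]) (use R in \<open>auto simp: z_def w_def\<close>)
  have t2: "((\<lambda>s. Dh (z s) (w s) / s^l) \<longlongrightarrow> b') (at 0)"
    by (rule tendsto_leading[OF S2(1)]) (use HH in \<open>auto simp: z_def w_def\<close>)
  have t3: "((\<lambda>s. r (z s) / s^k) \<longlongrightarrow> P (G y)) (at 0)" using LP unfolding lead_def z_def by (rule spec)
  have t4: "((\<lambda>s. h (z s) / s^l) \<longlongrightarrow> Q (G y)) (at 0)" using LQ unfolding lead_def z_def by (rule spec)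
  have "((\<lambda>s. Dr (z s) (w s) / s^k * (h (z s) / s^l) - r (z s) / s^k * (Dh (z s) (w s) / s^l)) \<longlongrightarrow> a' * Q (G y) - P (G y) * b') (at 0)"
    by (intro tendsto_diff tendsto_mult t1 t2 t3 t4)
  moreover have "Dr (z s) (w s) / s^k * (h (z s) / s^l) - r (z s) / s^k * (Dh (z s) (w s) / s^l) = E s / s^(k + l)" for s
    unfolding E_def power_add by (simp add: diff_divide_distrib)
  ultimately have lim1: "((\<lambda>s. E s / s^(k + l)) \<longlongrightarrow> a' * Q (G y) - P (G y) * b') (at 0)" by (simp only:)
  define \<kappa>1 \<kappa>2 where "\<kappa>1 = of_real \<mu> * G y $ 1 * G y $ 2 ^ 2" and "\<kappa>2 = of_real lam * G y $ 2 ^ 3"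
  define K where "K = norm \<phi> * ((norm \<kappa>1 + norm \<kappa>2) * (2 * (B1 * B2)))"
  have bound: "norm (E s / s^(k + l)) \<le> K * norm s ^ 2"
    if s: "norm s \<le> S1" "norm s \<le> S2" "s \<noteq> 0" and hz: "h (z s) \<noteq> 0" for s
  proof -
    have zN: "z s \<in> ball 0 e" using R s by (simp add: z_def)
    note r1 = Dr[OF zN] and h1 = Dh[OF zN]
    \<comment> \<open>The two terms of X that are nonlinear in q2 are the only corrections. After
      s^2 and s^3 are spent on the weighted derivatives along axes 3 and 4, both retain s^3, against
      a single s in front of the linear part.\<close>
    have vec: "\<phi> *s X (z s) = s *s w s + ((\<phi> * s^5 * \<kappa>1) *s axis 3 1 + (\<phi> * s^6 * \<kappa>2) *s axis 4 1)"
      unfolding vec4_eq_iff w_def z_def X_def XV_def \<kappa>1_def \<kappa>2_def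
      by (simp add: axis_def algebra_simps power2_eq_square power3_eq_cube eval_nat_numeral)
    have DX: "\<phi> * D (X (z s)) = s * D (w s) + (\<phi> * s^5 * \<kappa>1 * D (axis 3 1) + \<phi> * s^6 * \<kappa>2 * D (axis 4 1))"
      if "cderiv f D (z s)" for f D
      using arg_cong[OF vec, of D] unfolding cderiv_add[OF that] cderiv_scale[OF that] .
    define A3 A4 C3 C4 where "A3 = s^2 * Dr (z s) (axis 3 1)" and "A4 = s^3 * Dr (z s) (axis 4 1)"
      and "C3 = s^2 * Dh (z s) (axis 3 1)" and "C4 = s^3 * Dh (z s) (axis 4 1)"
    have "s * E s = (\<phi> * Dr (z s) (X (z s)) - s^3 * \<phi> * (\<kappa>1 * A3 + \<kappa>2 * A4)) * h (z s)
       - r (z s) * (\<phi> * Dh (z s) (X (z s)) - s^3 * \<phi> * (\<kappa>1 * C3 + \<kappa>2 * C4))"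
      unfolding DX[OF r1] DX[OF h1] E_def A3_def A4_def C3_def C4_def
      by (simp add: algebra_simps power2_eq_square power3_eq_cube eval_nat_numeral)
    also have "\<dots> = \<phi> * (Dr (z s) (X (z s)) * h (z s) - r (z s) * Dh (z s) (X (z s)))
       - s^3 * (\<phi> * (\<kappa>1 * (A3 * h (z s) - r (z s) * C3) + \<kappa>2 * (A4 * h (z s) - r (z s) * C4)))"
      by (simp add: algebra_simps)
    also have "\<dots> = - (s^3 * (\<phi> * (\<kappa>1 * (A3 * h (z s) - r (z s) * C3) + \<kappa>2 * (A4 * h (z s) - r (z s) * C4))))"
      using fi[OF zN hz] by simp
    finally have sE: "s * E s = - (s^3 * (\<phi> * (\<kappa>1 * (A3 * h (z s) - r (z s) * C3) + \<kappa>2 * (A4 * h (z s) - r (z s) * C4))))" .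
    let ?M = "(B1 * norm s ^ k) * (B2 * norm s ^ l)"
    have bA: "norm A3 \<le> B1 * norm s ^ k" "norm A4 \<le> B1 * norm s ^ k" "norm (r (z s)) \<le> B1 * norm s ^ k"
      and bC: "norm C3 \<le> B2 * norm s ^ l" "norm C4 \<le> B2 * norm s ^ l" "norm (h (z s)) \<le> B2 * norm s ^ l"
      using R HH s unfolding A3_def A4_def C3_def C4_def z_def by auto
    have b1: "0 \<le> B1 * norm s ^ k" "0 \<le> B2 * norm s ^ l" using S1 S2 by auto
    have prod: "norm (p * q - p' * q') \<le> 2 * ?M"
      if "norm p \<le> B1 * norm s ^ k" "norm q \<le> B2 * norm s ^ l" "norm p' \<le> B1 * norm s ^ k" "norm q' \<le> B2 * norm s ^ l"
      for p q p' q' :: complex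
    proof -
      have "norm (p * q) \<le> ?M" "norm (p' * q') \<le> ?M"
        unfolding norm_mult by (intro mult_mono that b1 norm_ge_zero)+
      then show ?thesis using norm_triangle_ineq4[of "p * q" "p' * q'"] by linarith
    qed
    have "norm (\<kappa>1 * (A3 * h (z s) - r (z s) * C3) + \<kappa>2 * (A4 * h (z s) - r (z s) * C4))
       \<le> norm \<kappa>1 * (2 * ?M) + norm \<kappa>2 * (2 * ?M)"
      by (intro norm_triangle_mono) (auto simp: norm_mult intro!: mult_left_mono prod bA bC)
    then have "norm (\<phi> * (\<kappa>1 * (A3 * h (z s) - r (z s) * C3) + \<kappa>2 * (A4 * h (z s) - r (z s) * C4)))
       \<le> norm \<phi> * (norm \<kappa>1 * (2 * ?M) + norm \<kappa>2 * (2 * ?M))"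
      unfolding norm_mult[of \<phi>] by (intro mult_left_mono) auto
    also have "\<dots> = K * norm s ^ (k + l)" by (simp add: K_def power_add algebra_simps)
    finally have "norm s ^ 3 * norm (\<phi> * (\<kappa>1 * (A3 * h (z s) - r (z s) * C3) + \<kappa>2 * (A4 * h (z s) - r (z s) * C4)))
       \<le> norm s ^ 3 * (K * norm s ^ (k + l))" by (intro mult_left_mono) auto
    moreover have "norm s * norm (E s) = norm s ^ 3 * norm (\<phi> * (\<kappa>1 * (A3 * h (z s) - r (z s) * C3) + \<kappa>2 * (A4 * h (z s) - r (z s) * C4)))"
      using arg_cong[OF sE, of norm] by (simp only: norm_mult norm_minus_cancel norm_power)
    moreover have "norm s ^ 3 * (K * norm s ^ (k + l)) = norm s * (K * norm s ^ 2 * norm s ^ (k + l))"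
      by (simp add: power3_eq_cube power2_eq_square)
    ultimately have "norm s * norm (E s) \<le> norm s * (K * norm s ^ 2 * norm s ^ (k + l))"
      by linarith
    then have "norm (E s) \<le> K * norm s ^ 2 * norm s ^ (k + l)" using s(3) by simp
    then show ?thesis using s(3) by (simp add: norm_divide norm_power field_simps)
  qed
  have ev: "\<forall>\<^sub>F s in at 0. norm s \<le> S1 \<and> norm s \<le> S2 \<and> s \<noteq> 0"
    using S1(1) S2(1) by (auto simp: eventually_at intro!: exI[of _ "min S1 S2"])
  have evh: "\<forall>\<^sub>F s in at 0. h (z s) \<noteq> 0"
    using tendsto_imp_eventually_ne[OF t4 b] by (rule eventually_mono) auto
  have lim2: "((\<lambda>s. E s / s^(k + l)) \<longlongrightarrow> 0) (at 0)"
  proof (rule Lim_null_comparison)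
    show "\<forall>\<^sub>F s in at 0. norm (E s / s^(k + l)) \<le> K * norm s ^ 2"
      using ev evh by eventually_elim (use bound in blast)
    have "((\<lambda>s::complex. K * norm s ^ 2) \<longlongrightarrow> K * norm (0::complex) ^ 2) (at 0)" by (intro tendsto_intros)
    then show "((\<lambda>s::complex. K * norm s ^ 2) \<longlongrightarrow> 0) (at 0)" by simp
  qed
  have "a' * Q (G y) - P (G y) * b' = 0"
    by (rule tendsto_unique[OF trivial_limit_at lim1 lim2])
  then show ?thesis by simp
qed

text \<open>The factor \<open>\<phi>\<close> allows any time parametrisation, in particular \<open>q\<^sub>1\<close> as independent variable, and
  cross-multiplication avoids the poles of \<open>P / Q\<close>.\<close>

definition const_ratio :: "(complex^4 \<Rightarrow> complex) \<Rightarrow> (complex^4 \<Rightarrow> complex) \<Rightarrow> bool" where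
  "const_ratio P Q \<longleftrightarrow> (\<forall>T G \<phi>. open T \<longrightarrow> connected T \<longrightarrow> (\<forall>i. (\<lambda>t. G t $ i) holomorphic_on T) \<longrightarrow>
     (\<forall>y\<in>T. \<forall>i. ((\<lambda>t. G t $ i) has_field_derivative \<phi> y * XV (G y) $ i) (at y)) \<longrightarrow>
     (\<forall>y\<in>T. \<forall>y'\<in>T. P (G y) * Q (G y') = P (G y') * Q (G y)))"

text \<open>The vanishing Wronskian makes P/Q locally constant along the curve near a point where Q
  is non-zero; the identity theorem then extends P = c Q over the zeros of Q.\<close>

lemma const_ratio_lead:
  assumes e: "0 < e" and r: "first_integral_quotient r h (ball 0 e)"
    and LP: "lead (wt4 1 2 2 3) r k P" and LQ: "lead (wt4 1 2 2 3) h l Q"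
  shows "curve_hol P UNIV" "curve_hol Q UNIV" "const_ratio P Q"
proof -
  have "\<exists>DD. \<forall>z\<in>ball 0 e. cderiv r (fst (DD z)) z \<and> cderiv h (snd (DD z)) z \<and>
      (h z \<noteq> 0 \<longrightarrow> fst (DD z) (X z) * h z = r z * snd (DD z) (X z))"
    by (rule bchoice) (use r in \<open>unfold first_integral_quotient_def, auto\<close>)
  then obtain DD where DD: "\<And>z. z \<in> ball 0 e \<Longrightarrow> cderiv r (fst (DD z)) z \<and> cderiv h (snd (DD z)) z \<and>
      (h z \<noteq> 0 \<longrightarrow> fst (DD z) (X z) * h z = r z * snd (DD z) (X z))" by blast
  have rh: "curve_hol r (ball 0 e)" "curve_hol h (ball 0 e)"
    by (rule mv_holomorphic_imp_curve_hol, unfold mv_holomorphic_on_cderiv, use DD in blast)+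
  have N: "dilatable (wt4 1 2 2 3) (ball 0 e)"
    by (rule dilatable_ball[OF wt4_nonzero e]) auto
  show P: "curve_hol P UNIV" by (rule lead_curve_hol[OF rh(1) N LP])
  show Q: "curve_hol Q UNIV" by (rule lead_curve_hol[OF rh(2) N LQ])
  show "const_ratio P Q"
    unfolding const_ratio_def
  proof (intro allI impI ballI)
    fix T G \<phi> y1 y2
    assume T: "open T" "connected T" and G0: "\<forall>i. (\<lambda>t. G t $ i) holomorphic_on T"
      and G': "\<forall>y\<in>T. \<forall>i. ((\<lambda>t. G t $ i) has_field_derivative \<phi> y * XV (G y) $ i) (at y)"
      and y: "y1 \<in> T" "y2 \<in> T"
    have G: "(\<lambda>t. G t $ i) holomorphic_on T" for i using G0 by blast
    define a b where "a t = P (G t)" and "b t = Q (G t)" for t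
    have a: "a holomorphic_on T" unfolding a_def by (rule curve_hol_compose[OF P T(1) G UNIV_I])
    have b: "b holomorphic_on T" unfolding b_def by (rule curve_hol_compose[OF Q T(1) G UNIV_I])
    have W: "deriv a y * b y = a y * deriv b y" if "y \<in> T" "b y \<noteq> 0" for y
      unfolding a_def b_def
    proof (rule wronskian_vanishes[OF e rh, where T = T and \<phi> = "\<phi> y" and Dr = "\<lambda>z. fst (DD z)" and Dh = "\<lambda>z. snd (DD z)"])
      show "((\<lambda>t. P (G t)) has_field_derivative deriv (\<lambda>t. P (G t)) y) (at y)"
        using holomorphic_derivI[OF a T(1) that(1)] by (simp add: a_def[abs_def])
      show "((\<lambda>t. Q (G t)) has_field_derivative deriv (\<lambda>t. Q (G t)) y) (at y)"
        using holomorphic_derivI[OF b T(1) that(1)] by (simp add: b_def[abs_def])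
      show "((\<lambda>t. G t $ i) has_field_derivative \<phi> y * XV (G y) $ i) (at y)" for i using G' that by blast
      show "Q (G y) \<noteq> 0" using that by (simp add: b_def)
    qed (use DD T that G LP LQ in blast)+
    have "a y1 * b y2 = a y2 * b y1"
    proof (cases "\<forall>t\<in>T. b t = 0")
      case True
      then show ?thesis using y by simp
    next
      case False
      then obtain t0 where t0: "t0 \<in> T" "b t0 \<noteq> 0" by blast
      have "open (T \<inter> b -` (- {0}))"
        using holomorphic_on_imp_continuous_on[OF b] T(1) by (intro continuous_open_preimage) auto
      then obtain d where d: "0 < d" "ball t0 d \<subseteq> T \<inter> b -` (- {0})"
        using t0 open_contains_ball[of "T \<inter> b -` (- {0})"] by blast
      define \<kappa> where "\<kappa> = a t0 / b t0"
      have "(\<lambda>t. a t / b t) constant_on ball t0 d"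
      proof (rule has_field_derivative_0_imp_constant_on)
        fix t assume t: "t \<in> ball t0 d"
        then have tT: "t \<in> T" "b t \<noteq> 0" using d by auto
        have "((\<lambda>t. a t / b t) has_field_derivative (deriv a t * b t - a t * deriv b t) / (b t * b t)) (at t)"
          by (rule DERIV_divide[OF holomorphic_derivI[OF a T(1) tT(1)] holomorphic_derivI[OF b T(1) tT(1)] tT(2)])
        then show "((\<lambda>t. a t / b t) has_field_derivative 0) (at t)" using W[OF tT] by simp
      qed auto
      then obtain c where c: "\<And>t. t \<in> ball t0 d \<Longrightarrow> a t / b t = c" unfolding constant_on_def by blast
      have near: "a t = c * b t" if "t \<in> ball t0 d" for t
      proof -
        have "b t \<noteq> 0" using that d by auto
        then show ?thesis using c[OF that] by (simp add: field_simps)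
      qed
      have "a t = c * b t" if "t \<in> T" for t
      proof (rule analytic_continuation_open[where f = a and g = "\<lambda>t. c * b t" and s = "ball t0 d" and s' = T])
        show "(\<lambda>t. c * b t) holomorphic_on T" by (intro holomorphic_intros b)
        show "ball t0 d \<subseteq> T" using d by blast
      qed (use T d that a near in auto)
      then show ?thesis using y by simp
    qed
    then show "P (G y1) * Q (G y2) = P (G y2) * Q (G y1)" by (simp add: a_def b_def)
  qed
qed

text \<open>In these weights p2^2 and q1^2 q2^2 have degree 6 and q2^4 has degree 8, so only the
  planar energy survives in degree 4.\<close>

lemma H_lead: "lead (wt4 1 2 2 3) H 4 h0"
  unfolding lead_def
proof
  fix z :: "complex^4"
  let ?p = "\<lambda>s. h0 z + s^2 * (z$4^2 / 2 - of_real \<mu> * z$1^2 * z$2^2 / 2) - s^4 * (of_real lam / 4 * z$2^4)"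
  have "(?p \<longlongrightarrow> h0 z + 0^2 * (z$4^2 / 2 - of_real \<mu> * z$1^2 * z$2^2 / 2) - 0^4 * (of_real lam / 4 * z$2^4)) (at 0)"
    by (intro tendsto_intros)
  then have "(?p \<longlongrightarrow> h0 z) (at 0)" by simp
  then show "((\<lambda>s. H (dilate s z) / s ^ 4) \<longlongrightarrow> h0 z) (at 0)"
  proof (rule Lim_transform_eventually)
    have "?p s = H (dilate s z) / s ^ 4" if "s \<noteq> 0" for s
    proof -
      have "H (dilate s z) = s^4 * ?p s"
        unfolding phantom_hamiltonian_def phantom_potential_def h0_def scal_nth wt4_simps
        by (simp add: field_simps eval_nat_numeral)
      then show ?thesis using that by simp
    qed
    then show "\<forall>\<^sub>F s in at 0. ?p s = H (dilate s z) / s ^ 4" by (auto simp: eventually_at_filter)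
  qed
qed

end

section \<open>Continuation along dilations and constancy on energy levels\<close>

lemma scal_in_ball:
  assumes w: "\<And>i. w i \<noteq> 0" and z: "z \<in> ball 0 e" and s: "norm s \<le> 1"
  shows "scal w s z \<in> ball 0 e"
proof -
  have "norm (scal w s z) \<le> norm s * norm z" by (rule norm_scal_le[OF w s])
  also have "\<dots> \<le> 1 * norm z" using s by (intro mult_right_mono) auto
  finally show ?thesis using z by simp
qed

lemma dilation_continuous:
  assumes f: "curve_hol f (ball 0 e)" and w: "\<And>i. w i \<noteq> 0" and z: "z \<in> ball 0 e"
  shows "continuous_on (cball 0 1) (\<lambda>s. f (scal w s z))"
  by (rule continuous_on_compose2[OF curve_hol_imp_continuous[OF f], of "cball 0 1" "\<lambda>s. scal w s z"])
     (use scal_in_ball[OF w z] in \<open>auto intro!: continuous_intros\<close>)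

text \<open>A dilation curve through a point of a ball around 0 is known to stay in the ball only
  for |s| <= 1. The point of interest s = 1 is thus on the boundary and is reached by
  continuity.\<close>

lemma unit_disc_continuation:
  assumes f: "f holomorphic_on ball 0 1" and c: "continuous_on (cball 0 1) f"
    and S: "0 < S" "\<And>s. s \<noteq> 0 \<Longrightarrow> norm s < S \<Longrightarrow> f s = (0 :: complex)"
  shows "f 1 = 0"
proof -
  have "f s = 0" if "s \<in> ball 0 1" for s
  proof (rule analytic_continuation_open[where f = f and g = "\<lambda>_. 0" and s = "ball 0 (min S 1) - {0}" and s' = "ball 0 1"])
    show "ball 0 (min S 1) - {0} \<noteq> ({} :: complex set)"
    proof -
      have "complex_of_real (min S 1 / 2) \<in> ball 0 (min S 1) - {0}" using S(1) by (auto simp: abs_if min_def)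
      then show ?thesis by blast
    qed
  qed (use f S that in auto)
  then show ?thesis
    using continuous_constant_on_closure[of "ball 0 1" f 0 1] c by simp
qed

lemma dilation_vanishing:
  assumes f: "curve_hol f (ball 0 e)" and w: "\<And>i. w i \<noteq> 0" and z: "z \<in> ball 0 e"
    and S: "0 < S" "\<And>s. norm s < S \<Longrightarrow> f (scal w s z) = 0"
  shows "f z = 0"
proof -
  have "f (scal w 1 z) = 0"
  proof (rule unit_disc_continuation[where f = "\<lambda>s. f (scal w s z)" and S = S])
    show "(\<lambda>s. f (scal w s z)) holomorphic_on ball 0 1"
      by (rule dilation_holomorphic[OF f open_ball]) (use scal_in_ball[OF w z] in auto)
    show "continuous_on (cball 0 1) (\<lambda>s. f (scal w s z))" by (rule dilation_continuous[OF f w z])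
  qed (use S in auto)
  then show ?thesis by simp
qed

context phantom
begin

text \<open>With respect to the weights \<open>(1,1,2,2)\<close> the Hamiltonian itself is homogeneous, so that the
  scaling preserves the relation \<open>H z = H z'\<close>.\<close>

abbreviation "hw \<equiv> wt4 1 1 2 2"

lemma H_homogeneous: "H (scal hw s z) = s^4 * H z"
  unfolding phantom_hamiltonian_def phantom_potential_def scal_nth wt4_simps
  by (simp add: field_simps eval_nat_numeral)

text \<open>Order 2n for the weights (1,2,2,3) gives order n for (1,1,2,2). With \<sigma> = sqrt
  |s|, \<open>scal hw s z\<close> equals \<open>dilate \<sigma> w\<close>, where w differs from z by
  the factors s/\<sigma>, s/\<sigma>^2, s^2/\<sigma>^2, s^2/\<sigma>^3, all of modulus at most 1 for
  |s| <= 1.\<close>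

lemma infinite_order_small:
  assumes e: "0 < e" and r: "curve_hol r (ball 0 e)" and L: "lead (wt4 1 2 2 3) r (2 * n) P"
  shows "\<exists>S>0. \<exists>C\<ge>0. \<forall>s. norm s \<le> S \<longrightarrow> norm (r (scal hw s z)) \<le> C * norm s ^ n"
proof -
  have N: "dilatable (wt4 1 2 2 3) (ball 0 e)"
    by (rule dilatable_ball[OF wt4_nonzero e]) auto
  obtain S C where S: "S > 0" "C \<ge> 0" and SC: "\<And>w s. norm w \<le> norm z \<Longrightarrow> norm s \<le> S \<Longrightarrow> dilate s w \<in> ball 0 e \<and>
       norm (r (dilate s w) - P w * s^(2*n)) \<le> C * norm s ^ Suc (2*n)"
    using lead_bound[OF r N L, of "norm z"] by blast
  have "curve_hol P UNIV" by (rule lead_curve_hol[OF r N L])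
  then have "compact (P ` cball 0 (norm z))"
    by (intro compact_continuous_image continuous_on_subset[OF curve_hol_imp_continuous]) auto
  then obtain B0 where B0: "\<And>w. norm w \<le> norm z \<Longrightarrow> norm (P w) \<le> B0"
    by (meson compact_imp_bounded bounded_iff image_eqI mem_cball_0)
  have "norm (P z) \<le> B0" by (rule B0) simp
  then have B00: "0 \<le> B0" using norm_ge_zero[of "P z"] by linarith
  show ?thesis
  proof (intro exI conjI allI impI)
    show "0 < (min S 1)^2" using S by simp
    show "0 \<le> C + B0" using S B00 by simp
    fix s :: complex assume s: "norm s \<le> (min S 1)^2"
    show "norm (r (scal hw s z)) \<le> (C + B0) * norm s ^ n"
    proof -
      define q where "q = sqrt (norm s)"
      have q: "0 \<le> q" "q \<le> min S 1" "q^2 = norm s"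
        using s S real_le_lsqrt[of "min S 1" "norm s"] by (auto simp: q_def)
      have "(min S 1)^2 \<le> 1" using S by (simp add: power_le_one)
      then have s1: "norm s \<le> 1" using s by linarith
      define \<sigma> where "\<sigma> = complex_of_real q"
      define w where "w = (if s = 0 then 0 else vec4 (s / \<sigma> * z$1) (s / \<sigma>^2 * z$2) (s^2 / \<sigma>^2 * z$3) (s^2 / \<sigma>^3 * z$4))"
      have n\<sigma>: "norm \<sigma> = q" using q by (simp add: \<sigma>_def)
      have qz: "q \<noteq> 0" if "s \<noteq> 0" using that q(3) by auto
      have zw: "scal hw s z = dilate \<sigma> w"
      proof (cases "s = 0")
        case True
        then show ?thesis by (simp add: w_def vec4_eq_iff)
      next
        case False
        then have "\<sigma> \<noteq> 0" using qz by (simp add: \<sigma>_def)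
        then show ?thesis using False by (simp add: w_def vec4_eq_iff)
      qed
      have c1: "norm (s / \<sigma>) \<le> 1" "norm (s / \<sigma>^2) \<le> 1" "norm (s^2 / \<sigma>^2) \<le> 1" "norm (s^2 / \<sigma>^3) \<le> 1" if "s \<noteq> 0"
      proof -
        have q0: "0 < q" using qz[OF that] q by simp
        have eqs: "norm s / q = q" "norm s / q^2 = 1" "norm s ^ 2 / q^2 = q^2" "norm s ^ 2 / q^3 = q"
          unfolding q(3)[symmetric] using q0 by (simp_all add: eval_nat_numeral)
        have "q^2 \<le> 1" using q(3) s1 by simp
        then show "norm (s / \<sigma>) \<le> 1" "norm (s / \<sigma>^2) \<le> 1" "norm (s^2 / \<sigma>^2) \<le> 1" "norm (s^2 / \<sigma>^3) \<le> 1"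
          unfolding norm_divide norm_power n\<sigma> eqs using q by auto
      qed
      have "norm w \<le> norm z"
      proof (cases "s = 0")
        case True
        then show ?thesis by (simp add: w_def)
      next
        case False
        note c = c1[OF False]
        have m: "norm (a * b) \<le> norm b" if "norm a \<le> 1" for a b :: complex
          unfolding norm_mult using that mult_right_mono[of "norm a" 1 "norm b"] by simp
        have "norm (w $ i) \<le> norm (z $ i)" for i
          using exhaust_4[of i] False m[OF c(1)] m[OF c(2)] m[OF c(3)] m[OF c(4)]
          unfolding w_def by (auto simp del: norm_divide)
        then show ?thesis by (rule norm_vec_le_norm)
      qed
      then have wz: "norm w \<le> norm z" .
      have \<sigma>S: "norm \<sigma> \<le> S" using q n\<sigma> by simp
      have "norm (r (dilate \<sigma> w)) \<le> norm (r (dilate \<sigma> w) - P w * \<sigma>^(2*n)) + norm (P w * \<sigma>^(2*n))"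
        using norm_triangle_ineq[of "r (dilate \<sigma> w) - P w * \<sigma>^(2*n)" "P w * \<sigma>^(2*n)"] by simp
      also have "\<dots> \<le> C * q ^ Suc (2*n) + B0 * q^(2*n)"
        using SC[OF wz \<sigma>S] B0[OF wz] q(1) unfolding n\<sigma> norm_mult norm_power
        by (intro add_mono mult_right_mono) auto
      also have "C * q ^ Suc (2*n) \<le> C * q^(2*n)"
        using q S by (intro mult_left_mono power_decreasing) auto
      finally have "norm (r (dilate \<sigma> w)) \<le> (C + B0) * q^(2*n)" by (simp add: algebra_simps)
      then show ?thesis unfolding zw power_mult q(3) .
    qed
  qed
qed

text \<open>If subtracting polynomials in H achieves arbitrarily high order, then g/h is constant on
  non-zero levels of H. Two points with equal H keep equal H under \<open>scal hw s\<close>, so S(H)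
  cancels from the comparison \<open>\<phi>\<close> of g/h at the two points, and H^M
  \<open>\<phi>\<close> inherits every order of vanishing at s = 0.\<close>

lemma level_constant:
  assumes e: "0 < e" and g: "curve_hol g (ball 0 e)" and h: "curve_hol h (ball 0 e)" and H: "curve_hol H UNIV"
    and order: "\<And>n. \<exists>S P. lead (wt4 1 2 2 3) (\<lambda>z. g z * H z ^ M - h z * poly S (H z)) n P"
    and z: "z \<in> ball 0 e" and z': "z' \<in> ball 0 e" and HH: "H z = H z'" "H z \<noteq> 0"
  shows "g z * h z' = g z' * h z"
proof -
  have w0: "hw i \<noteq> 0" for i by (rule wt4_nonzero) auto
  define \<phi> where "\<phi> s = g (scal hw s z) * h (scal hw s z') - g (scal hw s z') * h (scal hw s z)" for s
  have hol: "(\<lambda>s. f (scal hw s x)) holomorphic_on ball 0 1" if "curve_hol f (ball 0 e)" "x \<in> ball 0 e" for f x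
    by (rule dilation_holomorphic[OF that(1) open_ball]) (use scal_in_ball[OF w0 that(2)] in auto)
  have \<phi>hol: "\<phi> holomorphic_on ball 0 1"
    unfolding \<phi>_def by (intro holomorphic_on_diff holomorphic_on_mult hol g h z z')
  have \<phi>c: "continuous_on (cball 0 1) \<phi>"
    unfolding \<phi>_def
    by (intro continuous_on_diff continuous_on_mult dilation_continuous[OF g w0] dilation_continuous[OF h w0] z z')
  define \<psi> where "\<psi> s = (s^4 * H z) ^ M * \<phi> s" for s
  have \<psi>hol: "\<psi> holomorphic_on ball 0 1"
    unfolding \<psi>_def by (intro holomorphic_intros \<phi>hol)
  have hb: "\<exists>B. \<forall>s. norm s \<le> 1 \<longrightarrow> norm (h (scal hw s x)) \<le> B" if "x \<in> ball 0 e" for x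
  proof -
    have "compact ((\<lambda>s. h (scal hw s x)) ` cball 0 1)"
      by (intro compact_continuous_image dilation_continuous[OF h w0 that]) auto
    then show ?thesis by (meson compact_imp_bounded bounded_iff image_eqI mem_cball_0)
  qed
  obtain B where B: "\<And>s. norm s \<le> 1 \<Longrightarrow> norm (h (scal hw s z)) \<le> B" using hb[OF z] by blast
  obtain B' where B': "\<And>s. norm s \<le> 1 \<Longrightarrow> norm (h (scal hw s z')) \<le> B'" using hb[OF z'] by blast
  have flat: "((\<lambda>s. \<psi> s / s^n) \<longlongrightarrow> 0) (at 0)" for n
  proof -
    \<comment> \<open>\<open>infinite_order_small\<close> halves the order, so 2 * Suc n leaves
      s^(n+1), one power more than is divided out.\<close>
    obtain S P where L: "lead (wt4 1 2 2 3) (\<lambda>z. g z * H z ^ M - h z * poly S (H z)) (2 * Suc n) P"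
      using order by blast
    define r where "r z = g z * H z ^ M - h z * poly S (H z)" for z
    have Hb: "curve_hol H (ball 0 e)" by (rule curve_hol_subset[OF H]) auto
    have pS: "curve_hol (\<lambda>z. poly S (H z)) (ball 0 e)"
    proof (induction S)
      case (pCons a S)
      then show ?case by (simp add: curve_hol_add curve_hol_mult Hb)
    qed simp
    have rh: "curve_hol r (ball 0 e)"
      unfolding r_def by (intro curve_hol_diff curve_hol_mult curve_hol_power g h Hb pS)
    obtain S1 C1 where 1: "S1 > 0" "C1 \<ge> 0" "\<And>s. norm s \<le> S1 \<Longrightarrow> norm (r (scal hw s z)) \<le> C1 * norm s ^ Suc n"
      using infinite_order_small[OF e rh L[folded r_def], of z] by blast
    obtain S2 C2 where 2: "S2 > 0" "C2 \<ge> 0" "\<And>s. norm s \<le> S2 \<Longrightarrow> norm (r (scal hw s z')) \<le> C2 * norm s ^ Suc n"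
      using infinite_order_small[OF e rh L[folded r_def], of z'] by blast
    have \<psi>r: "\<psi> s = r (scal hw s z) * h (scal hw s z') - r (scal hw s z') * h (scal hw s z)" for s
      unfolding \<psi>_def \<phi>_def r_def H_homogeneous HH(1) by (simp add: algebra_simps)
    have bd: "norm (\<psi> s - 0 * s^n) \<le> (C1 * B' + C2 * B) * norm s ^ Suc n" if s: "norm s \<le> min (min S1 S2) 1" for s
    proof -
      have "norm (\<psi> s) \<le> norm (r (scal hw s z) * h (scal hw s z')) + norm (r (scal hw s z') * h (scal hw s z))"
        unfolding \<psi>r by (rule norm_triangle_ineq4)
      also have "\<dots> \<le> (C1 * norm s ^ Suc n) * B' + (C2 * norm s ^ Suc n) * B"
        unfolding norm_mult using s 1 2 B[of s] B'[of s] by (intro add_mono mult_mono) auto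
      finally show ?thesis by (simp add: algebra_simps)
    qed
    show ?thesis
      by (rule tendsto_leading[of "min (min S1 S2) 1", OF _ bd]) (use 1 2 in auto)
  qed
  have \<psi>0: "\<psi> s = 0" if "norm s < 1/2" for s
    by (rule taylor_all_zero[OF \<psi>hol, of "1/2"]) (use flat that in auto)
  have "\<phi> 1 = 0"
  proof (rule unit_disc_continuation[OF \<phi>hol \<phi>c, of "1/2"])
    show "\<phi> s = 0" if "s \<noteq> 0" "norm s < 1/2" for s
      using \<psi>0[OF that(2)] that(1) HH(2) by (simp add: \<psi>_def)
  qed simp
  then show ?thesis by (simp add: \<phi>_def)
qed

lemma H_curve_hol: "curve_hol H UNIV"
  by (rule mv_holomorphic_imp_curve_hol) (use H_cderiv in \<open>auto simp: mv_holomorphic_on_cderiv\<close>)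

lemma H_shift3: "H (z + t *s axis 3 1) = H z + ((z$3 + t)^2 - z$3^2) / 2"
  unfolding phantom_hamiltonian_def by (simp add: axis_def field_simps)

text \<open>H is quadratic in p1, so a displacement in any other coordinate can be compensated
  exactly by a change of p1. This gives explicit curves in the level through \<open>z\<close>, along
  which F is constant; differentiating yields each partial derivative.\<close>

lemma gradient_parallel:
  assumes F: "cderiv F D z" and p: "z$3 \<noteq> 0" and U: "open U" "z \<in> U"
    and lev: "\<And>z'. z' \<in> U \<Longrightarrow> H z' = H z \<Longrightarrow> F z' = F z"
  shows "gradient F z = (D (axis 3 1) / z$3) *s gradient H z"
proof -
  have H3: "partial_deriv 3 H z = z$3" unfolding cderiv_partial[OF H_cderiv] by (simp add: DH_def axis_def)
  have "partial_deriv i F z = D (axis 3 1) / z$3 * partial_deriv i H z" for i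
  proof (cases "i = 3")
    case True
    then show ?thesis using p H3 by (simp add: cderiv_partial[OF F])
  next
    case False
    \<comment> \<open>By \<open>H_shift3\<close> the corrected momentum must satisfy (z3 + q)^2 =
      z3^2 - 2 (H(z + \<zeta> e_i) - H z) = z3^2 c, solved by the branch with c(0) = 1 and q(0) =
      0.\<close>
    define c where "c \<zeta> = 1 - 2 * (H (z + \<zeta> *s axis i 1) - H z) / z$3^2" for \<zeta>
    define q where "q \<zeta> = z$3 * csqrt (c \<zeta>) - z$3" for \<zeta>
    define Z where "Z \<zeta> = (z + \<zeta> *s axis i 1) + q \<zeta> *s axis 3 1" for \<zeta>
    define hi where "hi = DH z (axis i 1)"
    have i3: "(z + \<zeta> *s axis i 1) $ 3 = z$3" for \<zeta> using False by (simp add: axis_def)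
    have HZ: "H (Z \<zeta>) = H z" for \<zeta>
      unfolding Z_def H_shift3 i3 using p by (simp add: q_def c_def power_mult_distrib field_simps)
    have dH: "((\<lambda>\<zeta>. H (z + \<zeta> *s axis i 1)) has_field_derivative hi) (at 0)"
      unfolding hi_def
    proof (rule cderiv_along_curve)
      show "cderiv H (DH z) (z + 0 *s axis i 1)" using H_cderiv[of z] by simp
      show "((\<lambda>t. (z + t *s axis i 1) $ j) has_field_derivative axis i 1 $ j) (at 0)" for j
        unfolding vector_add_component vector_smult_component by (auto intro!: derivative_eq_intros)
    qed
    have c0: "c 0 = 1" by (simp add: c_def)
    have dc: "(c has_field_derivative - 2 * hi / z$3^2) (at 0)"
      unfolding c_def[abs_def]
      by (rule DERIV_cong[OF DERIV_diff[OF DERIV_const DERIV_cdivide[OF DERIV_cmult[OF DERIV_diff[OF dH DERIV_const]]]]]) simp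
    have "(csqrt has_field_derivative inverse (2 * csqrt 1)) (at (c 0))"
      unfolding c0 by (rule has_field_derivative_csqrt) auto
    from DERIV_chain2[OF this dc] have dcs: "((\<lambda>\<zeta>. csqrt (c \<zeta>)) has_field_derivative - hi / z$3^2) (at 0)" by simp
    have dq: "(q has_field_derivative - hi / z$3) (at 0)"
      unfolding q_def[abs_def]
      by (rule DERIV_cong[OF DERIV_diff[OF DERIV_cmult[OF dcs] DERIV_const]])
         (use p in \<open>simp add: power2_eq_square\<close>)
    have q0: "q 0 = 0" by (simp add: q_def c0)
    have Z0: "Z 0 = z" by (simp add: Z_def q0)
    have dZ: "((\<lambda>\<zeta>. Z \<zeta> $ j) has_field_derivative (axis i 1 + (- hi / z$3) *s axis 3 1) $ j) (at 0)" for j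
      unfolding Z_def vector_add_component vector_smult_component
      by (auto intro!: derivative_eq_intros dq)
    have "((\<lambda>\<zeta>. F (Z \<zeta>)) has_field_derivative D (axis i 1 + (- hi / z$3) *s axis 3 1)) (at 0)"
      by (rule cderiv_along_curve[OF _ dZ]) (use F Z0 in simp)
    moreover have "((\<lambda>\<zeta>. F (Z \<zeta>)) has_field_derivative 0) (at 0)"
    proof -
      have "isCont Z 0"
        using has_derivative_continuous[OF has_derivative_curve[OF dZ]] by simp
      then have "\<forall>\<^sub>F \<zeta> in nhds 0. Z \<zeta> \<in> U"
        using U Z0 by (metis continuous_at_imp_continuous_within eventually_nhds topological_tendstoD isCont_def tendsto_at_iff_tendsto_nhds)
      then have "\<forall>\<^sub>F \<zeta> in nhds 0. F (Z \<zeta>) = F z"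
        by (rule eventually_mono) (use lev HZ in blast)
      then show ?thesis
        using DERIV_cong_ev[of 0 0 "\<lambda>\<zeta>. F (Z \<zeta>)" "\<lambda>\<zeta>. F z" 0 0] by simp
    qed
    ultimately have "D (axis i 1 + (- hi / z$3) *s axis 3 1) = 0" by (rule DERIV_unique)
    then have "D (axis i 1) = hi / z$3 * D (axis 3 1)"
      unfolding cderiv_add[OF F] cderiv_scale[OF F] by (simp add: algebra_simps)
    then show ?thesis unfolding cderiv_partial[OF F] cderiv_partial[OF H_cderiv] hi_def by simp
  qed
  then show ?thesis by (simp add: vec_eq_iff gradient_def)
qed

end

section \<open>Identity theorems in several variables\<close>

lemma curve_hol_convex_identity:
  assumes f: "curve_hol f S" and S: "open S" "convex S" and w: "w \<in> S"
    and V: "open V" "w \<in> V" "\<And>x. x \<in> V \<Longrightarrow> x \<in> S \<Longrightarrow> f x = 0" and v: "v \<in> S"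
  shows "f v = 0"
proof -
  define \<phi> where "\<phi> t = w + t *s (v - w)" for t :: complex
  have \<phi>: "(\<lambda>t. \<phi> t $ i) holomorphic_on X" for i X
    unfolding \<phi>_def vector_add_component vector_smult_component by (intro holomorphic_intros)
  have op: "open (\<phi> -` X)" if "open X" for X
    by (rule open_vimage[OF that continuous_curve[OF \<phi>]])
  define T where "T = \<phi> -` S"
  have T: "open T" unfolding T_def by (rule op[OF S(1)])
  have "convex T"
    unfolding convex_alt T_def
  proof (intro ballI allI impI)
    fix a b :: complex and u :: real assume ab: "a \<in> \<phi> -` S" "b \<in> \<phi> -` S" and u: "0 \<le> u \<and> u \<le> 1"
    have "\<phi> ((1 - u) *\<^sub>R a + u *\<^sub>R b) = (1 - u) *\<^sub>R \<phi> a + u *\<^sub>R \<phi> b"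
      unfolding \<phi>_def vec_eq_iff vector_add_component vector_smult_component vector_minus_component vector_scaleR_component
      by (simp add: scaleR_conv_of_real algebra_simps)
    then show "(1 - u) *\<^sub>R a + u *\<^sub>R b \<in> \<phi> -` S"
      using S(2) ab u unfolding convex_alt by simp
  qed
  then have cT: "connected T" by (rule convex_connected)
  have \<phi>0: "\<phi> 0 = w" and \<phi>1: "\<phi> 1 = v" unfolding \<phi>_def vec_eq_iff by simp_all
  have hol: "(\<lambda>t. f (\<phi> t)) holomorphic_on T"
    by (rule curve_hol_compose[OF f T \<phi>]) (simp add: T_def)
  have "f (\<phi> 1) = 0"
  proof (rule analytic_continuation_open[where f = "\<lambda>t. f (\<phi> t)" and g = "\<lambda>t. 0" and s = "\<phi> -` V \<inter> T" and s' = T, OF _ T _ cT _ hol holomorphic_on_const])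
    show "open (\<phi> -` V \<inter> T)" by (intro open_Int op V(1) T)
    show "\<phi> -` V \<inter> T \<noteq> {}" using \<phi>0 w V(2) by (auto simp: T_def)
    show "1 \<in> T" using \<phi>1 v by (simp add: T_def)
    show "f (\<phi> t) = 0" if "t \<in> \<phi> -` V \<inter> T" for t using that V(3) by (simp add: T_def)
  qed blast
  then show ?thesis unfolding \<phi>1 .
qed

text \<open>The interior of the zero set is relatively closed, by the convex case on small balls.
  Its use: a denominator that is non-zero somewhere in the connected neighbourhood is non-zero
  somewhere in the ball around the origin.\<close>

lemma curve_hol_connected_identity:
  assumes f: "curve_hol f U" and U: "open U" "connected U" and a: "a \<in> U" "0 < \<rho>"
    and 0: "\<And>x. x \<in> ball a \<rho> \<Longrightarrow> x \<in> U \<Longrightarrow> f x = 0" and v: "v \<in> U"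
  shows "f v = 0"
proof -
  define A where "A = {z \<in> U. \<exists>\<rho>>0. ball z \<rho> \<subseteq> U \<and> (\<forall>w\<in>ball z \<rho>. f w = 0)}"
  have opA: "open A"
    unfolding open_contains_ball
  proof
    fix z assume "z \<in> A"
    then obtain r where r: "0 < r" "ball z r \<subseteq> U" "\<forall>w\<in>ball z r. f w = 0" unfolding A_def by blast
    have "w \<in> A" if w: "w \<in> ball z r" for w
    proof -
      have sub: "ball w (r - dist z w) \<subseteq> ball z r"
      proof
        fix x assume "x \<in> ball w (r - dist z w)"
        then show "x \<in> ball z r" using dist_triangle[of z x w] by simp
      qed
      moreover have "w \<in> U" using w r(2) by blast
      moreover have "0 < r - dist z w" using w by simp
      moreover have "ball w (r - dist z w) \<subseteq> U" "\<forall>x\<in>ball w (r - dist z w). f x = 0"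
        using sub r(2,3) by blast+
      ultimately show ?thesis unfolding A_def by blast
    qed
    then show "\<exists>e>0. ball z e \<subseteq> A" using r(1) by blast
  qed
  have opB: "open (U - A)"
    unfolding open_contains_ball
  proof
    fix z assume z: "z \<in> U - A"
    then obtain r where r: "0 < r" "ball z r \<subseteq> U" using U(1) open_contains_ball by blast
    have "w \<notin> A" if w: "w \<in> ball z r" for w
    proof
      assume "w \<in> A"
      then obtain r' where r': "0 < r'" "ball w r' \<subseteq> U" "\<forall>x\<in>ball w r'. f x = 0" unfolding A_def by blast
      have "f x = 0" if "x \<in> ball z r" for x
        by (rule curve_hol_convex_identity[OF curve_hol_subset[OF f r(2)] open_ball convex_ball w open_ball[of w r'] _ _ that])
           (use r' in auto)
      then have "z \<in> A" unfolding A_def using r z by blast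
      with z show False by simp
    qed
    then show "\<exists>e>0. ball z e \<subseteq> U - A" using r by blast
  qed
  obtain r where r: "0 < r" "ball a r \<subseteq> U" using U(1) a(1) open_contains_ball by blast
  have "ball a (min r \<rho>) \<subseteq> U" using r by auto
  moreover have "0 < min r \<rho>" using r a by simp
  moreover from calculation have "\<forall>w\<in>ball a (min r \<rho>). f w = 0" using 0 by auto
  ultimately have "a \<in> A" unfolding A_def using a(1) by blast
  moreover have "A \<inter> (U - A) \<inter> U = {}" "U \<subseteq> A \<union> (U - A)" by blast+
  ultimately have "(U - A) \<inter> U = {}" using connectedD[OF U(2) opA opB] a(1) by blast
  then have "v \<in> A" using v by blast
  then obtain r where "0 < r" "\<forall>w\<in>ball v r. f w = 0" unfolding A_def by blast
  then show ?thesis by simp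
qed

text \<open>For entire \<open>f\<close> the dilation curve exists for all s, so s = 1 is an interior
  point and the weights may be zero.\<close>

lemma entire_dilation_vanishing:
  assumes f: "curve_hol f UNIV" and S: "0 < S" "\<And>s. norm s < S \<Longrightarrow> f (scal w s z) = 0"
  shows "f z = 0"
proof -
  have hol: "(\<lambda>s. f (scal w s z)) holomorphic_on UNIV" by (rule dilation_holomorphic[OF f]) auto
  have "f (scal w 1 z) = 0"
    by (rule analytic_continuation_open[where f = "\<lambda>s. f (scal w s z)" and g = "\<lambda>_. 0" and s = "ball 0 S" and s' = UNIV,
          OF open_ball open_UNIV _ connected_UNIV subset_UNIV hol holomorphic_on_const])
       (use S in auto)
  then show ?thesis by simp
qed

lemma entire_lead_exists:
  assumes P: "curve_hol P UNIV" and z: "\<exists>z. P z \<noteq> 0"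
  shows "\<exists>m A. lead w P m A \<and> (\<exists>z. A z \<noteq> 0)"
proof -
  obtain z where z: "P z \<noteq> 0" using z by blast
  have "\<not> (\<exists>S>0. \<forall>s. norm s < S \<longrightarrow> P (scal w s z) = 0)"
  proof
    assume "\<exists>S>0. \<forall>s. norm s < S \<longrightarrow> P (scal w s z) = 0"
    then obtain S where S: "S > 0" "\<And>s. norm s < S \<Longrightarrow> P (scal w s z) = 0" by blast
    from entire_dilation_vanishing[OF P S] z show False by simp
  qed
  from lead_exists[OF P dilatable_UNIV this] show ?thesis .
qed

section \<open>Nontrivial pairs of leading terms\<close>

context phantom
begin

text \<open>\<open>N\<close> and \<open>l\<close> are the degrees under \<open>dilate\<close>. With
  l <= N, a quotient equal to a constant times a power of \<open>h0\<close> has a non-negative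
  exponent j, as in N = l + 4 j.\<close>

definition good_pair :: "(complex^4 \<Rightarrow> complex) \<Rightarrow> (complex^4 \<Rightarrow> complex) \<Rightarrow> nat \<Rightarrow> nat \<Rightarrow> bool" where
  "good_pair P Q N l \<longleftrightarrow> curve_hol P UNIV \<and> curve_hol Q UNIV \<and> (\<exists>z. P z \<noteq> 0) \<and> (\<exists>z. Q z \<noteq> 0) \<and> l \<le> N \<and>
     const_ratio P Q \<and> (\<forall>s z. s \<noteq> 0 \<longrightarrow> P (dilate s z) = s^N * P z) \<and> (\<forall>s z. s \<noteq> 0 \<longrightarrow> Q (dilate s z) = s^l * Q z)"

text \<open>Suppose every leading quotient is c h0^j. It is then the leading term of c H^j, and
  subtracting c H^j raises the order; repeated indefinitely, this feeds
  \<open>level_constant\<close>. F is then constant on levels of H near a suitable point, and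
  \<open>gradient_parallel\<close> contradicts independence.\<close>

lemma leading_pair_exists:
  assumes F: "meromorphic_first_integral H F" and ind: "functionally_independent F H"
  shows "\<exists>P Q N l. good_pair P Q N l \<and> \<not> (\<exists>c j. N = l + 4 * j \<and> (\<forall>z. P z = c * h0 z ^ j * Q z))"
proof (rule ccontr)
  assume none: "\<not> ?thesis"
  obtain U g h where U: "open U" "connected U" "0 \<in> U" and g0: "mv_holomorphic_on g U" and hU: "mv_holomorphic_on h U"
    and hne: "\<exists>w\<in>U. h w \<noteq> 0" and Fgh: "\<And>w. w \<in> U \<Longrightarrow> h w \<noteq> 0 \<Longrightarrow> F w = g w / h w"
    using F unfolding meromorphic_first_integral_def mv_meromorphic_on_def by (meson UNIV_I)
  obtain e where e: "0 < e" "ball 0 e \<subseteq> U" using U open_contains_ball by blast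
  have g: "curve_hol g (ball 0 e)" and h: "curve_hol h (ball 0 e)"
    using curve_hol_subset[OF mv_holomorphic_imp_curve_hol e(2)] g0 hU by auto
  have fq: "first_integral_quotient g h (ball 0 e)"
    using meromorphic_first_integral_quotient[OF F g0 hU U(1) Fgh] e(2) unfolding first_integral_quotient_def by blast
  have "\<exists>z1\<in>ball 0 e. h z1 \<noteq> 0"
  proof (rule ccontr)
    assume *: "\<not> ?thesis"
    obtain w where w: "w \<in> U" "h w \<noteq> 0" using hne by blast
    have "h w = 0"
      by (rule curve_hol_connected_identity[OF mv_holomorphic_imp_curve_hol[OF hU] U e(1) _ w(1)]) (use * in auto)
    with w show False by simp
  qed
  then obtain z1 where z1: "z1 \<in> ball 0 e" "h z1 \<noteq> 0" by blast
  have wt: "wt4 1 2 2 3 i \<noteq> 0" for i by (rule wt4_nonzero) auto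
  have N: "dilatable (wt4 1 2 2 3) (ball 0 e)" by (rule dilatable_ball[OF wt e(1)])
  have "\<not> (\<exists>S>0. \<forall>s. norm s < S \<longrightarrow> h (dilate s z1) = 0)"
  proof
    assume "\<exists>S>0. \<forall>s. norm s < S \<longrightarrow> h (dilate s z1) = 0"
    then obtain S where S: "S > 0" "\<And>s. norm s < S \<Longrightarrow> h (dilate s z1) = 0" by blast
    from dilation_vanishing[OF h wt z1(1) S] z1(2) show False by simp
  qed
  from lead_exists[OF h N this] obtain l Q where LQ: "lead (wt4 1 2 2 3) h l Q" and Q0: "\<exists>z. Q z \<noteq> 0" by blast
  have Hb: "curve_hol H (ball 0 e)" by (rule curve_hol_subset[OF H_curve_hol]) auto
  have pS: "curve_hol (\<lambda>z. poly S (H z)) (ball 0 e)" for S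
  proof (induction S)
    case (pCons a S)
    then show ?case by (simp add: curve_hol_add curve_hol_mult Hb)
  qed simp
  \<comment> \<open>The factor H^l has order 4 l, at least the order l of h, so the leading degree
    starts at or above l.\<close>
  define r where "r S z = g z * H z ^ l - h z * poly S (H z)" for S z
  have rh: "curve_hol (r S) (ball 0 e)" for S
    unfolding r_def by (intro curve_hol_diff curve_hol_mult curve_hol_power g h Hb pS)
  have fqr: "first_integral_quotient (r S) h (ball 0 e)" for S
    unfolding r_def by (rule first_integral_quotient_shift[OF fq])
  have order: "\<exists>S P. lead (wt4 1 2 2 3) (r S) (l + n) P" for n
  proof (induction n)
    case 0
    obtain Pg where "lead (wt4 1 2 2 3) g 0 Pg" using lead_zero_exists[OF g N] by blast
    from lead_mult[OF this lead_power[OF H_lead, of l]]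
    have L: "lead (wt4 1 2 2 3) (r 0) (4 * l) (\<lambda>z. Pg z * h0 z ^ l)" by (simp add: r_def[abs_def])
    have "\<exists>P. lead (wt4 1 2 2 3) (r 0) l P"
    proof (cases "l = 0")
      case True
      then show ?thesis using L by auto
    next
      case False
      then show ?thesis using lead_lower[OF L, of l] by auto
    qed
    then show ?case by auto
  next
    case (Suc n)
    then obtain S P where L: "lead (wt4 1 2 2 3) (r S) (l + n) P" by blast
    have "\<exists>S'. lead (wt4 1 2 2 3) (r S') (l + n) (\<lambda>z. 0)"
    proof (cases "\<exists>z. P z \<noteq> 0")
      case False
      then have "P = (\<lambda>z. 0)" by auto
      then show ?thesis using L by blast
    next
      case True
      have "good_pair P Q (l + n) l"
        unfolding good_pair_def
        using const_ratio_lead[OF e(1) fqr L LQ] True Q0 lead_homogeneous[OF L] lead_homogeneous[OF LQ] by simp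
      then obtain c j where cj: "l + n = l + 4 * j" "\<And>z. P z = c * h0 z ^ j * Q z"
        using none by blast
      have "lead (wt4 1 2 2 3) (\<lambda>z. c * (H z ^ j * h z)) (4 * j + l) (\<lambda>z. c * (h0 z ^ j * Q z))"
        by (intro lead_cmult lead_mult lead_power H_lead LQ)
      then have "lead (wt4 1 2 2 3) (\<lambda>z. c * (H z ^ j * h z)) (l + n) (\<lambda>z. c * (h0 z ^ j * Q z))"
        unfolding cj(1) by (simp add: add.commute)
      from lead_diff[OF L this]
      have "lead (wt4 1 2 2 3) (\<lambda>z. r S z - c * (H z ^ j * h z)) (l + n) (\<lambda>z. P z - c * (h0 z ^ j * Q z))" .
      moreover have "(\<lambda>z. r S z - c * (H z ^ j * h z)) = r (S + monom c j)"
        by (rule ext) (simp add: r_def poly_monom algebra_simps)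
      moreover have "(\<lambda>z. P z - c * (h0 z ^ j * Q z)) = (\<lambda>z. 0)" by (rule ext) (simp add: cj(2))
      ultimately have "lead (wt4 1 2 2 3) (r (S + monom c j)) (l + n) (\<lambda>z. 0)" by (simp only:)
      then show ?thesis by blast
    qed
    then obtain S' where "lead (wt4 1 2 2 3) (r S') (l + n) (\<lambda>z. 0)" by blast
    from lead_next[OF rh N this] show ?case by auto
  qed
  have order': "\<exists>S P. lead (wt4 1 2 2 3) (\<lambda>z. g z * H z ^ l - h z * poly S (H z)) n P" for n
  proof -
    obtain S P where L: "lead (wt4 1 2 2 3) (r S) (l + n) P" using order by blast
    have "\<exists>P. lead (wt4 1 2 2 3) (r S) n P"
    proof (cases "l = 0")
      case True
      then show ?thesis using L by auto
    next
      case False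
      then show ?thesis using lead_lower[OF L, of n] by auto
    qed
    then show ?thesis unfolding r_def[abs_def] by blast
  qed
  obtain W where W: "open W" "closure W = UNIV" "W \<subseteq> regular_points F"
    and Wi: "\<And>z a b. z \<in> W \<Longrightarrow> a *s gradient F z + b *s gradient H z = 0 \<Longrightarrow> a = 0 \<and> b = 0"
    using ind unfolding functionally_independent_def by blast
  define D where "D = ball 0 e \<inter> h -` (- {0})"
  have D: "open D" "z1 \<in> D" using z1
    unfolding D_def by (auto intro!: continuous_open_preimage[OF curve_hol_imp_continuous[OF h]])
  have "W \<inter> D \<noteq> {}" using open_Int_closure_eq_empty[OF D(1), of W] W(2) D(2) by blast
  then obtain z2 where z2: "z2 \<in> W \<inter> D" by blast
  define \<zeta> where "\<zeta> t = z2 + t *s axis 3 1" for t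
  have \<zeta>c: "(\<lambda>t. \<zeta> t $ i) holomorphic_on UNIV" for i
    unfolding \<zeta>_def vector_add_component vector_smult_component by (intro holomorphic_intros)
  have "open (\<zeta> -` (W \<inter> D))"
    by (rule open_vimage[OF open_Int[OF W(1) D(1)] continuous_curve[OF \<zeta>c]])
  moreover have "0 \<in> \<zeta> -` (W \<inter> D)" using z2 by (simp add: \<zeta>_def)
  ultimately have ev1: "\<forall>\<^sub>F t in at 0. t \<in> \<zeta> -` (W \<inter> D)"
    using eventually_at_in_open' by blast
  \<comment> \<open>Along the line in the p1 direction H is (p1^2 - K)/2, so p1 or H vanishes for at
    most three values of t, collected in \<open>E\<close>.\<close>
  define K where "K = z2 $ 3 ^ 2 - 2 * H z2"
  define E where "E = {- z2 $ 3, csqrt K - z2 $ 3, - csqrt K - z2 $ 3}"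
  have "\<not> 0 islimpt E" by (rule islimpt_finite) (simp add: E_def)
  then have ev2: "\<forall>\<^sub>F t in at 0. t \<notin> E" unfolding islimpt_iff_eventually by simp
  obtain t where t: "\<zeta> t \<in> W \<inter> D" "t \<notin> E"
    using eventually_happens'[OF trivial_limit_at eventually_conj[OF ev1 ev2]] by auto
  define z where "z = \<zeta> t"
  have z3: "z $ 3 = z2 $ 3 + t" by (simp add: z_def \<zeta>_def axis_def)
  have p: "z $ 3 \<noteq> 0" using t(2) unfolding z3 E_def by (auto simp: add_eq_0_iff)
  have Hz: "H z \<noteq> 0"
  proof
    assume "H z = 0"
    then have "(z2 $ 3 + t)^2 = csqrt K ^ 2"
      unfolding z_def \<zeta>_def H_shift3 K_def by (simp add: field_simps)
    then have "z2 $ 3 + t = csqrt K \<or> z2 $ 3 + t = - csqrt K" unfolding power2_eq_iff .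
    then have "t = csqrt K - z2 $ 3 \<or> t = - csqrt K - z2 $ 3"
      using add_diff_cancel_left'[of "z2 $ 3" t] by metis
    then have "t \<in> E" unfolding E_def by blast
    with t(2) show False by simp
  qed
  have zW: "z \<in> W" and zD: "z \<in> D" using t by (auto simp: z_def)
  obtain DF where DF: "cderiv F DF z"
    using W(3) zW unfolding regular_points_def mv_holomorphic_on_cderiv by blast
  have "gradient F z = (DF (axis 3 1) / z$3) *s gradient H z"
  proof (rule gradient_parallel[OF DF p D(1) zD])
    fix z' assume z': "z' \<in> D" "H z' = H z"
    have "g z * h z' = g z' * h z"
      by (rule level_constant[OF e(1) g h H_curve_hol order']) (use zD z' Hz in \<open>auto simp: D_def\<close>)
    then show "F z' = F z"
      using zD z' e(2) by (simp add: Fgh D_def subset_iff field_simps)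
  qed
  then have "1 *s gradient F z + (- (DF (axis 3 1) / z$3)) *s gradient H z = 0"
    by (simp add: vec_eq_iff)
  from Wi[OF zW this] show False by simp
qed

text \<open>Counts the degree in the transverse variables q2 and p2. The linearised equations are
  linear in these, so this dilation maps solutions of \<open>XV\<close> to solutions.\<close>

abbreviation rw :: "4 \<Rightarrow> nat" where "rw \<equiv> wt4 0 1 0 1"

lemma h0_curve_hol: "curve_hol h0 UNIV"
proof -
  have "curve_hol (\<lambda>z. (1/2) * z$3^2 - of_real \<Lambda> / 4 * z$1^4) UNIV"
    by (intro curve_hol_diff curve_hol_mult curve_hol_power curve_hol_const curve_hol_nth)
  then show ?thesis unfolding h0_def[abs_def] by simp
qed

lemma h0_dilate: "h0 (dilate s z) = s^4 * h0 z"
  unfolding h0_def scal_nth wt4_simps by (simp add: field_simps eval_nat_numeral)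

lemma h0_const:
  assumes T: "open T" "connected T"
    and G': "\<forall>y\<in>T. \<forall>i. ((\<lambda>t. G t $ i) has_field_derivative \<phi> y * XV (G y) $ i) (at y)"
    and y: "y \<in> T" "y' \<in> T"
  shows "h0 (G y) = h0 (G y')"
proof -
  have "(\<lambda>t. h0 (G t)) constant_on T"
  proof (rule has_field_derivative_0_imp_constant_on[OF _ T(2,1)])
    fix t assume t: "t \<in> T"
    note d = G'[rule_format, OF t]
    have "((\<lambda>t. h0 (G t)) has_field_derivative
       (2 * G t $ 3 * (\<phi> t * XV (G t) $ 3)) / 2 - of_real \<Lambda> / 4 * (4 * G t $ 1 ^ 3 * (\<phi> t * XV (G t) $ 1))) (at t)"
      unfolding h0_def by (rule derivative_eq_intros d refl | simp)+
    moreover have "(2 * G t $ 3 * (\<phi> t * XV (G t) $ 3)) / 2 - of_real \<Lambda> / 4 * (4 * G t $ 1 ^ 3 * (\<phi> t * XV (G t) $ 1)) = 0"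
      by (simp add: XV_def)
    ultimately show "((\<lambda>t. h0 (G t)) has_field_derivative 0) (at t)" by (simp only:)
  qed
  then show ?thesis using y unfolding constant_on_def by auto
qed

lemma const_ratio_rlead:
  assumes PQ: "const_ratio P Q" and A: "lead rw P m A" and B: "lead rw Q m' B"
  shows "const_ratio A B"
  unfolding const_ratio_def
proof (intro allI impI ballI)
  fix T G \<phi> y y'
  assume T: "open T" "connected T" and G: "\<forall>i. (\<lambda>t. G t $ i) holomorphic_on T"
    and G': "\<forall>y\<in>T. \<forall>i. ((\<lambda>t. G t $ i) has_field_derivative \<phi> y * XV (G y) $ i) (at y)"
    and y: "y \<in> T" "y' \<in> T"
  have rel: "P (scal rw s (G y)) * Q (scal rw s (G y')) = P (scal rw s (G y')) * Q (scal rw s (G y))" for s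
  proof -
    have 1: "\<forall>i. (\<lambda>t. scal rw s (G t) $ i) holomorphic_on T"
      unfolding scal_nth using G by (auto intro!: holomorphic_intros)
    have XVs: "XV (scal rw s z) $ i = s ^ rw i * XV z $ i" for z i
      using exhaust_4[of i] by (auto simp: XV_def)
    have 2: "\<forall>y\<in>T. \<forall>i. ((\<lambda>t. scal rw s (G t) $ i) has_field_derivative \<phi> y * XV (scal rw s (G y)) $ i) (at y)"
    proof (intro ballI allI)
      fix t i assume t: "t \<in> T"
      have "((\<lambda>t. s ^ rw i * G t $ i) has_field_derivative s ^ rw i * (\<phi> t * XV (G t) $ i)) (at t)"
        by (rule DERIV_cmult) (use G' t in blast)
      then show "((\<lambda>t. scal rw s (G t) $ i) has_field_derivative \<phi> t * XV (scal rw s (G t)) $ i) (at t)"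
        unfolding scal_nth XVs by (simp add: mult.left_commute)
    qed
    show ?thesis using PQ[unfolded const_ratio_def, rule_format, OF T 1[rule_format] 2[rule_format] y] .
  qed
  note a = A[unfolded lead_def, rule_format] and b = B[unfolded lead_def, rule_format]
  have l1: "((\<lambda>s. P (scal rw s (G y)) / s^m * (Q (scal rw s (G y')) / s^m')) \<longlongrightarrow> A (G y) * B (G y')) (at 0)"
    by (rule tendsto_mult[OF a b])
  have l2: "((\<lambda>s. P (scal rw s (G y')) / s^m * (Q (scal rw s (G y)) / s^m')) \<longlongrightarrow> A (G y') * B (G y)) (at 0)"
    by (rule tendsto_mult[OF a b])
  show "A (G y) * B (G y') = A (G y') * B (G y)"
    by (rule tendsto_unique[OF trivial_limit_at l1[unfolded times_divide_times_eq rel] l2[unfolded times_divide_times_eq]])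
qed

lemma good_pair_rlead:
  assumes g: "good_pair P Q N l" and A: "lead rw P m A" "\<exists>z. A z \<noteq> 0" and B: "lead rw Q m' B" "\<exists>z. B z \<noteq> 0"
  shows "good_pair A B N l" "\<And>s z. s \<noteq> 0 \<Longrightarrow> A (scal rw s z) = s^m * A z" "\<And>s z. s \<noteq> 0 \<Longrightarrow> B (scal rw s z) = s^m' * B z"
proof -
  have PQ: "curve_hol P UNIV" "curve_hol Q UNIV" "const_ratio P Q" "l \<le> N"
    "\<And>s z. s \<noteq> 0 \<Longrightarrow> P (dilate s z) = s^N * P z" "\<And>s z. s \<noteq> 0 \<Longrightarrow> Q (dilate s z) = s^l * Q z"
    using g unfolding good_pair_def by auto
  have "A (dilate s z) = s^N * A z" "B (dilate s z) = s^l * B z" if "s \<noteq> 0" for s z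
    using lead_homogeneous_other[OF A(1) PQ(5)[OF that]] lead_homogeneous_other[OF B(1) PQ(6)[OF that]] by auto
  then show "good_pair A B N l"
    unfolding good_pair_def
    using lead_curve_hol[OF PQ(1) dilatable_UNIV A(1)] lead_curve_hol[OF PQ(2) dilatable_UNIV B(1)]
      A(2) B(2) PQ(4) const_ratio_rlead[OF PQ(3) A(1) B(1)] by simp
  show "\<And>s z. s \<noteq> 0 \<Longrightarrow> A (scal rw s z) = s^m * A z" by (rule lead_homogeneous[OF A(1)])
  show "\<And>s z. s \<noteq> 0 \<Longrightarrow> B (scal rw s z) = s^m' * B z" by (rule lead_homogeneous[OF B(1)])
qed

definition trivial_pair :: "(complex^4 \<Rightarrow> complex) \<Rightarrow> (complex^4 \<Rightarrow> complex) \<Rightarrow> nat \<Rightarrow> nat \<Rightarrow> bool" where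
  "trivial_pair P Q N l \<longleftrightarrow> (\<exists>c j. N = l + 4 * j \<and> (\<forall>z. P z = c * h0 z ^ j * Q z))"

text \<open>If the leading terms of P and Q have equal degree and are themselves trivial, P is
  replaced by P - c h0^j Q, which is non-zero because P, Q is nontrivial. The cancellation makes its
  leading degree differ from that of Q, and unequal degrees are an equally good obstruction.\<close>

lemma bihomogeneous_pair_exists:
  assumes g: "good_pair P Q N l" and nt: "\<not> trivial_pair P Q N l"
  shows "\<exists>A B m m'. good_pair A B N l \<and> (\<forall>s z. s \<noteq> 0 \<longrightarrow> A (scal rw s z) = s^m * A z) \<and>
    (\<forall>s z. s \<noteq> 0 \<longrightarrow> B (scal rw s z) = s^m' * B z) \<and> (m \<noteq> m' \<or> \<not> trivial_pair A B N l)"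
proof -
  have PQ: "curve_hol P UNIV" "curve_hol Q UNIV" "const_ratio P Q" "l \<le> N" "\<exists>z. P z \<noteq> 0" "\<exists>z. Q z \<noteq> 0"
    "\<And>s z. s \<noteq> 0 \<Longrightarrow> P (dilate s z) = s^N * P z" "\<And>s z. s \<noteq> 0 \<Longrightarrow> Q (dilate s z) = s^l * Q z"
    using g unfolding good_pair_def by auto
  obtain m A where A: "lead rw P m A" "\<exists>z. A z \<noteq> 0" using entire_lead_exists[OF PQ(1,5)] by blast
  obtain m' B where B: "lead rw Q m' B" "\<exists>z. B z \<noteq> 0" using entire_lead_exists[OF PQ(2,6)] by blast
  show ?thesis
  proof (cases "m \<noteq> m' \<or> \<not> trivial_pair A B N l")
    case True
    then show ?thesis using good_pair_rlead[OF g A B] by blast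
  next
    case False
    then obtain c j where mm: "m = m'" and cj: "N = l + 4 * j" "\<And>z. A z = c * h0 z ^ j * B z"
      unfolding trivial_pair_def by blast
    define P' where "P' z = P z - c * (h0 z ^ j * Q z)" for z
    have P'0: "\<exists>z. P' z \<noteq> 0"
    proof (rule ccontr)
      assume "\<not> ?thesis"
      then have "\<forall>z. P z = c * h0 z ^ j * Q z" by (simp add: P'_def mult.assoc)
      with nt cj(1) show False unfolding trivial_pair_def by blast
    qed
    have P'h: "curve_hol P' UNIV"
      unfolding P'_def[abs_def] by (intro curve_hol_diff curve_hol_mult curve_hol_power PQ h0_curve_hol curve_hol_const)
    have P'd: "P' (dilate s z) = s^N * P' z" if "s \<noteq> 0" for s z
    proof -
      have "s^(l + 4 * j) = s^l * (s^4)^j" by (simp add: power_add power_mult)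
      then show ?thesis
        unfolding P'_def PQ(7,8)[OF that] h0_dilate cj(1) power_mult_distrib by (simp add: right_diff_distrib mult_ac)
    qed
    have P'c: "const_ratio P' Q"
      unfolding const_ratio_def
    proof (intro allI impI ballI)
      fix T G \<phi> y y'
      assume T: "open T" "connected T" and G: "\<forall>i. (\<lambda>t. G t $ i) holomorphic_on T"
        and G': "\<forall>y\<in>T. \<forall>i. ((\<lambda>t. G t $ i) has_field_derivative \<phi> y * XV (G y) $ i) (at y)"
        and y: "y \<in> T" "y' \<in> T"
      have "P (G y) * Q (G y') = P (G y') * Q (G y)"
        using PQ(3)[unfolded const_ratio_def, rule_format, OF T G[rule_format] G'[rule_format] y] .
      then show "P' (G y) * Q (G y') = P' (G y') * Q (G y)"
        unfolding P'_def h0_const[OF T G' y] by (simp add: algebra_simps)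
    qed
    have g': "good_pair P' Q N l"
      unfolding good_pair_def using P'h P'0 P'd P'c PQ by simp
    obtain m'' A' where A': "lead rw P' m'' A'" "\<exists>z. A' z \<noteq> 0" using entire_lead_exists[OF P'h P'0] by blast
    have "lead rw h0 0 h0" unfolding lead_def h0_def by simp
    then have "lead rw (\<lambda>z. h0 z ^ j * Q z) (0 * j + m') (\<lambda>z. h0 z ^ j * B z)"
      by (intro lead_mult lead_power B(1))
    then have "lead rw (\<lambda>z. c * (h0 z ^ j * Q z)) m' (\<lambda>z. c * (h0 z ^ j * B z))"
      by (intro lead_cmult) simp
    from lead_diff[OF A(1)[unfolded mm] this]
    have "lead rw P' m' (\<lambda>z. A z - c * (h0 z ^ j * B z))"
      unfolding P'_def[abs_def] .
    then have L0: "lead rw P' m' (\<lambda>z. 0)" by (simp add: cj(2) mult.assoc)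
    have "m'' \<noteq> m'"
    proof
      assume "m'' = m'"
      then have "A' = (\<lambda>z. 0)" using lead_unique[OF A'(1)] L0 by blast
      with A'(2) show False by simp
    qed
    then show ?thesis using good_pair_rlead[OF g' A' B] by blast
  qed
qed

end

section \<open>Symmetries of the ratio along planar solutions\<close>

text \<open>A non-zero form composed with an invertible matrix vanishes on finitely many lines only,
  so it may be cancelled from an identity of continuous functions.\<close>

lemma binary_form_cancel:
  assumes h: "binary_form m h" "\<exists>v. h v \<noteq> 0" and X: "mdet X \<noteq> 0"
    and f: "continuous_on UNIV f" and g: "continuous_on UNIV g"
    and eq: "\<And>v. h (app X v) * f v = h (app X v) * g v"
  shows "f v = g v"
proof -
  obtain c as where as: "c \<noteq> 0" "\<forall>a\<in>set as. a \<noteq> 0" "\<forall>v. h v = c * lprod as v"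
    using binary_form_factor[OF h(1)] h(2) by blast
  show ?thesis
  proof (rule eq_off_lines[where as = "map (app (adj X)) as" and f = f and g = g, OF f g])
    show "a \<noteq> 0" if a: "a \<in> set (map (app (adj X)) as)" for a
    proof -
      obtain a0 where "a0 \<in> set as" "a = app (adj X) a0" using a by auto
      then show ?thesis using app_nonzero[of "adj X" a0] X as(2) by simp
    qed
    show "f v = g v" if "lprod (map (app (adj X)) as) v \<noteq> 0" for v
    proof -
      have "h (app X v) \<noteq> 0" using that as(1) unfolding as(3)[rule_format, of "app X v"] lprod_app by simp
      then show ?thesis using eq[of v] by simp
    qed
  qed
qed

lemma continuous_app: "continuous_on UNIV f \<Longrightarrow> continuous_on UNIV (\<lambda>v. f (app X v))"
  by (rule continuous_on_compose2[of UNIV f UNIV "app X"]) (auto simp: app_def[abs_def] intro!: continuous_intros)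

lemma app_id [simp]: "app (Mat2 1 0 0 1) v = v"
  by (simp add: app_def)

text \<open>Dilates p1 alone. At the branch point y = 1, where p1 = 0, both functions of the pair
  may vanish, and their leading terms in p1 take the place of the values.\<close>

abbreviation "pw \<equiv> wt4 0 0 1 0"

lemma continuous_on_if_const:
  "continuous_on S f \<Longrightarrow> continuous_on S g \<Longrightarrow> continuous_on S (\<lambda>x. if P then f x else g x)"
  by (cases P) simp_all

lemma tendsto_if_const:
  "(f \<longlongrightarrow> a) F \<Longrightarrow> (g \<longlongrightarrow> b) F \<Longrightarrow> ((\<lambda>x. if P then f x else g x) \<longlongrightarrow> (if P then a else b)) F"
  by (cases P) simp_all

lemma binary_form_slice:
  assumes A: "curve_hol A UNIV" and hom: "\<And>s z. s \<noteq> 0 \<Longrightarrow> A (scal (wt4 0 1 0 1) s z) = s^m * A z"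
  shows "binary_form m (\<lambda>v. A (vec4 q (a * fst v + b * snd v) p (c * fst v + d * snd v)))"
  unfolding binary_form_def
proof (intro conjI allI impI)
  have "continuous_on UNIV (\<lambda>v::vec2. vec4 q (a * fst v + b * snd v) p (c * fst v + d * snd v))"
    unfolding vec4_def
  proof (rule continuous_on_vec_lambda)
    fix i :: 4
    show "continuous_on UNIV (\<lambda>v::vec2. if i = 1 then q else if i = 2 then a * fst v + b * snd v
        else if i = 3 then p else c * fst v + d * snd v)"
      by (intro continuous_on_if_const continuous_intros)
  qed
  then show "continuous_on UNIV (\<lambda>v. A (vec4 q (a * fst v + b * snd v) p (c * fst v + d * snd v)))"
    by (rule continuous_on_compose2[OF curve_hol_imp_continuous[OF A]]) auto
  fix s :: complex and v :: vec2 assume s: "s \<noteq> 0"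
  have "vec4 q (a * fst (smul s v) + b * snd (smul s v)) p (c * fst (smul s v) + d * snd (smul s v))
      = scal (wt4 0 1 0 1) s (vec4 q (a * fst v + b * snd v) p (c * fst v + d * snd v))"
    unfolding vec4_eq_iff by (simp add: smul_def algebra_simps)
  then show "A (vec4 q (a * fst (smul s v) + b * snd (smul s v)) p (c * fst (smul s v) + d * snd (smul s v)))
      = s^m * A (vec4 q (a * fst v + b * snd v) p (c * fst v + d * snd v))"
    by (simp only: hom[OF s])
next
  show "(\<lambda>w. A (vec4 q (a * fst (1, w) + b * snd (1, w)) p (c * fst (1, w) + d * snd (1, w)))) holomorphic_on UNIV"
  proof (rule curve_hol_compose[OF A open_UNIV _ UNIV_I])
    fix i :: 4
    have "(\<lambda>w. vec4 q (a * 1 + b * w) p (c * 1 + d * w) $ i) holomorphic_on UNIV"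
      using exhaust_4[of i] by (auto intro!: holomorphic_intros)
    then show "(\<lambda>w. vec4 q (a * fst (1, w) + b * snd (1, w)) p (c * fst (1, w) + d * snd (1, w)) $ i) holomorphic_on UNIV"
      by simp
  qed
qed

context phantom
begin

text \<open>On each sheet the quotient of the two forms is independent of y. Comparing y with i y
  links the sheets through \<open>rot4\<close>, and the common end point y = 1 links them through
  the connection matrix. Eliminating one sheet leaves the situation of
  \<open>ratio_symmetric_imp_constant\<close>.\<close>

lemma no_nontrivial_pair:
  assumes gp: "good_pair A B N l"
    and Am: "\<And>s z. s \<noteq> 0 \<Longrightarrow> A (scal rw s z) = s^m * A z" and Bm: "\<And>s z. s \<noteq> 0 \<Longrightarrow> B (scal rw s z) = s^m' * B z"
    and nt: "m \<noteq> m' \<or> \<not> trivial_pair A B N l" and ex: "\<mu> / \<Lambda> \<notin> I1 \<union> I2 \<union> I3"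
  shows False
proof -

  \<comment> \<open>Planar solutions with q1 as independent variable\<close>
  have A: "curve_hol A UNIV" and B: "curve_hol B UNIV" and A0: "\<exists>z. A z \<noteq> 0" and B0: "\<exists>z. B z \<noteq> 0"
    and AB: "const_ratio A B" and lN: "l \<le> N"
    and Ad: "\<And>s z. s \<noteq> 0 \<Longrightarrow> A (dilate s z) = s^N * A z" and Bd: "\<And>s z. s \<noteq> 0 \<Longrightarrow> B (dilate s z) = s^l * B z"
    using gp unfolding good_pair_def by auto
  obtain u1 u2 w1 w2 :: "complex \<Rightarrow> complex" and \<alpha> \<beta> \<gamma> \<delta> :: complex where
    du1: "\<And>y. norm y < 1 \<Longrightarrow> (u1 has_field_derivative w1 y / root4 y) (at y)"
    and dw1: "\<And>y. norm y < 1 \<Longrightarrow> (w1 has_field_derivative - 2 * of_real (\<mu> / \<Lambda>) * y^2 * u1 y / root4 y) (at y)"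
    and du2: "\<And>y. norm y < 1 \<Longrightarrow> (u2 has_field_derivative w2 y / root4 y) (at y)"
    and dw2: "\<And>y. norm y < 1 \<Longrightarrow> (w2 has_field_derivative - 2 * of_real (\<mu> / \<Lambda>) * y^2 * u2 y / root4 y) (at y)"
    and rot: "\<And>y. u1 (\<i> * y) = u1 y" "\<And>y. w1 (\<i> * y) = - \<i> * w1 y" "\<And>y. u2 (\<i> * y) = \<i> * u2 y" "\<And>y. w2 (\<i> * y) = w2 y"
    and wr: "\<And>y. norm y < 1 \<Longrightarrow> u1 y * w2 y - u2 y * w1 y = 1"
    and lims: "((\<lambda>y. u1 (of_real y)) \<longlongrightarrow> \<alpha>) (at_left 1)" "((\<lambda>y. u2 (of_real y)) \<longlongrightarrow> \<beta>) (at_left 1)"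
      "((\<lambda>y. w1 (of_real y)) \<longlongrightarrow> \<gamma>) (at_left 1)" "((\<lambda>y. w2 (of_real y)) \<longlongrightarrow> \<delta>) (at_left 1)"
    and det1: "\<alpha> * \<delta> - \<beta> * \<gamma> = 1"
    and c2: "(\<alpha> * \<delta> + \<beta> * \<gamma>)^2 = 1 + cos (2 * of_real pi * exponent_diff (\<mu> / \<Lambda>))"
  proof (rule variational_solutions[of "\<mu> / \<Lambda>"], goal_cases)
    case (1 u1 u2 w1 w2 \<alpha> \<beta> \<gamma> \<delta>)
    show ?case
      by (rule 1(1)[where ?u1.0 = u1 and ?u2.0 = u2 and ?w1.0 = w1 and ?w2.0 = w2 and \<alpha> = \<alpha> and \<beta> = \<beta> and \<gamma> = \<gamma> and \<delta> = \<delta>])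
         (fact 1)+
  qed
  obtain k where k: "0 \<le> k" "1 + cos (2 * of_real pi * exponent_diff (\<mu> / \<Lambda>)) = of_real k" "k \<notin> {0, 1/2, 1}"
    using ex by (rule_tac exponent_diff_exceptional[of "\<mu> / \<Lambda>"]) blast
  \<comment> \<open>Chosen so that p1^2 = \<omega>^2 (1 - y^4) is the level of planar energy
    \<omega>^2 / 2.\<close>
  define \<omega> where "\<omega> = csqrt (- of_real \<Lambda> / 2)"
  have \<omega>2: "\<omega>^2 = - of_real \<Lambda> / 2" by (simp add: \<omega>_def)
  have \<omega>0: "\<omega> \<noteq> 0" using \<omega>2 Lambda_nonzero by auto
  \<comment> \<open>The solution of the linearised system over the sheet \<epsilon> = 1 or -1, with
    transverse initial data \<open>v\<close>; its time parametrisation is dt/dy = 1/p1.\<close>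
  define \<Gamma> where "\<Gamma> \<epsilon> v y = vec4 y (u1 y * fst v + u2 y * snd v) (\<epsilon> * \<omega> * root4 y)
     ((\<epsilon> * \<omega> * w1 y) * fst v + (\<epsilon> * \<omega> * w2 y) * snd v)" for \<epsilon> v y
  have i1: "norm (\<i> * y) < 1 \<longleftrightarrow> norm y < 1" for y by (simp add: norm_mult)
  have dG: "((\<lambda>y. \<Gamma> \<epsilon> v y $ i) has_field_derivative (1 / (\<epsilon> * \<omega> * root4 y)) * XV (\<Gamma> \<epsilon> v y) $ i) (at y)"
    if \<epsilon>: "\<epsilon>^2 = 1" and y: "norm y < 1" for \<epsilon> v y i
  proof -
    have \<epsilon>0: "\<epsilon> \<noteq> 0" using \<epsilon> by auto
    note r0 = root4_nonzero[OF y]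
    have eq: "(\<epsilon> * \<omega>)^2 = - of_real \<Lambda> / 2" using \<epsilon> \<omega>2 by (simp add: power_mult_distrib)
    have L: "of_real \<Lambda> = - 2 * (\<epsilon> * \<omega>)^2" unfolding eq by simp
    have Mu: "of_real \<mu> = - 2 * (\<epsilon> * \<omega>)^2 * of_real (\<mu> / \<Lambda>)"
      unfolding L[symmetric] using Lambda_nonzero by simp
    define e where "e = \<epsilon> * \<omega>"
    have e0: "e \<noteq> 0" using \<epsilon>0 \<omega>0 by (simp add: e_def)
    have 1: "((\<lambda>y. y) has_field_derivative 1 / (e * root4 y) * (e * root4 y)) (at y)"
      using e0 r0 by simp
    have 2: "((\<lambda>y. u1 y * fst v + u2 y * snd v) has_field_derivative 1 / (e * root4 y) * ((e * w1 y) * fst v + (e * w2 y) * snd v)) (at y)"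
      by (rule DERIV_cong[OF DERIV_add[OF DERIV_cmult_right[OF du1[OF y]] DERIV_cmult_right[OF du2[OF y]]]])
         (use e0 r0 in \<open>simp add: field_simps\<close>)
    have 3: "((\<lambda>y. e * root4 y) has_field_derivative 1 / (e * root4 y) * ((- 2 * e^2) * y^3)) (at y)"
      by (rule DERIV_cong[OF DERIV_cmult[OF root4_deriv[OF y]]])
         (use e0 r0 in \<open>simp add: field_simps power2_eq_square\<close>)
    have 4: "((\<lambda>y. (e * w1 y) * fst v + (e * w2 y) * snd v) has_field_derivative
        1 / (e * root4 y) * ((- 2 * e^2 * of_real (\<mu> / \<Lambda>)) * y^2 * (u1 y * fst v + u2 y * snd v))) (at y)"
      by (rule DERIV_cong[OF DERIV_add[OF DERIV_cmult_right[OF DERIV_cmult[OF dw1[OF y]]] DERIV_cmult_right[OF DERIV_cmult[OF dw2[OF y]]]]])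
         (use e0 r0 Lambda_nonzero in \<open>simp add: field_simps power2_eq_square\<close>)
    show ?thesis
      using exhaust_4[of i] 1 2 3 4
      unfolding \<Gamma>_def XV_def e_def[symmetric] L[folded e_def] Mu[folded e_def] by (auto simp: mult_ac)
  qed
  have hG: "(\<lambda>y. \<Gamma> \<epsilon> v y $ i) holomorphic_on ball 0 1" if "\<epsilon>^2 = 1" for \<epsilon> v i
    unfolding holomorphic_on_open[OF open_ball]
  proof
    fix y :: complex assume "y \<in> ball 0 1"
    then have "norm y < 1" by simp
    from dG[OF that this] show "\<exists>D. ((\<lambda>y. \<Gamma> \<epsilon> v y $ i) has_field_derivative D) (at y)" by (rule exI)
  qed
  have ratio: "A (\<Gamma> \<epsilon> v y) * B (\<Gamma> \<epsilon> v y') = A (\<Gamma> \<epsilon> v y') * B (\<Gamma> \<epsilon> v y)"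
    if "\<epsilon>^2 = 1" "norm y < 1" "norm y' < 1" for \<epsilon> v y y'
    using AB[unfolded const_ratio_def, rule_format, of "ball 0 1" "\<lambda>y. \<Gamma> \<epsilon> v y" "\<lambda>y. 1 / (\<epsilon> * \<omega> * root4 y)" y y']
      hG[OF that(1)] dG[OF that(1)] that(2,3) by auto
  define f g where "f \<epsilon> y v = A (\<Gamma> \<epsilon> v y)" and "g \<epsilon> y v = B (\<Gamma> \<epsilon> v y)" for \<epsilon> y and v :: vec2
  have bf: "binary_form m (f \<epsilon> y)" and bg: "binary_form m' (g \<epsilon> y)" for \<epsilon> y
    unfolding f_def[abs_def] g_def[abs_def] \<Gamma>_def
    by (rule binary_form_slice[OF A Am], assumption, rule binary_form_slice[OF B Bm], assumption)
  have cf: "continuous_on UNIV (f \<epsilon> y)" and cg: "continuous_on UNIV (g \<epsilon> y)" for \<epsilon> y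
    using bf bg unfolding binary_form_def by auto
  have one2: "(1::complex)^2 = 1" "(- 1::complex)^2 = 1" by simp_all

  \<comment> \<open>The curves \<open>\<Gamma> 1 v y\<close> and their dilations fill a
    neighbourhood of (0, 0, \<omega>, 0), so a quasi-homogeneous entire function vanishing on the
    curves vanishes everywhere.\<close>
  have slice_identity: "E z = 0"
    if E: "curve_hol E UNIV" and Eh: "\<And>s z. s \<noteq> 0 \<Longrightarrow> E (dilate s z) = s^n * E z"
      and E0: "\<And>v y. norm y < 1 \<Longrightarrow> E (\<Gamma> 1 v y) = 0" for E n z
  proof -
    \<comment> \<open>D equals 2 h0 / \<omega>^2, and s with s^4 D = 1 scales \<open>z\<close> to
      the energy of the curves. The later condition on the real part selects the sheet of the
      principal root.\<close>
    define D where "D z = (z$3 / \<omega>)^2 + z$1^4" for z :: "complex^4"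
    define s where "s z = csqrt (csqrt (1 / D z))" for z
    define a where "a = vec4 0 0 \<omega> 0"
    have Da: "D a = 1" using \<omega>0 by (simp add: D_def a_def)
    have cD: "(D \<longlongrightarrow> D a) (nhds a)"
      unfolding D_def[abs_def] by (intro tendsto_intros filterlim_ident \<omega>0)
    have nn: "(1::complex) \<notin> \<real>\<^sub>\<le>\<^sub>0" by simp
    have "((\<lambda>z. 1 / D z) \<longlongrightarrow> 1 / 1) (nhds a)" using cD unfolding Da by (intro tendsto_intros) auto
    then have "((\<lambda>z. csqrt (1 / D z)) \<longlongrightarrow> csqrt (1 / 1)) (nhds a)"
      by (rule isCont_tendsto_compose[rotated]) (use continuous_at_csqrt[of 1] in simp)
    then have cs: "(s \<longlongrightarrow> csqrt (csqrt (1 / 1))) (nhds a)"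
      unfolding s_def[abs_def] by (rule isCont_tendsto_compose[rotated]) (use continuous_at_csqrt[of 1] in simp)
    then have cs: "(s \<longlongrightarrow> 1) (nhds a)" by simp
    have n: "((\<lambda>z. z $ i) \<longlongrightarrow> a $ i) (nhds a)" for i by (intro tendsto_intros filterlim_ident)
    have l1: "((\<lambda>z. norm (s z * z$1)) \<longlongrightarrow> norm (1 * a$1)) (nhds a)" by (intro tendsto_intros cs n)
    have l2: "((\<lambda>z. Re (s z ^ 2 * (z$3 / \<omega>))) \<longlongrightarrow> Re (1 ^ 2 * (a$3 / \<omega>))) (nhds a)" by (intro tendsto_intros cs n \<omega>0)
    have "\<forall>\<^sub>F z in nhds a. D z \<noteq> 0" using cD unfolding Da by (rule tendsto_imp_eventually_ne) simp
    moreover have "\<forall>\<^sub>F z in nhds a. norm (s z * z$1) < 1"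
      by (rule order_tendstoD(2)[OF l1]) (simp add: a_def)
    moreover have "\<forall>\<^sub>F z in nhds a. 0 < Re (s z ^ 2 * (z$3 / \<omega>))"
      by (rule order_tendstoD(1)[OF l2]) (use \<omega>0 in \<open>simp add: a_def\<close>)
    ultimately have "\<forall>\<^sub>F z in nhds a. D z \<noteq> 0 \<and> norm (s z * z$1) < 1 \<and> 0 < Re (s z ^ 2 * (z$3 / \<omega>))"
      by (intro eventually_conj)
    then obtain U where O: "open U" "a \<in> U"
      "\<And>z. z \<in> U \<Longrightarrow> D z \<noteq> 0 \<and> norm (s z * z$1) < 1 \<and> 0 < Re (s z ^ 2 * (z$3 / \<omega>))"
      unfolding eventually_nhds by blast
    have "E x = 0" if x: "x \<in> U" for x
    proof -
      define y where "y = s x * x$1"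
      define t where "t = s x ^ 2 * (x$3 / \<omega>)"
      have c: "D x \<noteq> 0" "norm y < 1" "0 < Re t" using O(3)[OF x] by (auto simp: y_def t_def)
      have s2: "s x ^ 2 = csqrt (1 / D x)" by (simp add: s_def)
      have s4: "s x ^ 4 * D x = 1"
      proof -
        have "s x ^ 4 = (s x ^ 2)^2" by simp
        also have "\<dots> = 1 / D x" unfolding s2 by simp
        finally show ?thesis using c(1) by simp
      qed
      have s0: "s x \<noteq> 0" using s4 by auto
      have "t^2 = s x ^ 4 * (x$3 / \<omega>)^2" unfolding t_def power_mult_distrib by simp
      also have "\<dots> = s x ^ 4 * D x - (s x * x$1)^4" by (simp add: D_def power_mult_distrib algebra_simps)
      finally have t2: "t^2 = 1 - y^4" unfolding s4 y_def .
      have "root4 y = csqrt (t^2)" unfolding root4_def t2 ..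
      also have "\<dots> = t" by (rule csqrt_square) (use c(3) in simp)
      finally have rt: "root4 y = t" .
      define p q where "p = s x ^ 2 * x$2" and "q = s x ^ 3 * x$4 / \<omega>"
      \<comment> \<open>Cramer's rule for the initial data; the determinant is the Wronskian
        1.\<close>
      define v where "v = (w2 y * p - u2 y * q, u1 y * q - w1 y * p)"
      have W: "u1 y * w2 y - u2 y * w1 y = 1" by (rule wr[OF c(2)])
      have "u1 y * fst v + u2 y * snd v = (u1 y * w2 y - u2 y * w1 y) * p" by (simp add: v_def algebra_simps)
      then have v1: "u1 y * fst v + u2 y * snd v = p" unfolding W by simp
      have "w1 y * fst v + w2 y * snd v = (u1 y * w2 y - u2 y * w1 y) * q" by (simp add: v_def algebra_simps)
      then have v2: "w1 y * fst v + w2 y * snd v = q" unfolding W by simp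
      have "\<omega> * w1 y * fst v + \<omega> * w2 y * snd v = \<omega> * (w1 y * fst v + w2 y * snd v)" by (simp add: algebra_simps)
      then have v3: "\<omega> * w1 y * fst v + \<omega> * w2 y * snd v = s x ^ 3 * x$4" unfolding v2 q_def using \<omega>0 by simp
      have "dilate (s x) x = \<Gamma> 1 v y"
        unfolding vec4_eq_iff \<Gamma>_def scal_nth vec4_nth wt4_simps mult_1 v1 v3 rt
        using \<omega>0 by (simp add: y_def p_def t_def)
      then have "E (dilate (s x) x) = 0" using E0[OF c(2)] by simp
      then show ?thesis unfolding Eh[OF s0] using s0 by simp
    qed
    then show ?thesis by (rule curve_hol_identity[OF E O(1,2)])
  qed

  have h0G: "h0 (\<Gamma> 1 v y) = \<omega>^2 / 2" for v y
  proof -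
    have "h0 (\<Gamma> 1 v y) = \<omega>^2 * root4 y ^ 2 / 2 - of_real \<Lambda> / 4 * y^4"
      unfolding h0_def \<Gamma>_def by (simp add: power_mult_distrib)
    also have "of_real \<Lambda> = - 2 * \<omega>^2" unfolding \<omega>2 by simp
    finally show ?thesis unfolding root4_sq by (simp add: field_simps)
  qed

  \<comment> \<open>The rotation y -> i y is \<open>dilate \<i>\<close> followed by the transverse
    dilation by -1; these are the factors that A and B acquire. As \<open>dilate \<i>\<close> sends
    p1 to -p1, the two sheets are exchanged.\<close>
  define a b where "a = \<i>^N * (-1)^m" and "b = \<i>^l * (-1)^m'"
  have ab0: "a \<noteq> 0" "b \<noteq> 0" by (simp_all add: a_def b_def)
  have Grot: "\<Gamma> \<epsilon> v (\<i> * y) = scal rw (-1) (dilate \<i> (\<Gamma> (- \<epsilon>) (app rot4 v) y))" for \<epsilon> v y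
  proof -
    have "\<i>^4 = 1" by (simp add: power4_eq_xxxx)
    then have "(\<i> * y)^4 = y^4" by (simp add: power_mult_distrib)
    then have "root4 (\<i> * y) = root4 y" by (simp add: root4_def)
    then show ?thesis
      unfolding vec4_eq_iff \<Gamma>_def rot by (simp add: app_def rot4_def power3_eq_cube algebra_simps)
  qed
  have frot: "f \<epsilon> (\<i> * y) v = a * f (- \<epsilon>) y (app rot4 v)" and grot: "g \<epsilon> (\<i> * y) v = b * g (- \<epsilon>) y (app rot4 v)" for \<epsilon> y v
    unfolding f_def g_def Grot a_def b_def using Am[of "- 1"] Bm[of "- 1"] Ad[of \<i>] Bd[of \<i>] by (simp_all add: mult_ac)

  obtain vs ys where vy: "norm ys < 1" "A (\<Gamma> 1 vs ys) * B (\<Gamma> 1 vs ys) \<noteq> 0"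
  proof (rule ccontr)
    assume "\<not> thesis"
    with that have *: "\<And>v y. norm y < 1 \<Longrightarrow> A (\<Gamma> 1 v y) * B (\<Gamma> 1 v y) = 0" by blast
    obtain z where "A z * B z \<noteq> 0" using curve_hol_mult_zero[OF A B] A0 B0 by blast
    moreover have "A z * B z = 0"
    proof (rule slice_identity[where E = "\<lambda>z. A z * B z" and n = "N + l", OF curve_hol_mult[OF A B]])
      show "A (dilate s z) * B (dilate s z) = s^(N + l) * (A z * B z)" if "s \<noteq> 0" for s z
        unfolding Ad[OF that] Bd[OF that] power_add by (simp add: mult_ac)
    qed (rule *)
    ultimately show False by simp
  qed
  define \<theta> where "\<theta> y = A (\<Gamma> 1 vs y) * B (\<Gamma> 1 vs y)" for y
  have \<theta>hol: "\<theta> holomorphic_on ball 0 1"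
    unfolding \<theta>_def
    by (intro holomorphic_on_mult curve_hol_compose[OF A open_ball hG[OF one2(1)] UNIV_I]
      curve_hol_compose[OF B open_ball hG[OF one2(1)] UNIV_I])
  \<comment> \<open>The value at i y is the value on the other sheet over y, so such a point makes
    the forms on both sheets non-zero at one common base point.\<close>
  have "\<exists>y. norm y < 1 \<and> \<theta> y \<noteq> 0 \<and> \<theta> (\<i> * y) \<noteq> 0"
  proof (rule ccontr)
    assume "\<not> ?thesis"
    then have *: "\<theta> (\<i> * y) = 0" if "norm y < 1" "\<theta> y \<noteq> 0" for y using that by blast
    define V where "V = ball 0 1 \<inter> \<theta> -` (- {0})"
    have V: "open V" unfolding V_def
      by (rule continuous_open_preimage[OF holomorphic_on_imp_continuous_on[OF \<theta>hol]]) auto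
    have "ys \<in> V" using vy by (simp add: V_def \<theta>_def)
    then have V0: "V \<noteq> {}" by blast
    have hol: "(\<lambda>y. \<theta> (\<i> * y)) holomorphic_on ball 0 1"
      by (rule holomorphic_on_compose_gen[of "\<lambda>y. \<i> * y" "ball 0 1" \<theta> "ball 0 1", unfolded o_def])
         (use \<theta>hol in \<open>auto simp: norm_mult intro!: holomorphic_intros\<close>)
    have "(\<lambda>y. \<theta> (\<i> * y)) (- \<i> * ys) = 0"
    proof (rule analytic_continuation_open[OF V open_ball V0 _ _ hol holomorphic_on_const])
      show "connected (ball (0::complex) 1)" by simp
      show "V \<subseteq> ball 0 1" by (auto simp: V_def)
      show "\<theta> (\<i> * y) = 0" if "y \<in> V" for y using * that by (simp add: V_def)
      show "- \<i> * ys \<in> ball 0 1" using vy(1) by (simp add: norm_mult)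
    qed
    then have "\<theta> ys = 0" by (simp flip: mult.assoc)
    with vy(2) show False by (simp add: \<theta>_def)
  qed
  then obtain y0 where y0: "norm y0 < 1" "\<theta> y0 \<noteq> 0" "\<theta> (\<i> * y0) \<noteq> 0" by blast
  have y0i: "norm (\<i> * y0) < 1" using y0(1) i1 by blast
  have fp0: "f 1 y0 vs \<noteq> 0" and gp0: "g 1 y0 vs \<noteq> 0" using y0(2) by (auto simp: \<theta>_def f_def g_def)
  have "g 1 (\<i> * y0) vs \<noteq> 0" using y0(3) by (auto simp: \<theta>_def g_def)
  then have gm0: "g (- 1) y0 (app rot4 vs) \<noteq> 0" unfolding grot by auto

  \<comment> \<open>\<open>M\<close> takes initial data at y = 0 to values at y = 1, and
    \<open>J\<close> expresses that the sheets differ there in the sign of the transverse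
    momentum.\<close>
  define M where "M = Mat2 \<alpha> \<beta> \<gamma> \<delta>"
  define J where "J = Mat2 1 0 0 (- 1)"
  \<comment> \<open>This is the inverse of M times J M, written out using det M = 1.\<close>
  define T where "T = Mat2 (\<alpha> * \<delta> + \<beta> * \<gamma>) (2 * \<beta> * \<delta>) (- 2 * \<alpha> * \<gamma>) (- (\<alpha> * \<delta> + \<beta> * \<gamma>))"
  have detM: "mdet M \<noteq> 0" using det1 by (simp add: M_def mdet_def)
  have detJ: "mdet J \<noteq> 0" by (simp add: J_def mdet_def)
  have detS: "mdet rot4 \<noteq> 0" by (simp add: rot4_def mdet_def)
  have MT: "app M (app T v) = app J (app M v)" for v
  proof -
    have "app M (app T v) = smul (\<alpha> * \<delta> - \<beta> * \<gamma>) (app J (app M v))"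
      by (simp add: app_def M_def T_def J_def smul_def algebra_simps)
    then show ?thesis unfolding det1 by simp
  qed

  obtain d Ah where Ah: "lead pw A d Ah" "\<exists>z. Ah z \<noteq> 0" using entire_lead_exists[OF A A0] by blast
  obtain d' Bh where Bh: "lead pw B d' Bh" "\<exists>z. Bh z \<noteq> 0" using entire_lead_exists[OF B B0] by blast
  have Ahc: "curve_hol Ah UNIV" and Bhc: "curve_hol Bh UNIV"
    using lead_curve_hol[OF A dilatable_UNIV Ah(1)] lead_curve_hol[OF B dilatable_UNIV Bh(1)] .
  define F1 G1 where "F1 v = Ah (vec4 1 (1 * fst v + 0 * snd v) 1 (0 * fst v + \<omega> * snd v))"
    and "G1 v = Bh (vec4 1 (1 * fst v + 0 * snd v) 1 (0 * fst v + \<omega> * snd v))" for v :: vec2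
  have bF1: "binary_form m F1" and bG1: "binary_form m' G1"
    unfolding F1_def[abs_def] G1_def[abs_def]
    using binary_form_slice[OF Ahc lead_homogeneous_other[OF Ah(1) Am]]
      binary_form_slice[OF Bhc lead_homogeneous_other[OF Bh(1) Bm]] by blast+
  \<comment> \<open>A point with q1 and p1 non-zero can be moved to q1 = p1 = 1 by
    \<open>dilate\<close> and \<open>pw\<close> together, and the leading term is homogeneous for
    both; so its slice there is not identically zero.\<close>
  have end_nonzero: "\<exists>v. P' (vec4 1 (1 * fst v + 0 * snd v) 1 (0 * fst v + \<omega> * snd v)) \<noteq> 0"
    if L: "lead pw P n P'" "\<exists>z. P' z \<noteq> 0" and P: "curve_hol P UNIV" and Pd: "\<And>s z. s \<noteq> 0 \<Longrightarrow> P (dilate s z) = s^n' * P z"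
    for P P' n n'
  proof -
    have P'c: "curve_hol P' UNIV" by (rule lead_curve_hol[OF P dilatable_UNIV L(1)])
    have z13: "curve_hol (\<lambda>z. z$1 * z$3) UNIV" by (intro curve_hol_mult curve_hol_nth)
    have "vec4 1 0 1 0 $ 1 * vec4 1 0 1 0 $ 3 \<noteq> 0" by simp
    then obtain z where z: "P' z * (z$1 * z$3) \<noteq> 0"
      using curve_hol_mult_zero[OF P'c z13] L(2) by blast
    then have z0: "z$1 \<noteq> 0" "z$3 \<noteq> 0" "P' z \<noteq> 0" by auto
    define s where "s = 1 / z$1"
    define c where "c = 1 / (s^2 * z$3)"
    have s0: "s \<noteq> 0" and c0: "c \<noteq> 0" using z0 by (simp_all add: s_def c_def)
    have "P' (scal pw c (dilate s z)) = c^n * (s^n' * P' z)"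
      using lead_homogeneous[OF L(1) c0] lead_homogeneous_other[OF L(1) Pd[OF s0]] by simp
    then have "P' (scal pw c (dilate s z)) \<noteq> 0" using z0 s0 c0 by simp
    moreover have "scal pw c (dilate s z) = vec4 1 (s^2 * z$2) 1 (s^3 * z$4)"
      unfolding vec4_eq_iff using z0 by (simp add: c_def s_def)
    ultimately show ?thesis using \<omega>0
      by (intro exI[of _ "(s^2 * z$2, s^3 * z$4 / \<omega>)"]) simp
  qed
  have F10: "\<exists>v. F1 v \<noteq> 0" unfolding F1_def by (rule end_nonzero[OF Ah A Ad])
  have G10: "\<exists>v. G1 v \<noteq> 0" unfolding G1_def by (rule end_nonzero[OF Bh B Bd])

  \<comment> \<open>The limit at the branch point y = 1\<close>
  define q where "q \<epsilon> y = \<epsilon> * \<omega> * root4 (of_real y)" for \<epsilon> and y :: real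
  have q0: "(q \<epsilon> \<longlongrightarrow> 0) (at_left 1)" for \<epsilon>
  proof -
    have "(q \<epsilon> \<longlongrightarrow> \<epsilon> * \<omega> * 0) (at_left 1)" unfolding q_def[abs_def] by (intro tendsto_intros root4_tendsto)
    then show ?thesis by simp
  qed
  have unit: "\<forall>\<^sub>F y in at_left (1::real). norm (complex_of_real y) < 1"
    using eventually_unit_at_left by (rule eventually_mono) simp
  have qne: "\<forall>\<^sub>F y in at_left 1. q \<epsilon> y \<noteq> 0" if "\<epsilon>^2 = 1" for \<epsilon>
    using unit by (rule eventually_mono) (use that \<omega>0 root4_nonzero in \<open>auto simp: q_def\<close>)
  \<comment> \<open>\<open>\<Gamma> \<epsilon> v y\<close> is the \<open>pw\<close> dilation, by the
    factor p1, of a point that converges as y tends to 1. The uniformity in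
    \<open>lead_bound\<close> allows the dilated point to move with y.\<close>
  have end_limit: "((\<lambda>y. P (\<Gamma> \<epsilon> v (of_real y)) / q \<epsilon> y ^ n) \<longlongrightarrow>
      P' (vec4 1 (\<alpha> * fst v + \<beta> * snd v) 1 (\<epsilon> * \<omega> * (\<gamma> * fst v + \<delta> * snd v)))) (at_left 1)"
    if L: "lead pw P n P'" and P: "curve_hol P UNIV" and \<epsilon>: "\<epsilon>^2 = 1" for P P' n \<epsilon> v
  proof -
    define z where "z y = vec4 (of_real y) (u1 (of_real y) * fst v + u2 (of_real y) * snd v) 1
       ((\<epsilon> * \<omega> * w1 (of_real y)) * fst v + (\<epsilon> * \<omega> * w2 (of_real y)) * snd v)" for y :: real
    define z1 where "z1 = vec4 (of_real 1) (\<alpha> * fst v + \<beta> * snd v) 1 ((\<epsilon> * \<omega> * \<gamma>) * fst v + (\<epsilon> * \<omega> * \<delta>) * snd v)"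
    have zl: "(z \<longlongrightarrow> z1) (at_left 1)"
      unfolding z_def[abs_def] z1_def vec4_def
    proof (rule tendsto_vec_lambda)
      fix i :: 4
      show "((\<lambda>y. if i = 1 then complex_of_real y else if i = 2 then u1 (of_real y) * fst v + u2 (of_real y) * snd v
          else if i = 3 then 1 else (\<epsilon> * \<omega> * w1 (of_real y)) * fst v + (\<epsilon> * \<omega> * w2 (of_real y)) * snd v) \<longlongrightarrow>
          (if i = 1 then of_real 1 else if i = 2 then \<alpha> * fst v + \<beta> * snd v else if i = 3 then 1
           else (\<epsilon> * \<omega> * \<gamma>) * fst v + (\<epsilon> * \<omega> * \<delta>) * snd v)) (at_left 1)"
        by (intro tendsto_if_const tendsto_intros lims)
    qed
    have Gz: "\<Gamma> \<epsilon> v (of_real y) = scal pw (q \<epsilon> y) (z y)" for y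
      unfolding vec4_eq_iff \<Gamma>_def z_def q_def by simp
    have P'c: "curve_hol P' UNIV" by (rule lead_curve_hol[OF P dilatable_UNIV L])
    have P'l: "((\<lambda>y. P' (z y)) \<longlongrightarrow> P' z1) (at_left 1)"
      by (rule continuous_on_tendsto_compose[OF curve_hol_imp_continuous[OF P'c] zl]) auto
    obtain S C where SC: "S > 0" "C \<ge> 0" "\<And>x s. norm x \<le> norm z1 + 1 \<Longrightarrow> norm s \<le> S \<Longrightarrow>
        norm (P (scal pw s x) - P' x * s^n) \<le> C * norm s ^ Suc n"
      using lead_bound[OF P dilatable_UNIV L, of "norm z1 + 1"] by blast
    have "\<forall>\<^sub>F y in at_left 1. norm (z y) < norm z1 + 1"
      by (rule order_tendstoD(2)[OF tendsto_norm[OF zl]]) simp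
    moreover have "\<forall>\<^sub>F y in at_left 1. norm (q \<epsilon> y) < S"
      by (rule order_tendstoD(2)[OF tendsto_norm[OF q0]]) (use SC in simp)
    ultimately have "\<forall>\<^sub>F y in at_left 1. norm (P (\<Gamma> \<epsilon> v (of_real y)) / q \<epsilon> y ^ n - P' (z y)) \<le> C * norm (q \<epsilon> y)"
      using qne[OF \<epsilon>]
    proof eventually_elim
      case (elim y)
      have "P (\<Gamma> \<epsilon> v (of_real y)) / q \<epsilon> y ^ n - P' (z y) = (P (scal pw (q \<epsilon> y) (z y)) - P' (z y) * q \<epsilon> y ^ n) / q \<epsilon> y ^ n"
        unfolding Gz using elim by (simp add: field_simps)
      then have "norm (P (\<Gamma> \<epsilon> v (of_real y)) / q \<epsilon> y ^ n - P' (z y)) = norm (P (scal pw (q \<epsilon> y) (z y)) - P' (z y) * q \<epsilon> y ^ n) / norm (q \<epsilon> y) ^ n"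
        by (simp add: norm_divide norm_power)
      also have "\<dots> \<le> C * norm (q \<epsilon> y) ^ Suc n / norm (q \<epsilon> y) ^ n"
        using SC(3)[of "z y" "q \<epsilon> y"] elim by (intro divide_right_mono) auto
      also have "\<dots> = C * norm (q \<epsilon> y)" using elim by simp
      finally show ?case .
    qed
    moreover have "((\<lambda>y. C * norm (q \<epsilon> y)) \<longlongrightarrow> C * norm (0::complex)) (at_left 1)" by (intro tendsto_intros q0)
    then have "((\<lambda>y. C * norm (q \<epsilon> y)) \<longlongrightarrow> 0) (at_left 1)" by simp
    ultimately have "((\<lambda>y. P (\<Gamma> \<epsilon> v (of_real y)) / q \<epsilon> y ^ n - P' (z y)) \<longlongrightarrow> 0) (at_left 1)"
      by (rule Lim_null_comparison)
    from tendsto_add[OF this P'l] have "((\<lambda>y. P (\<Gamma> \<epsilon> v (of_real y)) / q \<epsilon> y ^ n) \<longlongrightarrow> P' z1) (at_left 1)" by simp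
    moreover have "z1 = vec4 1 (\<alpha> * fst v + \<beta> * snd v) 1 (\<epsilon> * \<omega> * (\<gamma> * fst v + \<delta> * snd v))"
      unfolding z1_def vec4_eq_iff by (simp add: algebra_simps)
    ultimately show ?thesis by (simp only:)
  qed
  define Je where "Je \<epsilon> v = (fst v, \<epsilon> * snd v)" for \<epsilon> and v :: vec2
  have Alim: "((\<lambda>y. A (\<Gamma> \<epsilon> v (of_real y)) / q \<epsilon> y ^ d) \<longlongrightarrow> F1 (Je \<epsilon> (app M v))) (at_left 1)"
    and Blim: "((\<lambda>y. B (\<Gamma> \<epsilon> v (of_real y)) / q \<epsilon> y ^ d') \<longlongrightarrow> G1 (Je \<epsilon> (app M v))) (at_left 1)" if "\<epsilon>^2 = 1" for \<epsilon> v
    using end_limit[OF Ah(1) A that, of v] end_limit[OF Bh(1) B that, of v]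
    by (simp_all add: F1_def G1_def Je_def app_def M_def mult_ac)
  have Je1: "Je 1 v = v" "Je (-1) v = app J v" for v by (simp_all add: Je_def J_def app_def)
  have ratio_end: "f \<epsilon> y0 v * (B (\<Gamma> \<epsilon> v (of_real y)) / q \<epsilon> y ^ i) = (A (\<Gamma> \<epsilon> v (of_real y)) / q \<epsilon> y ^ i) * g \<epsilon> y0 v"
    if "\<epsilon>^2 = 1" "norm (complex_of_real y) < 1" for \<epsilon> v y i
    using ratio[OF that(1) y0(1) that(2), of v] by (simp add: f_def g_def)
  have fg0: "binary_form m (f 1 y0)" "\<exists>v. f 1 y0 v \<noteq> 0" "binary_form m' (g 1 y0)" "\<exists>v. g 1 y0 v \<noteq> 0"
    "binary_form m' (g (-1) y0)" "\<exists>v. g (-1) y0 v \<noteq> 0"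
    using bf bg fp0 gp0 gm0 by blast+
  have cF1: "continuous_on UNIV F1" and cG1: "continuous_on UNIV G1" using bF1 bG1 unfolding binary_form_def by auto
  have id1: "mdet (Mat2 1 0 0 1) \<noteq> 0" by (simp add: mdet_def)
  have c0: "continuous_on UNIV (\<lambda>v::vec2. 0::complex)" by (rule continuous_on_const)
  \<comment> \<open>Different orders in p1 would force the constant quotient along generic curves to
    be 0 or infinity at y = 1, against the non-vanishing forms at y0.\<close>
  have dd: "d = d'"
  proof (rule linorder_cases[of d d'])
    assume "d < d'"
    then have e: "0 < d' - d" "d' = d + (d' - d)" by auto
    have "F1 (app M v) * g 1 y0 v = 0" for v
    proof -
      have "((\<lambda>y. f 1 y0 v * (B (\<Gamma> 1 v (of_real y)) / q 1 y ^ d') * q 1 y ^ (d' - d)) \<longlongrightarrow> f 1 y0 v * G1 (Je 1 (app M v)) * 0 ^ (d' - d)) (at_left 1)"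
        by (intro tendsto_mult tendsto_power tendsto_const Blim one2 q0)
      moreover have "\<forall>\<^sub>F y in at_left 1. f 1 y0 v * (B (\<Gamma> 1 v (of_real y)) / q 1 y ^ d') * q 1 y ^ (d' - d) = (A (\<Gamma> 1 v (of_real y)) / q 1 y ^ d) * g 1 y0 v"
        using unit qne[OF one2(1)]
      proof eventually_elim
        case (elim y)
        have h: "B (\<Gamma> 1 v (of_real y)) / q 1 y ^ d' * q 1 y ^ (d' - d) = B (\<Gamma> 1 v (of_real y)) / q 1 y ^ d"
          using elim by (subst e(2)) (simp add: power_add)
        show ?case by (simp only: mult.assoc h ratio_end[OF one2(1) elim(1), of v d])
      qed
      ultimately have l: "((\<lambda>y. (A (\<Gamma> 1 v (of_real y)) / q 1 y ^ d) * g 1 y0 v) \<longlongrightarrow> f 1 y0 v * G1 (Je 1 (app M v)) * 0 ^ (d' - d)) (at_left 1)"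
        by (rule Lim_transform_eventually)
      have "((\<lambda>y. (A (\<Gamma> 1 v (of_real y)) / q 1 y ^ d) * g 1 y0 v) \<longlongrightarrow> F1 (Je 1 (app M v)) * g 1 y0 v) (at_left 1)"
        by (intro tendsto_mult tendsto_const Alim one2)
      from tendsto_unique[OF trivial_limit_at_left_real this l] show ?thesis using e(1) by (simp add: Je1)
    qed
    then have "F1 (app M v) * g 1 y0 v = F1 (app M v) * 0" for v by simp
    from binary_form_cancel[OF bF1 F10 detM cg c0 this] gp0 show ?thesis by blast
  next
    assume "d' < d"
    then have e: "0 < d - d'" "d = d' + (d - d')" by auto
    have z: "(0::complex) ^ (d - d') = 0" using e(1) by (rule zero_power)
    have "G1 (app M v) * f 1 y0 v = 0" for v
    proof -
      have "((\<lambda>y. (A (\<Gamma> 1 v (of_real y)) / q 1 y ^ d) * g 1 y0 v * q 1 y ^ (d - d')) \<longlongrightarrow> F1 (Je 1 (app M v)) * g 1 y0 v * 0 ^ (d - d')) (at_left 1)"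
        by (intro tendsto_mult tendsto_power tendsto_const Alim one2 q0)
      moreover have "\<forall>\<^sub>F y in at_left 1. (A (\<Gamma> 1 v (of_real y)) / q 1 y ^ d) * g 1 y0 v * q 1 y ^ (d - d') = f 1 y0 v * (B (\<Gamma> 1 v (of_real y)) / q 1 y ^ d')"
        using unit qne[OF one2(1)]
      proof eventually_elim
        case (elim y)
        have h: "A (\<Gamma> 1 v (of_real y)) / q 1 y ^ d * q 1 y ^ (d - d') = A (\<Gamma> 1 v (of_real y)) / q 1 y ^ d'"
          using elim by (subst e(2)) (simp add: power_add)
        have "A (\<Gamma> 1 v (of_real y)) / q 1 y ^ d * g 1 y0 v * q 1 y ^ (d - d')
            = A (\<Gamma> 1 v (of_real y)) / q 1 y ^ d * q 1 y ^ (d - d') * g 1 y0 v" by (simp only: mult_ac)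
        also have "\<dots> = f 1 y0 v * (B (\<Gamma> 1 v (of_real y)) / q 1 y ^ d')"
          unfolding h by (rule ratio_end[OF one2(1) elim(1), symmetric])
        finally show ?case .
      qed
      ultimately have l: "((\<lambda>y. f 1 y0 v * (B (\<Gamma> 1 v (of_real y)) / q 1 y ^ d')) \<longlongrightarrow> F1 (Je 1 (app M v)) * g 1 y0 v * 0 ^ (d - d')) (at_left 1)"
        by (rule Lim_transform_eventually)
      have "((\<lambda>y. f 1 y0 v * (B (\<Gamma> 1 v (of_real y)) / q 1 y ^ d')) \<longlongrightarrow> f 1 y0 v * G1 (Je 1 (app M v))) (at_left 1)"
        by (intro tendsto_mult tendsto_const Blim one2)
      from tendsto_unique[OF trivial_limit_at_left_real this l] show ?thesis unfolding Je1 z by auto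
    qed
    then have "G1 (app M v) * f 1 y0 v = G1 (app M v) * 0" for v by simp
    from binary_form_cancel[OF bG1 G10 detM cf c0 this] fp0 show ?thesis by blast
  qed
  have endrel: "f \<epsilon> y0 v * G1 (Je \<epsilon> (app M v)) = F1 (Je \<epsilon> (app M v)) * g \<epsilon> y0 v" if \<epsilon>: "\<epsilon>^2 = 1" for \<epsilon> v
  proof -
    have l1: "((\<lambda>y. f \<epsilon> y0 v * (B (\<Gamma> \<epsilon> v (of_real y)) / q \<epsilon> y ^ d)) \<longlongrightarrow> f \<epsilon> y0 v * G1 (Je \<epsilon> (app M v))) (at_left 1)"
      unfolding dd by (intro tendsto_mult tendsto_const Blim \<epsilon>)
    have l2: "((\<lambda>y. (A (\<Gamma> \<epsilon> v (of_real y)) / q \<epsilon> y ^ d) * g \<epsilon> y0 v) \<longlongrightarrow> F1 (Je \<epsilon> (app M v)) * g \<epsilon> y0 v) (at_left 1)"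
      by (intro tendsto_mult tendsto_const Alim \<epsilon>)
    have "((\<lambda>y. (A (\<Gamma> \<epsilon> v (of_real y)) / q \<epsilon> y ^ d) * g \<epsilon> y0 v) \<longlongrightarrow> f \<epsilon> y0 v * G1 (Je \<epsilon> (app M v))) (at_left 1)"
      by (rule Lim_transform_eventually[OF l1]) (rule eventually_mono[OF unit], rule ratio_end[OF \<epsilon>])
    from tendsto_unique[OF trivial_limit_at_left_real this l2] show ?thesis .
  qed
  note Ep = endrel[OF one2(1), unfolded Je1] and Em = endrel[OF one2(2), unfolded Je1]

  \<comment> \<open>From relations between the sheets to relations on one sheet\<close>
  define fp gp fm gm where "fp = f 1 y0" and "gp = g 1 y0" and "fm = f (-1) y0" and "gm = g (-1) y0"
  note fold = fp_def[symmetric] gp_def[symmetric] fm_def[symmetric] gm_def[symmetric]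
  have cont: "continuous_on UNIV fp" "continuous_on UNIV gp" "continuous_on UNIV fm" "continuous_on UNIV gm"
    unfolding fp_def gp_def fm_def gm_def by (rule cf cg)+
  have bgm: "binary_form m' gm" "\<exists>v. gm v \<noteq> 0" and bgp: "binary_form m' gp" "\<exists>v. gp v \<noteq> 0"
    using fg0 unfolding fold by auto
  have Ep': "fp v * G1 (app M v) = F1 (app M v) * gp v" and Em': "fm v * G1 (app J (app M v)) = F1 (app J (app M v)) * gm v" for v
    using Ep[of v] Em[of v] unfolding fold by auto
  \<comment> \<open>Constancy of the quotient between y0 and i y0, with the value at i y0
    transferred to the other sheet.\<close>
  have star1: "b * (fp v * gm (app rot4 v)) = a * (fm (app rot4 v) * gp v)" for v
    using ratio[OF one2(1) y0(1) y0i, of v, folded f_def g_def] unfolding frot grot fold by (simp add: mult_ac)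
  have star2: "b * (fm v * gp (app rot4 v)) = a * (fp (app rot4 v) * gm v)" for v
    using ratio[OF one2(2) y0(1) y0i, of v, folded f_def g_def] unfolding frot grot minus_minus fold by (simp add: mult_ac)
  have mdJM: "mdet (mul J M) \<noteq> 0" using detJ detM by (simp add: mdet_mul)
  \<comment> \<open>Both sheets have the same end forms \<open>F1\<close> and \<open>G1\<close>, up
    to \<open>J\<close>. Eliminating these identifies the quotient on the sheet -1 with the quotient
    on the sheet 1 composed with T.\<close>
  have star3: "fm v * gp (app T v) = gm v * fp (app T v)" for v
  proof -
    have 1: "F1 (app (mul J M) v) * (G1 (app (mul J M) v) * (fm v * gp (app T v)))
      = F1 (app (mul J M) v) * (G1 (app (mul J M) v) * (gm v * fp (app T v)))" for v
      using Ep'[of "app T v"] Em'[of v] unfolding MT app_mul by algebra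
    have cX: "continuous_on UNIV (\<lambda>v. G1 (app (mul J M) v))" by (rule continuous_app[OF cG1])
    have cL: "continuous_on UNIV (\<lambda>v. fm v * gp (app T v))" "continuous_on UNIV (\<lambda>v. gm v * fp (app T v))"
      by (intro continuous_on_mult cont cont[THEN continuous_app])+
    have 2: "G1 (app (mul J M) v) * (fm v * gp (app T v)) = G1 (app (mul J M) v) * (gm v * fp (app T v))" for v
      by (rule binary_form_cancel[OF bF1 F10 mdJM continuous_on_mult[OF cX cL(1)] continuous_on_mult[OF cX cL(2)] 1])
    show ?thesis by (rule binary_form_cancel[OF bG1 G10 mdJM cL 2])
  qed
  \<comment> \<open>\<open>star3\<close> is used to eliminate the forms of the sheet -1 from
    \<open>star1\<close>; the same is then done with \<open>star2\<close>.\<close>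
  have r1: "fp (app T (app rot4 v)) * gp v = (b / a) * fp v * gp (app T (app rot4 v))" for v
  proof -
    have cL: "continuous_on UNIV (\<lambda>v. a * (fp (app T (app rot4 v)) * gp v))" "continuous_on UNIV (\<lambda>v. b * (fp v * gp (app T (app rot4 v))))"
      by (intro continuous_on_mult cont cont[THEN continuous_app] cont[THEN continuous_app, THEN continuous_app] continuous_on_const)+
    have "gm (app rot4 v) * (a * (fp (app T (app rot4 v)) * gp v)) = gm (app rot4 v) * (b * (fp v * gp (app T (app rot4 v))))" for v
      using star1[of v] star3[of "app rot4 v"] by algebra
    from binary_form_cancel[OF bgm detS cL this, of v]
    have "a * (fp (app T (app rot4 v)) * gp v) = b * (fp v * gp (app T (app rot4 v)))" .
    then show ?thesis using ab0 by (simp add: field_simps)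
  qed
  have r2: "fp (app rot4 v) * gp (app T v) = (b / a) * fp (app T v) * gp (app rot4 v)" for v
  proof -
    have cL: "continuous_on UNIV (\<lambda>v. a * (fp (app rot4 v) * gp (app T v)))" "continuous_on UNIV (\<lambda>v. b * (fp (app T v) * gp (app rot4 v)))"
      by (intro continuous_on_mult cont cont[THEN continuous_app] cont[THEN continuous_app, THEN continuous_app] continuous_on_const)+
    have "gm (app (Mat2 1 0 0 1) v) * (a * (fp (app rot4 v) * gp (app T v))) = gm (app (Mat2 1 0 0 1) v) * (b * (fp (app T v) * gp (app rot4 v)))" for v
      unfolding app_id using star2[of v] star3[of v] by algebra
    from binary_form_cancel[OF bgm id1 cL this, of v]
    have "a * (fp (app rot4 v) * gp (app T v)) = b * (fp (app T v) * gp (app rot4 v))" .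
    then show ?thesis using ab0 by (simp add: field_simps)
  qed
  have "m = m' \<and> (\<exists>k. k \<noteq> 0 \<and> (\<forall>v. fp v = k * gp v))"
  proof (rule ratio_symmetric_imp_constant[OF _ _ bgp T_def _ _ k(1,3) _ r1 _ r2])
    show "binary_form m fp" "\<exists>v. fp v \<noteq> 0" using fg0 unfolding fold by auto
    have "(\<alpha> * \<delta> + \<beta> * \<gamma>)^2 + (- 2 * \<alpha> * \<gamma>) * (2 * \<beta> * \<delta>) = (\<alpha> * \<delta> - \<beta> * \<gamma>)^2"
      by (simp add: power2_eq_square algebra_simps)
    then show "(\<alpha> * \<delta> + \<beta> * \<gamma>)^2 + (- 2 * \<alpha> * \<gamma>) * (2 * \<beta> * \<delta>) = 1" unfolding det1 by simp
    show "(\<alpha> * \<delta> + \<beta> * \<gamma>)^2 = of_real k" using c2 k(2) by simp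
    show "b / a \<noteq> 0" "b / a \<noteq> 0" using ab0 by simp_all
  qed
  then obtain \<kappa> where mm: "m = m'" and \<kappa>: "\<kappa> \<noteq> 0" "\<And>v. fp v = \<kappa> * gp v" by blast

  \<comment> \<open>The constant found on the sheet 1 carries over to the end forms and from there
    to the sheet -1; inserted in \<open>star1\<close> it leaves a = b.\<close>
  have FG: "F1 (app M v) = \<kappa> * G1 (app M v)" for v
  proof (rule binary_form_cancel[OF bgp id1, where f = "\<lambda>v. F1 (app M v)" and g = "\<lambda>v. \<kappa> * G1 (app M v)"])
    show "gp (app (Mat2 1 0 0 1) v) * F1 (app M v) = gp (app (Mat2 1 0 0 1) v) * (\<kappa> * G1 (app M v))" for v
      using Ep'[of v] unfolding app_id \<kappa>(2) by auto
  qed (intro continuous_on_mult continuous_app[OF cF1] continuous_app[OF cG1] continuous_on_const)+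
  have fmk: "fm v = \<kappa> * gm v" for v
  proof (rule binary_form_cancel[OF bG1 G10 mdJM, where f = fm and g = "\<lambda>v. \<kappa> * gm v"])
    show "G1 (app (mul J M) v) * fm v = G1 (app (mul J M) v) * (\<kappa> * gm v)" for v
      using Em'[of v] FG[of "app T v"] unfolding MT app_mul by (simp add: mult_ac)
  qed (intro continuous_on_mult cont continuous_on_const)+
  have "a = b"
  proof -
    have "b * (\<kappa> * gp vs * gm (app rot4 vs)) = a * (\<kappa> * gm (app rot4 vs) * gp vs)"
      using star1[of vs] unfolding \<kappa>(2) fmk .
    then show ?thesis using \<kappa>(1) gp0 gm0 unfolding fold by simp
  qed
  \<comment> \<open>With m = m' the signs in a and b agree, so a = b says that 4 divides N - l,
    which supplies the exponent of \<open>h0\<close>.\<close>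
  then have iNl: "\<i>^N = \<i>^l" unfolding a_def b_def mm by simp
  obtain j where j: "N = l + 4 * j"
  proof -
    have "\<i>^N = \<i>^l * \<i>^(N - l)" using lN by (simp flip: power_add)
    then have i1: "\<i>^(N - l) = 1" using iNl by simp
    have "N - l = 4 * ((N - l) div 4) + (N - l) mod 4" by simp
    then have "\<i>^(N - l) = (\<i>^4)^((N - l) div 4) * \<i>^((N - l) mod 4)" by (metis power_add power_mult)
    also have "\<i>^4 = 1" by (simp add: power4_eq_xxxx)
    finally have im: "\<i>^((N - l) mod 4) = 1" using i1 by simp
    have "(N - l) mod 4 < 4" by simp
    then consider "(N - l) mod 4 = 0" | "(N - l) mod 4 = 1" | "(N - l) mod 4 = 2" | "(N - l) mod 4 = 3" by linarith
    then have "(N - l) mod 4 = 0"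
    proof cases
      case 2 with im show ?thesis by (simp add: complex_eq_iff)
    next
      case 3 with im show ?thesis by simp
    next
      case 4 with im show ?thesis by (simp add: power3_eq_cube complex_eq_iff)
    qed
    then have "N = l + 4 * ((N - l) div 4)" using lN by presburger
    then show ?thesis by (rule that)
  qed

  \<comment> \<open>Return from the curves to the whole phase space\<close>
  have AkB: "A (\<Gamma> 1 v y) = \<kappa> * B (\<Gamma> 1 v y)" if y: "norm y < 1" for v y
  proof -
    have "f 1 y v = \<kappa> * g 1 y v"
    proof (rule binary_form_cancel[OF bgp id1, where f = "f 1 y" and g = "\<lambda>v. \<kappa> * g 1 y v"])
      show "gp (app (Mat2 1 0 0 1) v) * f 1 y v = gp (app (Mat2 1 0 0 1) v) * (\<kappa> * g 1 y v)" for v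
        using ratio[OF one2(1) y y0(1), of v, folded f_def g_def] \<kappa>(2)[of v] unfolding app_id fold by (simp add: mult_ac)
    qed (intro continuous_on_mult cf cg continuous_on_const)+
    then show ?thesis by (simp add: f_def g_def)
  qed
  \<comment> \<open>Along the curves \<open>h0\<close> has the value \<omega>^2 / 2, so this
    constant makes c h0^j equal to \<kappa> there.\<close>
  define c where "c = \<kappa> / (\<omega>^2 / 2)^j"
  have "A z - c * (h0 z ^ j * B z) = 0" for z
  proof (rule slice_identity[where E = "\<lambda>z. A z - c * (h0 z ^ j * B z)" and n = N])
    show "curve_hol (\<lambda>z. A z - c * (h0 z ^ j * B z)) UNIV"
      by (intro curve_hol_diff curve_hol_mult curve_hol_power A B h0_curve_hol curve_hol_const)
    show "A (dilate s z) - c * (h0 (dilate s z) ^ j * B (dilate s z)) = s^N * (A z - c * (h0 z ^ j * B z))" if "s \<noteq> 0" for s z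
    proof -
      have "s^(l + 4 * j) = s^l * (s^4)^j" by (simp add: power_add power_mult)
      then show ?thesis
        unfolding Ad[OF that] Bd[OF that] h0_dilate j power_mult_distrib by (simp add: right_diff_distrib mult_ac)
    qed
    show "A (\<Gamma> 1 v y) - c * (h0 (\<Gamma> 1 v y) ^ j * B (\<Gamma> 1 v y)) = 0" if "norm y < 1" for v y
      unfolding AkB[OF that] h0G c_def using \<omega>0 by simp
  qed
  then have "trivial_pair A B N l" unfolding trivial_pair_def using j by (metis eq_iff_diff_eq_0 mult.assoc)
  with nt mm show False by blast
qed

theorem no_additional_integral:
  assumes "\<mu> / \<Lambda> \<notin> I1 \<union> I2 \<union> I3"
  shows "\<not> (\<exists>F. meromorphic_first_integral H F \<and> functionally_independent F H)"
proof
  assume "\<exists>F. meromorphic_first_integral H F \<and> functionally_independent F H"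
  then obtain P Q N l where "good_pair P Q N l" "\<not> trivial_pair P Q N l"
    using leading_pair_exists unfolding trivial_pair_def by blast
  from bihomogeneous_pair_exists[OF this] obtain A B m m' where "good_pair A B N l"
    and "\<And>s z. s \<noteq> 0 \<Longrightarrow> A (scal rw s z) = s^m * A z" "\<And>s z. s \<noteq> 0 \<Longrightarrow> B (scal rw s z) = s^m' * B z"
    and "m \<noteq> m' \<or> \<not> trivial_pair A B N l" by blast
  from no_nontrivial_pair[OF this assms] show False .
qed

end

theorem mainTheorem2:
  fixes \<Lambda> lam \<mu> lam1 lam2 lam3 :: real
  assumes "\<Lambda> \<noteq> 0" and "lam \<noteq> 0"
    and "lam1 = \<mu> / \<Lambda>" and "lam2 = \<mu> / lam" and "lam1 * lam2 \<noteq> 1"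
    and "lam3 = (lam1 * lam2 - 2 * (lam1 + lam2) + 3) / (1 - lam1 * lam2)"
    and "lam1 \<notin> I1 \<union> I2 \<union> I3" and "lam2 \<notin> I1 \<union> I2 \<union> I3" and "lam3 \<notin> I1 \<union> I2 \<union> I3"
  shows "\<not> (\<exists>F. meromorphic_first_integral (phantom_hamiltonian \<Lambda> lam \<mu>) F \<and>
               functionally_independent F (phantom_hamiltonian \<Lambda> lam \<mu>))"
proof -
  interpret phantom \<Lambda> lam \<mu> by unfold_locales (rule assms(1))
  have "\<mu> / \<Lambda> \<notin> I1 \<union> I2 \<union> I3" using assms(7) unfolding assms(3) .
  then show ?thesis by (rule no_additional_integral)
qed

end
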